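(* Let $q\in\mathbb N$ and let $\nu$ be a Borel probability measure on $\Pi_q$ with $\int_{\Pi_q}\|s\|^4\,d\nu(s)<\infty$. Let $(p_n)_{n\in\mathbb N}$ be a sequence of integers $p_n\ge q$ with $\lim_{n\to\infty}p_n=\infty$. For each $p\ge q$ let $X_k^p$ ($k\in\mathbb N$) be i.i.d. $\mathbb M_{p,q}$-valued random variables with law $\nu_p$, and let $S_n^p:=\sum_{k=1}^n X_k^p$. (1) If $\lim_{n\to\infty} n/p_n=\infty$, then the random matrix $$\frac{\sqrt{p_n}}{n}\Bigl(\varphi_{p_n}^2(S_n^{p_n})-n\int_{\Pi_q}s^2\,d\nu(s)\Bigr)$$ tends in distribution, as $n\to\infty$, to the normal distribution $\mathcal N(0,T^2(\nu))$ on the vector space $\mathbb M_q$. (2) If $\lim_{n\to\infty} n/p_n=c\in[0,\infty[$, then the random matrix $$\frac{1}{\sqrt n}\Bigl(\varphi_{p_n}^2(S_n^{p_n})-n\int_{\Pi_q}s^2\,d\nu(s)\Bigr)$$ tends in distribution, as $n\to\infty$, to the normal distribution $\mathcal N(0,\Sigma^2(\nu)+c\,T^2(\nu))$ on $\mathbb M_q$.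
   Context: $\mathbb M_{p,q}$ is the space of real $p\times q$ matrices, $\mathbb M_q:=\mathbb M_{q,q}$, $x'$ is the transpose of $x$, $\|x\|=\sqrt{\mathrm{tr}(x'x)}$, and $\Pi_q$ is the cone of positive semidefinite symmetric real $q\times q$ matrices. The map $\varphi_p:\mathbb M_{p,q}\to\Pi_q$ is $\varphi_p(x)=\sqrt{x'x}$ (positive semidefinite square root), and $\varphi_p^2(x)=x'x$. A measure on $\mathbb M_{p,q}$ is radial if it is invariant under $x\mapsto Ax$ for all $A$ in the orthogonal group $\mathbb O_p$. For $p\ge q$, $\nu_p$ denotes the unique radial probability measure on $\mathbb M_{p,q}$ whose image under $\varphi_p$ is $\nu$. Write $r_2(\nu):=\int_{\Pi_q}s^2\,d\nu(s)\in\Pi_q$. Covariance matrices of $\mathbb M_q$-valued random variables $Z$ are indexed by pairs of index pairs, with entries $\mathrm{Cov}(Z_{i,j},Z_{k,l})$ at position $((i,j),(k,l))$, $1\le i,j,k,l\le q$. The matrix $T^2(\nu)$ is given by $$T^2(\nu)_{(i,j),(k,l)}=r_2(\nu)_{i,k}\,r_2(\nu)_{j,l}+r_2(\nu)_{i,l}\,r_2(\nu)_{j,k},$$ and $\Sigma^2(\nu)$ is the covariance matrix of the random matrix $\varphi_p^2(X_1^p)$ (equivalently of $s^2$ where $s$ has law $\nu$), which depends only on $\nu$ and not on $p$. $\mathcal N(0,\Sigma)$ denotes the (possibly degenerate) centered Gaussian distribution on $\mathbb M_q$ with covariance matrix $\Sigma$. *)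

theory Defs
  imports "HOL-Probability.Probability"
begin

definition psd_cone :: "(real^'n^'n) set" where
  "psd_cone = {A. transpose A = A \<and> (\<forall>v. 0 \<le> v \<bullet> (A *v v))}"

definition psd_sqrt :: "real^'n^'n \<Rightarrow> real^'n^'n" where
  "psd_sqrt A = (THE B. B \<in> psd_cone \<and> B ** B = A)"

text \<open>
  The number \<open>q\<close> of columns is the cardinality of the index type, while the number \<open>p\<close> of rows
  varies with a sequence index. A \<open>p \<times> q\<close> matrix is therefore an extensional function on
  \<open>{..<p}\<close> giving its rows. The product sigma algebra on these functions is the Borel sigma
  algebra of the space of \<open>p \<times> q\<close> matrices.
\<close>

definition rect_mat :: "nat \<Rightarrow> (nat \<Rightarrow> real^'q) measure" where
  "rect_mat p = (\<Pi>\<^sub>M i\<in>{..<p}. borel)"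

definition gram :: "nat \<Rightarrow> (nat \<Rightarrow> real^'q) \<Rightarrow> real^'q^'q" where
  "gram p x = (\<chi> j k. \<Sum>i<p. x i $ j * x i $ k)"

definition phi :: "nat \<Rightarrow> (nat \<Rightarrow> real^'q) \<Rightarrow> real^'q^'q" where
  "phi p x = psd_sqrt (gram p x)"

definition orthogonal_group :: "nat \<Rightarrow> (nat \<Rightarrow> nat \<Rightarrow> real) set" where
  "orthogonal_group p =
    {A. \<forall>i<p. \<forall>j<p. (\<Sum>k<p. A k i * A k j) = (if i = j then 1 else 0)}"

definition left_mult :: "nat \<Rightarrow> (nat \<Rightarrow> nat \<Rightarrow> real) \<Rightarrow> (nat \<Rightarrow> real^'q) \<Rightarrow> nat \<Rightarrow> real^'q" where
  "left_mult p A x = (\<lambda>i\<in>{..<p}. \<Sum>j<p. A i j *\<^sub>R x j)"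

definition radial :: "nat \<Rightarrow> (nat \<Rightarrow> real^'q) measure \<Rightarrow> bool" where
  "radial p \<mu> \<longleftrightarrow> (\<forall>A\<in>orthogonal_group p. distr \<mu> (rect_mat p) (left_mult p A) = \<mu>)"

text \<open>
  For \<open>p \<ge> q\<close> the following property determines \<open>\<mu>\<close> uniquely; it is the measure usually
  written \<open>\<nu>\<^sub>p\<close>.
\<close>

definition radial_lift ::
  "nat \<Rightarrow> (real^'q^'q) measure \<Rightarrow> (nat \<Rightarrow> real^'q) measure \<Rightarrow> bool" where
  "radial_lift p \<nu> \<mu> \<longleftrightarrow>
     prob_space \<mu> \<and> sets \<mu> = sets (rect_mat p) \<and> radial p \<mu> \<and>
     distr \<mu> (restrict_space borel psd_cone) (phi p) = \<nu>"

definition partial_sum ::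
  "nat \<Rightarrow> (nat \<Rightarrow> 'w \<Rightarrow> nat \<Rightarrow> real^'q) \<Rightarrow> nat \<Rightarrow> 'w \<Rightarrow> nat \<Rightarrow> real^'q" where
  "partial_sum p X n \<omega> = (\<lambda>i\<in>{..<p}. \<Sum>k<n. X k \<omega> i)"

definition r2 :: "(real^'q^'q) measure \<Rightarrow> real^'q^'q" where
  "r2 \<nu> = (LINT s|\<nu>. s ** s)"

definition covariance_matrix :: "'w measure \<Rightarrow> ('w \<Rightarrow> real^'q^'q) \<Rightarrow> real^('q \<times> 'q)^('q \<times> 'q)" where
  "covariance_matrix M Z = (\<chi> a b.
     LINT \<omega>|M. (Z \<omega> $ fst a $ snd a - (LINT \<omega>'|M. Z \<omega>' $ fst a $ snd a)) *
              (Z \<omega> $ fst b $ snd b - (LINT \<omega>'|M. Z \<omega>' $ fst b $ snd b)))"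

definition T2 :: "(real^'q^'q) measure \<Rightarrow> real^('q \<times> 'q)^('q \<times> 'q)" where
  "T2 \<nu> = (\<chi> a b. r2 \<nu> $ fst a $ fst b * r2 \<nu> $ snd a $ snd b +
                  r2 \<nu> $ fst a $ snd b * r2 \<nu> $ snd a $ fst b)"

definition Sigma2 :: "(real^'q^'q) measure \<Rightarrow> real^('q \<times> 'q)^('q \<times> 'q)" where
  "Sigma2 \<nu> = covariance_matrix \<nu> (\<lambda>s. s ** s)"

text \<open>
  The centered normal distribution with (possibly singular) covariance matrix \<open>\<Sigma>\<close> is the law of
  \<open>psd_sqrt \<Sigma> *v Z\<close>, where the coordinates of \<open>Z\<close> are independent standard normal variables.
\<close>

definition centered_normal :: "real^'n^'n \<Rightarrow> (real^'n) measure" where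
  "centered_normal \<Sigma> =
     distr (\<Pi>\<^sub>M i\<in>UNIV. std_normal_distribution) borel (\<lambda>z. psd_sqrt \<Sigma> *v (\<chi> i. z i))"

definition centered_matrix_normal :: "real^('q \<times> 'q)^('q \<times> 'q) \<Rightarrow> (real^'q^'q) measure" where
  "centered_matrix_normal \<Sigma> = distr (centered_normal \<Sigma>) borel (\<lambda>v. \<chi> i j. v $ (i, j))"

definition converges_weakly :: "(nat \<Rightarrow> 'a::topological_space measure) \<Rightarrow> 'a measure \<Rightarrow> bool" where
  "converges_weakly \<mu> \<mu>' \<longleftrightarrow>
     (\<forall>f::'a \<Rightarrow> real. continuous_on UNIV f \<and> bounded (range f) \<longrightarrow>
        (\<lambda>n. LINT x|\<mu> n. f x) \<longlonglongrightarrow> (LINT x|\<mu>'. f x))"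

definition tends_in_distribution ::
  "(nat \<Rightarrow> 'w measure) \<Rightarrow> (nat \<Rightarrow> 'w \<Rightarrow> 'a::topological_space) \<Rightarrow> 'a measure \<Rightarrow> bool" where
  "tends_in_distribution M Z \<mu> \<longleftrightarrow> converges_weakly (\<lambda>n. distr (M n) borel (Z n)) \<mu>"

end

theory Submission
  imports Defs
begin

text \<open>
  Let \<open>S\<close> be the sum of the first \<open>n\<close> matrices in dimension \<open>p\<close> and let \<open>r\<close> be the mean of \<open>s\<^sup>2\<close>.
  Both parts of the theorem are one statement about scaling factors \<open>\<tau>\<close>: if \<open>n \<tau>\<^sup>2\<close> tends to
  \<open>\<gamma>\<close> and \<open>n\<^sup>2 \<tau>\<^sup>2 / p\<close> tends to \<open>\<delta>\<close> while \<open>p\<close> tends to infinity, then \<open>\<tau> (S'S - n r)\<close> tends to the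
  normal distribution with covariance \<open>\<gamma> \<Sigma>\<^sup>2 + \<delta> T\<^sup>2\<close> (lemma \<open>radial_clt\<close>). The first part is the
  case \<open>\<gamma> = 0\<close>, \<open>\<delta> = 1\<close>, the second the case \<open>\<gamma> = 1\<close>, \<open>\<delta> = c\<close>.

  Adding a matrix \<open>x\<close> to a sum \<open>S\<close> of \<open>m\<close> matrices changes \<open>S'S - m r\<close> by
  \<open>(x'x - r) + (S'x + x'S)\<close>. Given \<open>S\<close>, both summands have mean zero, and they are uncorrelated,
  because \<open>x\<close> and \<open>-x\<close> have the same law. The first summand has covariance \<open>\<Sigma>\<^sup>2\<close> in every
  dimension. Invariance under reflections makes different rows of \<open>x\<close> uncorrelated, with second
  moments \<open>r / p\<close> (\<open>integral_entry2\<close>), so the covariance of the second summand is \<open>1 / p\<close> times a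
  linear function of \<open>S'S\<close>. As \<open>S'S\<close> is close to \<open>m r\<close>, this covariance is close to
  \<open>2 m T\<^sup>2 / p\<close>, and the sum over \<open>m < n\<close> is \<open>n \<Sigma>\<^sup>2 + (n\<^sup>2 / p) T\<^sup>2\<close> to leading order.

  So \<open>S'S - n r\<close> is a martingale whose conditional covariances are nearly deterministic. For a
  fixed matrix \<open>t\<close> each step multiplies the characteristic function at \<open>t\<close> by about \<open>exp (-v / 2)\<close>,
  where \<open>v\<close> is the deterministic approximation of the conditional variance (\<open>char_walk_step\<close>); the
  errors of the \<open>n\<close> steps add up (\<open>char_walk_bound\<close>). Three estimates make the total
  error vanish: a truncated moment of \<open>x'x - r\<close>, which has only two moments; the bound
  of order \<open>p\<^sup>-\<^sup>2\<close> for the fourth moments of single entries (\<open>fourth_moment_entry\<close>); and the second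
  moment of the fluctuation of \<open>S'S\<close> (\<open>integral_centred_sq\<close>).

  Convergence of characteristic functions gives weak convergence by Levy's continuity theorem in a
  Euclidean space (\<open>levy_continuity_euclidean\<close>). Existence and uniqueness of positive semidefinite
  square roots turn \<open>\<phi>\<^sup>2\<close> into the Gram matrix \<open>S'S\<close> and give the characteristic function of the
  limit.
\<close>

section \<open>Square roots of positive semidefinite matrices\<close>

text \<open>
  A unit vector of the subspace that maximizes the quadratic form is an eigenvector: moving it in an
  orthogonal direction cannot increase the form to first order. Its orthogonal complement within the
  subspace is again invariant, so induction on the dimension yields the rest of the basis.
\<close>

lemma symmetric_eigenbasis:
  fixes f :: "'a::euclidean_space \<Rightarrow> 'a"
  assumes f: "linear f" and sym: "\<And>x y. f x \<bullet> y = x \<bullet> f y"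
  assumes "subspace S" "f ` S \<subseteq> S"
  shows "\<exists>B. finite B \<and> pairwise orthogonal B \<and> B \<subseteq> S \<and> span B = S \<and>
           (\<forall>b\<in>B. norm b = 1 \<and> (\<exists>c. f b = c *\<^sub>R b))"
  using assms(3,4)
proof (induction "dim S" arbitrary: S rule: less_induct)
  case less
  show ?case
  proof (cases "S \<subseteq> {0}")
    case True
    then have "S = {0}" using less.prems subspace_0 by blast
    then show ?thesis by (intro exI[of _ "{}"]) auto
  next
    case False
    then obtain s where s: "s \<in> S" "s \<noteq> 0" by auto
    define K where "K = S \<inter> sphere 0 1"
    have "compact K"
      unfolding K_def using less.prems(1) by (simp add: closed_subspace closed_Int_compact)
    moreover have "s /\<^sub>R norm s \<in> K"
      unfolding K_def using s less.prems(1) by (simp add: subspace_scale)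
    moreover have "continuous_on K (\<lambda>x. x \<bullet> f x)"
      using f by (intro continuous_intros linear_continuous_on) (simp add: linear_conv_bounded_linear)
    ultimately obtain u where u: "u \<in> K" and max: "\<And>x. x \<in> K \<Longrightarrow> x \<bullet> f x \<le> u \<bullet> f u"
      using continuous_attains_sup[of K "\<lambda>x. x \<bullet> f x"] by blast
    define c where "c = u \<bullet> f u"
    have uS: "u \<in> S" and nu: "norm u = 1" using u by (auto simp: K_def)
    have uu: "u \<bullet> u = 1" using nu by (simp add: norm_eq_1)
    have bound: "x \<bullet> f x \<le> c * (x \<bullet> x)" if "x \<in> S" for x
    proof (cases "x = 0")
      case True then show ?thesis by simp
    next
      case False
      have "x /\<^sub>R norm x \<in> K"
        unfolding K_def using that False less.prems(1) by (simp add: subspace_scale)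
      from max[OF this] have "(x \<bullet> f x) / (norm x)^2 \<le> c"
        using f by (simp add: c_def linear_cmul power2_eq_square divide_simps)
      then show ?thesis using False by (simp add: divide_simps power2_norm_eq_inner)
    qed
    have orth: "w \<bullet> f u = 0" if w: "w \<in> S" "w \<bullet> u = 0" for w
    proof (rule ccontr)
      assume nz: "w \<bullet> f u \<noteq> 0"
      define d where "d = c * (w \<bullet> w) - w \<bullet> f w"
      have d0: "0 \<le> d" using bound[OF w(1)] by (simp add: d_def)
      have quad: "2 * e * (w \<bullet> f u) \<le> e^2 * d" for e
      proof -
        have "u + e *\<^sub>R w \<in> S" using uS w less.prems(1) by (simp add: subspace_add subspace_scale)
        from bound[OF this]
        have "u \<bullet> f u + e * (u \<bullet> f w) + e * (w \<bullet> f u) + e^2 * (w \<bullet> f w) \<le> c * (1 + e^2 * (w \<bullet> w))"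
          using f w uu by (simp add: linear_add linear_cmul inner_add_left inner_add_right
              inner_commute[of u w] power2_eq_square algebra_simps)
        moreover have "u \<bullet> f w = w \<bullet> f u" using sym[of w u] by (simp add: inner_commute)
        ultimately show ?thesis by (simp add: c_def d_def algebra_simps)
      qed
      \<comment> \<open>the added 1 keeps the denominator positive when \<open>d = 0\<close>\<close>
      define e where "e = (w \<bullet> f u) / (d + 1)"
      have "e^2 * d = e * (w \<bullet> f u) * (d / (d + 1))"
        using d0 by (simp add: e_def power2_eq_square)
      also have "\<dots> \<le> e * (w \<bullet> f u)"
        using d0 by (intro mult_left_le) (auto simp: e_def)
      finally have "2 * e * (w \<bullet> f u) \<le> e * (w \<bullet> f u)" using quad[of e] by linarith
      moreover have "e * (w \<bullet> f u) > 0"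
      proof -
        have "(w \<bullet> f u)^2 > 0" using nz by simp
        then show ?thesis using d0 by (simp add: e_def power2_eq_square)
      qed
      ultimately show False by linarith
    qed
    have fu: "f u = c *\<^sub>R u"
    proof -
      define r where "r = f u - c *\<^sub>R u"
      have "r \<in> S" using uS less.prems by (auto simp: r_def subspace_diff subspace_scale)
      moreover have "r \<bullet> u = 0" by (simp add: r_def inner_diff_left uu c_def inner_commute[of "f u"])
      moreover have "r \<bullet> r = r \<bullet> f u - c * (r \<bullet> u)"
        by (subst (2) r_def) (simp add: inner_diff_right)
      ultimately have "r = 0" using orth[of r] by simp
      then show ?thesis by (simp add: r_def)
    qed
    define S' where "S' = S \<inter> {x. u \<bullet> x = 0}"
    have S'sub: "subspace S'" unfolding S'_def
      using less.prems(1) by (intro subspace_inter) (auto simp: subspace_hyperplane)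
    have "u \<notin> S'" using uu by (simp add: S'_def)
    moreover have "S' \<subseteq> S" by (simp add: S'_def)
    ultimately have "S' \<subset> S" using uS by blast
    then have "dim S' < dim S"
      using S'sub less.prems(1) by (intro dim_psubset) (simp add: span_eq_iff[THEN iffD2])
    moreover have "f ` S' \<subseteq> S'"
      using less.prems(2) sym fu by (auto simp: S'_def) (metis inner_scaleR_left mult_zero_right)
    ultimately obtain B where B: "finite B" "pairwise orthogonal B" "B \<subseteq> S'" "span B = S'"
       "\<forall>b\<in>B. norm b = 1 \<and> (\<exists>c. f b = c *\<^sub>R b)"
      using less.hyps[OF _ S'sub] by blast
    have "span (insert u B) = S"
    proof
      show "span (insert u B) \<subseteq> S"
        using uS B(3) less.prems(1) by (intro span_minimal) (auto simp: S'_def)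
      show "S \<subseteq> span (insert u B)"
      proof
        fix x assume x: "x \<in> S"
        have "x - (u \<bullet> x) *\<^sub>R u \<in> S'"
          using x uS less.prems(1) by (simp add: S'_def subspace_diff subspace_scale inner_diff_right uu)
        then have "x - (u \<bullet> x) *\<^sub>R u \<in> span B" using B(4) by simp
        then show "x \<in> span (insert u B)" by (auto simp: span_insert)
      qed
    qed
    then show ?thesis
      using B nu fu uS
      by (intro exI[of _ "insert u B"])
         (auto simp: pairwise_insert orthogonal_def S'_def inner_commute)
  qed
qed

lemma psd_coneD:
  assumes "A \<in> psd_cone"
  shows "transpose A = A" "0 \<le> v \<bullet> (A *v v)" "(A *v x) \<bullet> y = x \<bullet> (A *v y)"
proof -
  show t: "transpose A = A" "0 \<le> v \<bullet> (A *v v)" using assms by (auto simp: psd_cone_def)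
  show "(A *v x) \<bullet> y = x \<bullet> (A *v y)"
    by (metis dot_lmul_matrix t(1) transpose_matrix_vector)
qed

lemma psd_root_exists:
  assumes A: "A \<in> psd_cone"
  shows "\<exists>B. B \<in> psd_cone \<and> B ** B = A"
proof -
  obtain E where E: "finite E" "pairwise orthogonal E" "span E = UNIV"
      "\<forall>b\<in>E. norm b = 1 \<and> (\<exists>c. A *v b = c *\<^sub>R b)"
    using symmetric_eigenbasis[of "(*v) A" UNIV] psd_coneD(3)[OF A] by auto
  then obtain c where c: "\<And>b. b \<in> E \<Longrightarrow> A *v b = c b *\<^sub>R b" by metis
  have c0: "0 \<le> c b" if "b \<in> E" for b
    using psd_coneD(2)[OF A, of b] c[OF that] E(4) that by (simp add: norm_eq_1)
  have ortho: "b \<bullet> d = (if b = d then 1 else 0)" if "b \<in> E" "d \<in> E" for b d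
    using E(2,4) that by (auto simp: pairwise_def orthogonal_def norm_eq_1)
  have expand: "(\<Sum>b\<in>E. (b \<bullet> x) *\<^sub>R b) = x" for x
    using orthonormal_basis_expand[of E x] E by (auto simp: inner_commute)
  define g where "g x = (\<Sum>b\<in>E. (sqrt (c b) * (b \<bullet> x)) *\<^sub>R b)" for x
  have lin: "linear g"
    by (rule linearI) (auto simp: g_def inner_add_right algebra_simps sum.distrib scaleR_sum_right)
  define B where "B = matrix g"
  have Bv: "B *v x = g x" for x using lin by (simp add: B_def matrix_works)
  have inner_g: "y \<bullet> g x = (\<Sum>b\<in>E. sqrt (c b) * (b \<bullet> x) * (b \<bullet> y))" for x y
    by (simp add: g_def inner_sum_right inner_commute)
  have "transpose B = B"
  proof -
    have "(transpose B *v x) \<bullet> y = (B *v x) \<bullet> y" for x y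
    proof -
      have "(transpose B *v x) \<bullet> y = x \<bullet> g y" by (simp add: transpose_matrix_vector dot_lmul_matrix Bv)
      also have "\<dots> = y \<bullet> g x" unfolding inner_g by (intro sum.cong) auto
      finally show ?thesis by (simp add: Bv inner_commute)
    qed
    then show ?thesis by (metis matrix_eq vector_eq_rdot)
  qed
  moreover have "0 \<le> v \<bullet> (B *v v)" for v
    using c0 by (auto simp: Bv inner_g mult.assoc intro!: sum_nonneg)
  moreover have "B ** B = A"
  proof -
    have "(B ** B) *v x = A *v x" for x
    proof -
      have 1: "b \<bullet> g x = sqrt (c b) * (b \<bullet> x)" if "b \<in> E" for b
        using that E(1) by (simp add: inner_g ortho if_distrib if_distribR sum.delta cong: if_cong)
      have "(B ** B) *v x = g (g x)" by (simp add: Bv flip: matrix_vector_mul_assoc)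
      also have "\<dots> = (\<Sum>b\<in>E. (c b * (b \<bullet> x)) *\<^sub>R b)"
        unfolding g_def[of "g x"] using 1 c0 by (intro sum.cong) auto
      also have "\<dots> = A *v (\<Sum>b\<in>E. (b \<bullet> x) *\<^sub>R b)"
        using c by (simp add: linear_sum[OF matrix_vector_mul_linear] matrix_vector_mult_scaleR mult.commute)
      finally show ?thesis by (simp add: expand)
    qed
    then show ?thesis by (simp add: matrix_eq)
  qed
  ultimately show ?thesis by (auto simp: psd_cone_def)
qed

text \<open>
  With \<open>R\<close> a symmetric root of \<open>B\<close>, the form is the squared length of \<open>R v\<close>.
\<close>

lemma psd_form_zero:
  assumes B: "B \<in> psd_cone" and "v \<bullet> (B *v v) = 0"
  shows "B *v v = 0"
proof -
  obtain R where R: "R \<in> psd_cone" "R ** R = B" using psd_root_exists[OF B] by blast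
  have "(R *v v) \<bullet> (R *v v) = 0"
    using assms(2) R psd_coneD(3)[OF R(1), of v "R *v v"] by (simp add: matrix_vector_mul_assoc)
  then have "R *v v = 0" by simp
  then show ?thesis using R(2) by (metis matrix_vector_mul_assoc matrix_vector_mult_0_right)
qed

text \<open>
  For \<open>D = B - C\<close>, equality of the squares means \<open>B D + D C = 0\<close>. Multiplying by \<open>D\<close> and taking traces
  gives \<open>tr (D B D) + tr (D C D) = 0\<close>. Both traces are nonnegative, so both vanish and
  \<open>B D = C D = 0\<close>; hence \<open>D\<^sup>2 = 0\<close>, and \<open>D = 0\<close> by symmetry.
\<close>

lemma psd_root_unique:
  assumes B: "B \<in> psd_cone" and C: "C \<in> psd_cone" and eq: "B ** B = C ** C"
  shows "B = C"
proof -
  define D where "D = B - C"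
  have Dv: "D *v x = B *v x - C *v x" for x by (simp add: D_def matrix_vector_mult_diff_rdistrib)
  have symD: "(D *v x) \<bullet> y = x \<bullet> (D *v y)" for x y
    using psd_coneD(3)[OF B] psd_coneD(3)[OF C] by (simp add: Dv inner_diff_left inner_diff_right)
  have BB: "B *v (B *v x) = C *v (C *v x)" for x using eq by (simp add: matrix_vector_mul_assoc)
  have anti: "B *v (D *v x) + D *v (C *v x) = 0" for x
    using BB[of x] by (simp add: Dv matrix_vector_mult_diff_distrib)
  define q where "q E = (\<Sum>i\<in>Basis. (D *v i) \<bullet> (E *v (D *v i)))" for E
  have trace_cyc: "(\<Sum>i\<in>Basis. i \<bullet> f (g i)) = (\<Sum>i\<in>Basis. i \<bullet> g (f i))"
    if "linear f" "linear g" for f g :: "real^'a \<Rightarrow> real^'a"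
  proof -
    have "(\<Sum>i\<in>Basis. i \<bullet> f (g i)) = (\<Sum>i\<in>Basis. \<Sum>j\<in>Basis. (g i \<bullet> j) * (i \<bullet> f j))"
      if "linear f" for f g :: "real^'a \<Rightarrow> real^'a"
    proof (intro sum.cong refl)
      fix i :: "real^'a" assume "i \<in> Basis"
      have "i \<bullet> f (g i) = i \<bullet> f (\<Sum>j\<in>Basis. (g i \<bullet> j) *\<^sub>R j)" by (simp add: euclidean_representation)
      also have "\<dots> = (\<Sum>j\<in>Basis. (g i \<bullet> j) * (i \<bullet> f j))"
        using that by (simp add: linear_sum linear_cmul inner_sum_right)
      finally show "i \<bullet> f (g i) = \<dots>" .
    qed
    note dbl = this
    have "(\<Sum>i\<in>Basis. i \<bullet> f (g i)) = (\<Sum>j\<in>Basis. \<Sum>i\<in>Basis. (g i \<bullet> j) * (i \<bullet> f j))"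
      unfolding dbl[OF that(1)] by (rule sum.swap)
    also have "\<dots> = (\<Sum>i\<in>Basis. i \<bullet> g (f i))"
      unfolding dbl[OF that(2)] by (intro sum.cong refl) (simp add: inner_commute mult.commute)
    finally show ?thesis .
  qed
  have "q B + q C = 0"
  proof -
    have "q C = (\<Sum>i\<in>Basis. i \<bullet> (D *v (C *v (D *v i))))"
      by (simp add: q_def symD)
    also have "\<dots> = (\<Sum>i\<in>Basis. i \<bullet> (D *v (D *v (C *v i))))"
      using trace_cyc[of "\<lambda>x. D *v (C *v x)" "\<lambda>x. D *v x"]
      by (simp add: linear_compose[unfolded o_def, of "(*v) C" "(*v) D"])
    finally have "q B + q C = (\<Sum>i\<in>Basis. i \<bullet> (D *v (B *v (D *v i) + D *v (C *v i))))"
      by (simp add: q_def symD matrix_vector_right_distrib inner_add_right sum.distrib)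
    then show ?thesis by (simp add: anti)
  qed
  moreover have q0: "0 \<le> q E" if "E \<in> psd_cone" for E
    unfolding q_def using psd_coneD(2)[OF that] by (auto intro: sum_nonneg)
  ultimately have "q B = 0" "q C = 0" using q0[OF B] q0[OF C] by linarith+
  have z: "E *v (D *v i) = 0" if "E \<in> psd_cone" "q E = 0" "i \<in> Basis" for E i
  proof -
    have "(D *v i) \<bullet> (E *v (D *v i)) = 0"
      using that psd_coneD(2)[OF that(1)] unfolding q_def by (subst (asm) sum_nonneg_eq_0_iff) auto
    then show ?thesis by (rule psd_form_zero[OF that(1)])
  qed
  have "D *v i = 0" if "i \<in> Basis" for i
  proof -
    have "D *v (D *v i) = 0" using z[OF B \<open>q B = 0\<close> that] z[OF C \<open>q C = 0\<close> that] by (simp add: Dv)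
    then have "(D *v i) \<bullet> (D *v i) = 0" by (simp add: symD)
    then show ?thesis by simp
  qed
  then have "(*v) D = (\<lambda>x. 0)"
    by (intro linear_eq_stdbasis[of "(*v) D" "\<lambda>x. 0"]) (auto simp: linear_zero)
  then have "D *v x = 0 *v x" for x by (simp add: fun_eq_iff)
  then have "D = 0" by (simp add: matrix_eq)
  then show ?thesis by (simp add: D_def)
qed

lemma psd_sqrt:
  assumes "A \<in> psd_cone"
  shows psd_sqrt_in_psd_cone: "psd_sqrt A \<in> psd_cone"
    and psd_sqrt_mult_self: "psd_sqrt A ** psd_sqrt A = A"
proof -
  have "\<exists>!B. B \<in> psd_cone \<and> B ** B = A"
    using psd_root_exists[OF assms] psd_root_unique by metis
  from theI'[OF this] show "psd_sqrt A \<in> psd_cone" "psd_sqrt A ** psd_sqrt A = A"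
    by (auto simp: psd_sqrt_def)
qed

lemma gram_in_psd_cone: "gram p x \<in> psd_cone"
proof -
  have "v \<bullet> (gram p x *v v) = (\<Sum>a<p. (x a \<bullet> v)^2)" for v
  proof -
    have "v \<bullet> (gram p x *v v) = (\<Sum>i\<in>UNIV. \<Sum>j\<in>UNIV. \<Sum>a<p. x a $ i * v $ i * (x a $ j * v $ j))"
      by (simp add: inner_vec_def matrix_vector_mult_def gram_def sum_distrib_left sum_distrib_right mult_ac)
    also have "\<dots> = (\<Sum>i\<in>UNIV. \<Sum>a<p. \<Sum>j\<in>UNIV. x a $ i * v $ i * (x a $ j * v $ j))"
      by (intro sum.cong refl sum.swap)
    also have "\<dots> = (\<Sum>a<p. \<Sum>i\<in>UNIV. \<Sum>j\<in>UNIV. x a $ i * v $ i * (x a $ j * v $ j))"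
      by (rule sum.swap)
    also have "\<dots> = (\<Sum>a<p. (x a \<bullet> v)^2)"
      by (simp add: inner_vec_def power2_eq_square sum_product)
    finally show ?thesis .
  qed
  moreover have "transpose (gram p x) = gram p x"
    by (simp add: transpose_def gram_def mult.commute)
  ultimately show ?thesis by (simp add: psd_cone_def sum_nonneg)
qed

lemma phi_mult_self: "phi p x ** phi p x = gram p x"
  by (simp add: phi_def psd_sqrt_mult_self gram_in_psd_cone)

section \<open>Levy's continuity theorem in Euclidean space\<close>

text \<open>
  The functions whose integrals are controlled directly by characteristic functions. Bounded continuous
  functions are approximated by them.
\<close>

inductive trig_poly :: "('a::euclidean_space \<Rightarrow> real) \<Rightarrow> bool" where
  cos: "trig_poly (\<lambda>x. cos (t \<bullet> x))"
| sin: "trig_poly (\<lambda>x. sin (t \<bullet> x))"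
| add: "trig_poly f \<Longrightarrow> trig_poly g \<Longrightarrow> trig_poly (\<lambda>x. f x + g x)"
| scale: "trig_poly f \<Longrightarrow> trig_poly (\<lambda>x. c * f x)"

lemma trig_poly_const: "trig_poly (\<lambda>x. c)"
  using trig_poly.scale[OF trig_poly.cos[of 0], of c] by simp

text \<open>
  Product-to-sum formulas: this closure is what makes the Stone--Weierstrass theorem applicable.
\<close>

lemma trig_poly_mult:
  assumes "trig_poly f" "trig_poly g"
  shows "trig_poly (\<lambda>x. f x * g x)"
  using assms
proof (induction arbitrary: g)
  case (cos s)
  from cos.prems show ?case
  proof induction
    case (cos t)
    have "(\<lambda>x. cos (s \<bullet> x) * cos (t \<bullet> x)) =
        (\<lambda>x. (1/2) * cos ((s - t) \<bullet> x) + (1/2) * cos ((s + t) \<bullet> x))"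
      by (simp add: fun_eq_iff cos_times_cos inner_diff_left inner_add_left add_divide_distrib)
    then show ?case by (simp only:) (intro trig_poly.add trig_poly.scale trig_poly.cos)
  next
    case (sin t)
    have "(\<lambda>x. cos (s \<bullet> x) * sin (t \<bullet> x)) =
        (\<lambda>x. (1/2) * sin ((s + t) \<bullet> x) + (-1/2) * sin ((s - t) \<bullet> x))"
      by (simp add: fun_eq_iff cos_times_sin inner_diff_left inner_add_left diff_divide_distrib)
    then show ?case by (simp only:) (intro trig_poly.add trig_poly.scale trig_poly.sin)
  next
    case (add f g)
    then show ?case by (simp add: distrib_left trig_poly.add)
  next
    case (scale f c)
    from trig_poly.scale[OF scale.IH, of c] show ?case by (simp add: mult_ac)
  qed
next
  case (sin s)
  from sin.prems show ?case
  proof induction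
    case (cos t)
    have "(\<lambda>x. sin (s \<bullet> x) * cos (t \<bullet> x)) =
        (\<lambda>x. (1/2) * sin ((s + t) \<bullet> x) + (1/2) * sin ((s - t) \<bullet> x))"
      by (simp add: fun_eq_iff sin_times_cos inner_diff_left inner_add_left add_divide_distrib)
    then show ?case by (simp only:) (intro trig_poly.add trig_poly.scale trig_poly.sin)
  next
    case (sin t)
    have "(\<lambda>x. sin (s \<bullet> x) * sin (t \<bullet> x)) =
        (\<lambda>x. (1/2) * cos ((s - t) \<bullet> x) + (-1/2) * cos ((s + t) \<bullet> x))"
      by (simp add: fun_eq_iff sin_times_sin inner_diff_left inner_add_left diff_divide_distrib)
    then show ?case by (simp only:) (intro trig_poly.add trig_poly.scale trig_poly.cos)
  next
    case (add f g)
    then show ?case by (simp add: distrib_left trig_poly.add)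
  next
    case (scale f c)
    from trig_poly.scale[OF scale.IH, of c] show ?case by (simp add: mult_ac)
  qed
next
  case (add f1 f2)
  then show ?case by (simp add: distrib_right trig_poly.add)
next
  case (scale f c)
  from trig_poly.scale[OF scale.IH[OF scale.prems], of c] show ?case by (simp add: mult_ac)
qed

lemma trig_poly_continuous: "trig_poly f \<Longrightarrow> continuous_on S f"
  by (induction rule: trig_poly.induct) (auto intro!: continuous_intros)

lemma trig_poly_bounded: "trig_poly f \<Longrightarrow> \<exists>C. \<forall>x. \<bar>f x\<bar> \<le> C"
proof (induction rule: trig_poly.induct)
  case (add f g)
  then obtain C D where "\<forall>x. \<bar>f x\<bar> \<le> C" "\<forall>x. \<bar>g x\<bar> \<le> D" by blast
  then have "\<forall>x. \<bar>f x + g x\<bar> \<le> C + D" by (meson abs_triangle_ineq add_mono order_trans)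
  then show ?case by blast
next
  case (scale f c)
  then obtain C where "\<forall>x. \<bar>f x\<bar> \<le> C" by blast
  then have "\<forall>x. \<bar>c * f x\<bar> \<le> \<bar>c\<bar> * C" by (simp add: abs_mult mult_left_mono)
  then show ?case by blast
qed (auto intro: exI[of _ 1])

text \<open>
  A continuous function that is at least 1 outside the cube of half-width \<open>K + 1\<close> and vanishes on the
  cube of half-width \<open>K\<close>. Its integral bounds the mass outside a cube, and, being a sum of functions of
  single coordinates, it is accessible to the one-dimensional continuity theorem.
\<close>

definition tail_fun :: "real \<Rightarrow> 'a::euclidean_space \<Rightarrow> real" where
  "tail_fun K x = (\<Sum>b\<in>Basis. min 1 (max 0 (\<bar>b \<bullet> x\<bar> - K)))"

lemma tail_fun_nonneg: "0 \<le> tail_fun K x"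
  by (simp add: tail_fun_def sum_nonneg)

lemma tail_fun_le: "tail_fun K (x::'a::euclidean_space) \<le> DIM('a)"
proof -
  have "tail_fun K x \<le> (\<Sum>b\<in>(Basis::'a set). 1)"
    unfolding tail_fun_def by (intro sum_mono) auto
  then show ?thesis by simp
qed

lemma tail_fun_ge_1:
  assumes "b \<in> Basis" "\<bar>b \<bullet> x\<bar> \<ge> K + 1"
  shows "1 \<le> tail_fun K x"
proof -
  have "1 = min 1 (max 0 (\<bar>b \<bullet> x\<bar> - K))" using assms by auto
  also have "\<dots> \<le> tail_fun K x"
    unfolding tail_fun_def by (rule member_le_sum) (use assms in auto)
  finally show ?thesis .
qed

text \<open>
  Cut \<open>f\<close> off so that it vanishes on the boundary of the cube \<open>Q\<close> of half-width \<open>L = K + 1\<close>. The result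
  \<open>g\<close> extends \<open>2 L\<close>-periodically, that is, it factors through the torus \<open>e ` Q\<close>, where the
  Stone--Weierstrass theorem gives an approximation by trigonometric polynomials that is uniform on the
  whole space. The cutoff inside \<open>Q\<close> and the periodic copies outside \<open>Q\<close> are both paid for by the
  tail function, which is at least 1 outside \<open>Q\<close>.
\<close>

lemma trig_poly_approx:
  fixes f :: "'a::euclidean_space \<Rightarrow> real"
  assumes cont: "continuous_on UNIV f" and B: "\<And>x. \<bar>f x\<bar> \<le> B" and K: "0 \<le> K" and eps: "0 < \<epsilon>"
  shows "\<exists>G. trig_poly G \<and> (\<forall>x. \<bar>f x - G x\<bar> \<le> \<epsilon> + 2 * B * tail_fun K x)"
proof -
  define L where "L = K + 1"
  have L: "L > 0" using K by (simp add: L_def)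
  have B0: "0 \<le> B" using B[of 0] by linarith
  define \<theta> where "\<theta> = pi / L"
  define g where "g x = f x * max 0 (1 - tail_fun K x)" for x
  define e :: "'a \<Rightarrow> 'a \<times> 'a" where
    "e x = (\<Sum>b\<in>Basis. cos (\<theta> * (b \<bullet> x)) *\<^sub>R b, \<Sum>b\<in>Basis. sin (\<theta> * (b \<bullet> x)) *\<^sub>R b)" for x
  define Q :: "'a set" where "Q = cbox (\<Sum>b\<in>Basis. (- L) *\<^sub>R b) (\<Sum>b\<in>Basis. L *\<^sub>R b)"
  have inQ: "x \<in> Q \<longleftrightarrow> (\<forall>b\<in>Basis. \<bar>b \<bullet> x\<bar> \<le> L)" for x
  proof -
    have "i \<bullet> (\<Sum>b\<in>Basis. c *\<^sub>R b) = c" if "i \<in> Basis" for i :: 'a and c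
      using that by (simp add: inner_sum_right inner_Basis if_distrib if_distribR sum.delta' cong: if_cong)
    then show ?thesis
      by (auto simp: Q_def mem_box abs_le_iff inner_commute[of x] minus_le_iff simp del: scaleR_minus_left)
  qed
  have fst_e: "fst (e x) \<bullet> b = cos (\<theta> * (b \<bullet> x))" if "b \<in> Basis" for b x
    using that by (simp add: e_def inner_commute[of _ b] inner_sum_right inner_Basis if_distrib if_distribR sum.delta' cong: if_cong)
  have snd_e: "snd (e x) \<bullet> b = sin (\<theta> * (b \<bullet> x))" if "b \<in> Basis" for b x
    using that by (simp add: e_def inner_commute[of _ b] inner_sum_right inner_Basis if_distrib if_distribR sum.delta' cong: if_cong)
  have cont_tail: "continuous_on UNIV (tail_fun K :: 'a \<Rightarrow> real)"
    unfolding tail_fun_def by (intro continuous_intros)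
  have cont_g: "continuous_on UNIV g"
    unfolding g_def by (intro continuous_intros cont cont_tail)
  have cont_e: "continuous_on UNIV e"
    unfolding e_def by (intro continuous_intros)
  have "compact Q" by (simp add: Q_def)
  \<comment> \<open>two points of \<open>Q\<close> with the same image differ by multiples of \<open>2 L\<close>, so they are equal or both on the boundary, where \<open>g\<close> vanishes\<close>
  have wd: "g x = g x'" if "x \<in> Q" "x' \<in> Q" "e x = e x'" for x x'
  proof -
    have n: "\<exists>n::int. b \<bullet> x = b \<bullet> x' + 2 * L * n" if b: "b \<in> Basis" for b
    proof -
      have "sin (\<theta> * (b \<bullet> x)) = sin (\<theta> * (b \<bullet> x')) \<and> cos (\<theta> * (b \<bullet> x)) = cos (\<theta> * (b \<bullet> x'))"
        using fst_e[OF b] snd_e[OF b] \<open>e x = e x'\<close> by metis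
      then obtain n :: int where "\<theta> * (b \<bullet> x) = \<theta> * (b \<bullet> x') + 2 * pi * n"
        unfolding sin_cos_eq_iff by blast
      then have "pi * (b \<bullet> x) = pi * (b \<bullet> x' + 2 * L * n)"
        using L by (simp add: \<theta>_def field_simps)
      then show ?thesis by auto
    qed
    show ?thesis
    proof (cases "\<exists>b\<in>Basis. b \<bullet> x \<noteq> b \<bullet> x'")
      case False
      have "x = x'"
      proof (rule euclidean_eqI)
        show "x \<bullet> b = x' \<bullet> b" if "b \<in> Basis" for b
          using False that by (simp add: inner_commute[of _ b])
      qed
      then show ?thesis by simp
    next
      case True
      then obtain b where b: "b \<in> Basis" "b \<bullet> x \<noteq> b \<bullet> x'" by blast
      obtain m :: int where m: "b \<bullet> x = b \<bullet> x' + 2 * L * m" using n[OF b(1)] by blast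
      have "m \<noteq> 0" using m b(2) by auto
      then have "\<bar>real_of_int m\<bar> \<ge> 1" by linarith
      then have "2 * L * \<bar>real_of_int m\<bar> \<ge> 2 * L * 1" using L by (intro mult_left_mono) auto
      then have "\<bar>b \<bullet> x - b \<bullet> x'\<bar> \<ge> 2 * L" using m L by (simp add: abs_mult)
      moreover have "\<bar>b \<bullet> x\<bar> \<le> L" "\<bar>b \<bullet> x'\<bar> \<le> L" using that b(1) inQ by auto
      ultimately have "\<bar>b \<bullet> x\<bar> \<ge> K + 1" "\<bar>b \<bullet> x'\<bar> \<ge> K + 1" by (auto simp: L_def)
      then have "1 \<le> tail_fun K x" "1 \<le> tail_fun K x'" using tail_fun_ge_1 b(1) by blast+
      then show ?thesis by (simp add: g_def)
    qed
  qed
  define h where "h y = g (SOME x. x \<in> Q \<and> e x = y)" for y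
  have h: "h (e x) = g x" if "x \<in> Q" for x
  proof -
    have "(SOME x'. x' \<in> Q \<and> e x' = e x) \<in> Q \<and> e (SOME x'. x' \<in> Q \<and> e x' = e x) = e x"
      by (rule someI[of _ x]) (use that in auto)
    then show ?thesis unfolding h_def using wd that by blast
  qed
  have comp: "compact (e ` Q)"
    using \<open>compact Q\<close> cont_e by (intro compact_continuous_image) (auto intro: continuous_on_subset)
  \<comment> \<open>preimages of closed sets are images of compact subsets of \<open>Q\<close>\<close>
  have cont_h: "continuous_on (e ` Q) h"
    unfolding continuous_on_closed_vimage[OF compact_imp_closed[OF comp]]
  proof (intro allI impI)
    fix C :: "real set" assume "closed C"
    then have "closed (g -` C)" using cont_g by (simp add: continuous_on_closed_vimage[of UNIV])
    then have "compact (Q \<inter> g -` C)" using \<open>compact Q\<close> by (rule compact_Int_closed[rotated])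
    then have "compact (e ` (Q \<inter> g -` C))"
      using cont_e by (intro compact_continuous_image) (auto intro: continuous_on_subset)
    moreover have "h -` C \<inter> e ` Q = e ` (Q \<inter> g -` C)" using h by auto
    ultimately show "closed (h -` C \<inter> e ` Q)" by (simp add: compact_imp_closed)
  qed
  define P where "P u \<longleftrightarrow> continuous_on (e ` Q) u \<and> trig_poly (\<lambda>x. u (e x))" for u
  have "\<exists>u. P u \<and> (\<forall>y\<in>e ` Q. \<bar>h y - u y\<bar> < \<epsilon>)"
  proof (rule Stone_Weierstrass_HOL[OF comp])
    show "P (\<lambda>x. c)" for c by (simp add: P_def trig_poly_const)
    show "P f \<Longrightarrow> continuous_on (e ` Q) f" for f by (simp add: P_def)
    show "P f \<and> P g \<Longrightarrow> P (\<lambda>x. f x + g x)" for f g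
      by (auto simp: P_def intro!: continuous_intros trig_poly.add)
    show "P f \<and> P g \<Longrightarrow> P (\<lambda>x. f x * g x)" for f g
      by (auto simp: P_def intro!: continuous_intros trig_poly_mult)
    show "\<exists>f. P f \<and> f y \<noteq> f z" if yz: "y \<in> e ` Q \<and> z \<in> e ` Q \<and> y \<noteq> z" for y z
    proof -
      have "P (\<lambda>y. fst y \<bullet> b)" if "b \<in> Basis" for b
        using trig_poly.cos[of "\<theta> *\<^sub>R b"] fst_e[OF that]
        by (auto simp: P_def intro!: continuous_intros)
      moreover have "P (\<lambda>y. snd y \<bullet> b)" if "b \<in> Basis" for b
        using trig_poly.sin[of "\<theta> *\<^sub>R b"] snd_e[OF that]
        by (auto simp: P_def intro!: continuous_intros)
      moreover have "fst y \<noteq> fst z \<or> snd y \<noteq> snd z" using yz by (auto simp: prod_eq_iff)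
      then have "(\<exists>b\<in>Basis. fst y \<bullet> b \<noteq> fst z \<bullet> b) \<or> (\<exists>b\<in>Basis. snd y \<bullet> b \<noteq> snd z \<bullet> b)"
        using euclidean_eq_iff by blast
      ultimately show ?thesis by blast
    qed
    show "continuous_on (e ` Q) h" by (rule cont_h)
  qed (rule eps)
  then obtain u where u: "trig_poly (\<lambda>x. u (e x))" "\<And>x. x \<in> Q \<Longrightarrow> \<bar>g x - u (e x)\<bar> < \<epsilon>"
    using h by (auto simp: P_def)
  have shift: "\<exists>x'\<in>Q. e x = e x'" for x
  proof
    define k where "k b = round ((b \<bullet> x) / (2 * L))" for b
    define x' where "x' = (\<Sum>b\<in>Basis. (b \<bullet> x - 2 * L * k b) *\<^sub>R b)"
    have bx': "b \<bullet> x' = b \<bullet> x - 2 * L * k b" if "b \<in> Basis" for b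
      using that by (simp add: x'_def inner_sum_right inner_Basis if_distrib if_distribR sum.delta' cong: if_cong)
    have "\<bar>b \<bullet> x'\<bar> \<le> L" if "b \<in> Basis" for b
    proof -
      have "\<bar>k b - (b \<bullet> x) / (2 * L)\<bar> \<le> 1 / 2" unfolding k_def by (rule of_int_round_abs_le)
      then have "2 * L * \<bar>k b - (b \<bullet> x) / (2 * L)\<bar> \<le> 2 * L * (1 / 2)" using L by (intro mult_left_mono) auto
      moreover have "2 * L * \<bar>k b - (b \<bullet> x) / (2 * L)\<bar> = \<bar>2 * L * (k b - (b \<bullet> x) / (2 * L))\<bar>"
        using L by (simp add: abs_mult)
      moreover have "2 * L * (k b - (b \<bullet> x) / (2 * L)) = 2 * L * k b - b \<bullet> x"
        using L by (simp add: field_simps)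
      ultimately show ?thesis using bx'[OF that] by (simp add: abs_minus_commute)
    qed
    then show "x' \<in> Q" by (simp add: inQ)
    have "sin (\<theta> * (b \<bullet> x)) = sin (\<theta> * (b \<bullet> x')) \<and> cos (\<theta> * (b \<bullet> x)) = cos (\<theta> * (b \<bullet> x'))"
      if "b \<in> Basis" for b
    proof -
      have "\<theta> * (b \<bullet> x) = \<theta> * (b \<bullet> x') + 2 * pi * k b"
        using L by (simp add: bx'[OF that] \<theta>_def field_simps)
      then show ?thesis unfolding sin_cos_eq_iff by blast
    qed
    then show "e x = e x'" by (simp add: e_def cong: sum.cong)
  qed
  have gB: "\<bar>g x\<bar> \<le> B" for x
  proof -
    have "\<bar>g x\<bar> = \<bar>f x\<bar> * max 0 (1 - tail_fun K x)" by (simp add: g_def abs_mult)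
    also have "\<dots> \<le> B * 1" using B B0 tail_fun_nonneg[of K x] by (intro mult_mono) auto
    finally show ?thesis by simp
  qed
  have "\<bar>f x - u (e x)\<bar> \<le> \<epsilon> + 2 * B * tail_fun K x" for x
  proof (cases "x \<in> Q")
    case True
    have "\<bar>f x - g x\<bar> = \<bar>f x\<bar> * \<bar>1 - max 0 (1 - tail_fun K x)\<bar>"
      by (simp add: g_def flip: abs_mult) (simp add: algebra_simps)
    also have "\<dots> \<le> B * tail_fun K x"
      using B B0 tail_fun_nonneg[of K x] by (intro mult_mono) auto
    finally have "\<bar>f x - g x\<bar> \<le> B * tail_fun K x" .
    moreover have "0 \<le> B * tail_fun K x" using B0 tail_fun_nonneg by (rule mult_nonneg_nonneg)
    ultimately show ?thesis using u(2)[OF True] by linarith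
  next
    case False
    then obtain b where b: "b \<in> Basis" "\<bar>b \<bullet> x\<bar> > L" by (auto simp: inQ not_le)
    then have "1 \<le> tail_fun K x" by (intro tail_fun_ge_1[OF b(1)]) (auto simp: L_def)
    then have "2 * B * 1 \<le> 2 * B * tail_fun K x" using B0 by (intro mult_left_mono) auto
    moreover obtain x' where "x' \<in> Q" "e x = e x'" using shift by blast
    then have "\<bar>g x' - u (e x)\<bar> < \<epsilon>" using u(2)[of x'] by simp
    ultimately show ?thesis using gB[of x'] B[of x] by linarith
  qed
  then show ?thesis using u(1) by blast
qed

text \<open>
  The integrals of trigonometric polynomials converge by assumption. The one-dimensional continuity
  theorem, applied to the coordinates, gives convergence of the integrals of the tail functions, hence
  tightness, and the approximation of \<open>f\<close> has an error controlled by these integrals.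
\<close>

lemma levy_continuity_euclidean:
  fixes \<mu> :: "nat \<Rightarrow> 'a::euclidean_space measure" and \<mu>' :: "'a measure"
  assumes prob: "\<And>n. prob_space (\<mu> n)" "prob_space \<mu>'"
    and sets: "\<And>n. sets (\<mu> n) = sets borel" "sets \<mu>' = sets borel"
    and char: "\<And>t. (\<lambda>n. CLINT x|\<mu> n. iexp (t \<bullet> x)) \<longlonglongrightarrow> (CLINT x|\<mu>'. iexp (t \<bullet> x))"
  shows "converges_weakly \<mu> \<mu>'"
  unfolding converges_weakly_def
proof (intro allI impI, elim conjE)
  fix f :: "'a \<Rightarrow> real" assume f: "continuous_on UNIV f" "bounded (range f)"
  interpret \<mu>: prob_space "\<mu> n" for n by (rule prob)
  interpret \<mu>': prob_space \<mu>' by (rule prob)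
  note [measurable_cong] = sets
  have int\<mu>: "integrable (\<mu> n) u" "integrable \<mu>' u"
    if "continuous_on UNIV u" "\<And>x. \<bar>u x\<bar> \<le> C" for u :: "'a \<Rightarrow> real" and C n
  proof -
    have [measurable]: "u \<in> borel_measurable borel" using that(1) by (rule borel_measurable_continuous_onI)
    show "integrable (\<mu> n) u" using that(2) by (intro \<mu>.integrable_const_bound[where B=C]) auto
    show "integrable \<mu>' u" using that(2) by (intro \<mu>'.integrable_const_bound[where B=C]) auto
  qed
  have euler: "(CLINT x|M. iexp (t \<bullet> x)) = (LINT x|M. cos (t \<bullet> x)) + \<i> * (LINT x|M. sin (t \<bullet> x))"
    if "prob_space M" "sets M = sets borel" for M and t :: 'a
  proof -
    interpret prob_space M by fact
    note [measurable_cong] = that(2)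
    have i: "integrable M (\<lambda>x. cos (t \<bullet> x))" "integrable M (\<lambda>x. sin (t \<bullet> x))"
      by (intro integrable_const_bound[where B=1]; simp)+
    have "(CLINT x|M. iexp (t \<bullet> x)) = (CLINT x|M. complex_of_real (cos (t \<bullet> x)) + \<i> * complex_of_real (sin (t \<bullet> x)))"
      by (simp add: exp_Euler cos_of_real sin_of_real)
    then show ?thesis using i by simp
  qed
  have trig: "(\<lambda>n. LINT x|\<mu> n. G x) \<longlonglongrightarrow> (LINT x|\<mu>'. G x)" if "trig_poly G" for G
    using that
  proof induction
    case (cos t)
    have "Re (CLINT x|M. iexp (t \<bullet> x)) = (LINT x|M. cos (t \<bullet> x))"
      if "prob_space M" "sets M = sets borel" for M
      using euler[OF that, of t] by simp
    then show ?case using tendsto_Re[OF char[of t]] prob sets by simp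
  next
    case (sin t)
    have "Im (CLINT x|M. iexp (t \<bullet> x)) = (LINT x|M. sin (t \<bullet> x))"
      if "prob_space M" "sets M = sets borel" for M
      using euler[OF that, of t] by simp
    then show ?case using tendsto_Im[OF char[of t]] prob sets by simp
  next
    case (add f g)
    obtain C D where "\<And>x. \<bar>f x\<bar> \<le> C" "\<And>x. \<bar>g x\<bar> \<le> D"
      using add.hyps[THEN trig_poly_bounded] by blast
    then have "integrable (\<mu> n) f" "integrable \<mu>' f" "integrable (\<mu> n) g" "integrable \<mu>' g" for n
      using int\<mu> add.hyps[THEN trig_poly_continuous] by blast+
    then show ?case using tendsto_add[OF add.IH] by simp
  next
    case (scale f c)
    then show ?case by (simp add: tendsto_mult_left)
  qed
  define step where "step K y = min 1 (max 0 (\<bar>y\<bar> - K))" for K y :: real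
  have step_cont: "isCont (step K) y" for K y unfolding step_def by (intro continuous_intros)
  have step_bd: "norm (step K y) \<le> 1" for K y by (auto simp: step_def)
  have tail_eq: "tail_fun K x = (\<Sum>b\<in>Basis. step K (b \<bullet> x))" for K and x :: 'a
    by (simp add: tail_fun_def step_def)
  have step_int: "integrable (\<mu> n) (\<lambda>x. step K (b \<bullet> x))" "integrable \<mu>' (\<lambda>x. step K (b \<bullet> x))" for n K b
    by (rule int\<mu>[of _ 1]; simp add: step_def; intro continuous_intros)+
  have tail: "(\<lambda>n. LINT x|\<mu> n. tail_fun K x) \<longlonglongrightarrow> (LINT x|\<mu>'. tail_fun K x)" for K
  proof -
    have "(\<lambda>n. LINT x|\<mu> n. step K (b \<bullet> x)) \<longlonglongrightarrow> (LINT x|\<mu>'. step K (b \<bullet> x))" for b :: 'a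
    proof -
      have m': "(\<lambda>x. b \<bullet> x) \<in> measurable (\<mu> n) borel" "(\<lambda>x. b \<bullet> x) \<in> measurable \<mu>' borel" for n by measurable
      have sm[measurable]: "step K \<in> borel_measurable borel" unfolding step_def by measurable
      have rd: "real_distribution (distr (\<mu> n) borel (\<lambda>x. b \<bullet> x))" "real_distribution (distr \<mu>' borel (\<lambda>x. b \<bullet> x))" for n
        by (auto simp: real_distribution_def real_distribution_axioms_def intro!: \<mu>.prob_space_distr \<mu>'.prob_space_distr m')
      have "weak_conv_m (\<lambda>n. distr (\<mu> n) borel (\<lambda>x. b \<bullet> x)) (distr \<mu>' borel (\<lambda>x. b \<bullet> x))"
      proof (rule levy_continuity[OF rd])
        fix t
        show "(\<lambda>n. Characteristic_Functions.char (distr (\<mu> n) borel ((\<bullet>) b)) t)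
            \<longlonglongrightarrow> Characteristic_Functions.char (distr \<mu>' borel ((\<bullet>) b)) t"
          using char[of "t *\<^sub>R b"] by (simp add: char_def integral_distr)
      qed
      from weak_conv_imp_integral_bdd_continuous_conv[OF rd this step_cont step_bd, of K]
      show ?thesis by (simp add: integral_distr)
    qed
    then show ?thesis by (simp add: tail_eq step_int tendsto_sum)
  qed
  have tail0: "(\<lambda>k. LINT x|\<mu>'. tail_fun (real k) x) \<longlonglongrightarrow> 0"
  proof -
    have "(\<lambda>k. LINT x|\<mu>'. tail_fun (real k) x) \<longlonglongrightarrow> (LINT x|\<mu>'. 0)"
    proof (rule integral_dominated_convergence[where w="\<lambda>_. DIM('a)"])
      show "AE x in \<mu>'. (\<lambda>k. tail_fun (real k) x) \<longlonglongrightarrow> 0"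
      proof (rule AE_I2)
        fix x :: 'a
        have "(\<lambda>k. step (real k) y) \<longlonglongrightarrow> 0" for y
        proof (rule tendsto_eventually)
          show "\<forall>\<^sub>F k in sequentially. step (real k) y = 0"
            using eventually_ge_at_top[of "nat \<lceil>\<bar>y\<bar>\<rceil>"]
            by eventually_elim (simp add: step_def nat_le_iff ceiling_le_iff)
        qed
        then show "(\<lambda>k. tail_fun (real k) x) \<longlonglongrightarrow> 0"
          unfolding tail_eq by (intro tendsto_null_sum)
      qed
      show "AE x in \<mu>'. norm (tail_fun (real k) x) \<le> real DIM('a)" for k
        by (simp add: abs_of_nonneg tail_fun_nonneg tail_fun_le)
      show "tail_fun (real k) \<in> borel_measurable \<mu>'" for k unfolding tail_fun_def by measurable
    qed simp_all
    then show ?thesis by simp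
  qed
  obtain B where B: "\<And>x. \<bar>f x\<bar> \<le> B" using f(2) by (auto simp: bounded_iff)
  have B0: "0 \<le> B" using B[of 0] by linarith
  note intf = int\<mu>[OF f(1) B]
  have intT: "integrable (\<mu> n) (tail_fun K)" "integrable \<mu>' (tail_fun K)" for n K
    unfolding tail_eq[abs_def] using step_int by auto
  show "(\<lambda>n. LINT x|\<mu> n. f x) \<longlonglongrightarrow> (LINT x|\<mu>'. f x)"
  proof (rule LIMSEQ_I)
    fix r :: real assume r: "0 < r"
    define \<epsilon> where "\<epsilon> = r / 8"
    define d where "d = r / (8 * (2 * B + 1))"
    have ed: "\<epsilon> > 0" "d > 0" using r B0 by (auto simp: \<epsilon>_def d_def)
    have "\<forall>\<^sub>F k in sequentially. (LINT x|\<mu>'. tail_fun (real k) x) < d"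
      using order_tendstoD(2)[OF tail0 \<open>d > 0\<close>] .
    then obtain k where k: "(LINT x|\<mu>'. tail_fun (real k) x) < d"
      by (auto simp: eventually_sequentially)
    obtain G where G: "trig_poly G" "\<And>x. \<bar>f x - G x\<bar> \<le> \<epsilon> + 2 * B * tail_fun (real k) x"
      using trig_poly_approx[OF f(1) B _ ed(1), of "real k"] by auto
    obtain C where C: "\<And>x. \<bar>G x\<bar> \<le> C" using trig_poly_bounded[OF G(1)] by blast
    note intG = int\<mu>[OF trig_poly_continuous[OF G(1)] C]
    have diff: "\<bar>(LINT x|M. f x) - (LINT x|M. G x)\<bar> \<le> \<epsilon> + 2 * B * (LINT x|M. tail_fun (real k) x)"
      if "prob_space M" "integrable M f" "integrable M G" "integrable M (tail_fun (real k))" for M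
    proof -
      interpret prob_space M by fact
      have "\<bar>(LINT x|M. f x) - (LINT x|M. G x)\<bar> = \<bar>LINT x|M. f x - G x\<bar>" using that by simp
      also have "\<dots> \<le> (LINT x|M. \<bar>f x - G x\<bar>)" by (rule integral_abs_bound)
      also have "\<dots> \<le> (LINT x|M. \<epsilon> + 2 * B * tail_fun (real k) x)"
        using that G(2) by (intro integral_mono) auto
      also have "\<dots> = \<epsilon> + 2 * B * (LINT x|M. tail_fun (real k) x)"
        using that by (simp add: prob_space)
      finally show ?thesis .
    qed
    have "\<forall>\<^sub>F n in sequentially. (LINT x|\<mu> n. tail_fun (real k) x) < d"
      using order_tendstoD(2)[OF tail k] .
    moreover have "\<forall>\<^sub>F n in sequentially. \<bar>(LINT x|\<mu> n. G x) - (LINT x|\<mu>'. G x)\<bar> < \<epsilon>"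
      using trig[OF G(1)] ed(1) by (auto simp: tendsto_iff dist_real_def)
    ultimately have "\<forall>\<^sub>F n in sequentially. norm ((LINT x|\<mu> n. f x) - (LINT x|\<mu>'. f x)) < r"
    proof eventually_elim
      case (elim n)
      have "2 * B * (LINT x|\<mu> n. tail_fun (real k) x) \<le> 2 * B * d"
           "2 * B * (LINT x|\<mu>'. tail_fun (real k) x) \<le> 2 * B * d"
        using elim(1) k B0 by (auto intro!: mult_left_mono)
      moreover have "2 * B * d \<le> r / 8"
      proof -
        have "2 * B * d \<le> (2 * B + 1) * d" using ed by (intro mult_right_mono) auto
        also have "\<dots> = r / 8" using B0 by (simp add: d_def field_simps)
        finally show ?thesis .
      qed
      moreover note diff[OF prob(1)[of n] intf(1)[of n] intG(1)[of n] intT(1)[of n]]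
        diff[OF prob(2) intf(2) intG(2) intT(2)]
      ultimately show ?case using elim(2) r unfolding \<epsilon>_def real_norm_def by linarith
    qed
    then show "\<exists>no. \<forall>n\<ge>no. norm ((LINT x|\<mu> n. f x) - (LINT x|\<mu>'. f x)) < r"
      by (simp add: eventually_sequentially)
  qed
qed

section \<open>Characteristic functions of centered normal distributions\<close>

definition flat :: "real^'q^'q \<Rightarrow> real^('q \<times> 'q)" where
  "flat t = (\<chi> a. t $ fst a $ snd a)"

lemma flat_nth: "flat t $ (i, j) = t $ i $ j"
  by (simp add: flat_def)

lemma flat_surj: "flat (\<chi> i j. v $ (i, j)) = v"
  by (simp add: flat_def vec_eq_iff)

lemma sum_UNIV_prod: "(\<Sum>a\<in>UNIV. f a) = (\<Sum>i\<in>UNIV. \<Sum>j\<in>UNIV. f (i, j))"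
  by (simp add: sum.cartesian_product flip: UNIV_Times_UNIV)

lemma inner_unflat: "t \<bullet> (\<chi> i j. v $ (i, j)) = flat t \<bullet> v"
  by (simp add: inner_vec_def sum_UNIV_prod flat_nth)

lemma measurable_matrix_vector_mult:
  fixes A :: "real^'n^'n"
  shows "(\<lambda>z. A *v (\<chi> i. z i)) \<in> (\<Pi>\<^sub>M i\<in>UNIV. std_normal_distribution) \<rightarrow>\<^sub>M borel"
proof -
  have "(\<lambda>z. A *v (\<chi> i. z i)) = (\<lambda>z. \<Sum>i\<in>UNIV. z i *\<^sub>R column i A)"
    by (simp add: fun_eq_iff matrix_mult_sum scalar_mult_eq_scaleR)
  also have "\<dots> \<in> (\<Pi>\<^sub>M i\<in>UNIV. std_normal_distribution) \<rightarrow>\<^sub>M borel"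
    by measurable
  finally show ?thesis .
qed

lemma prob_space_centered_normal: "prob_space (centered_normal \<Sigma>)"
proof -
  interpret product_prob_space "\<lambda>_. std_normal_distribution" UNIV
    by unfold_locales (use real_distribution.axioms(1)[OF real_dist_normal_dist] in
        \<open>auto simp: prob_space_def finite_measure_def prob_space_axioms_def finite_measure_axioms_def sigma_finite_measure_def\<close>)
  show ?thesis
    unfolding centered_normal_def by (intro prob_space_distr measurable_matrix_vector_mult)
qed

lemma char_centered_normal:
  assumes "\<Sigma> \<in> psd_cone"
  shows "(CLINT v|centered_normal \<Sigma>. iexp (t \<bullet> v)) = of_real (exp (- (t \<bullet> (\<Sigma> *v t)) / 2))"
proof -
  interpret std: prob_space std_normal_distribution
    using real_dist_normal_dist by (rule real_distribution.axioms)
  interpret product_sigma_finite "\<lambda>_::'a. std_normal_distribution" ..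
  define w where "w = psd_sqrt \<Sigma> *v t"
  have "t \<bullet> (\<Sigma> *v t) = w \<bullet> w"
    using psd_coneD(3)[OF psd_sqrt_in_psd_cone[OF assms], of t "w"] psd_sqrt_mult_self[OF assms]
    by (simp add: w_def matrix_vector_mul_assoc)
  also have "\<dots> = (\<Sum>i\<in>UNIV. (w $ i)^2)" by (simp add: inner_vec_def power2_eq_square)
  finally have ww: "t \<bullet> (\<Sigma> *v t) = (\<Sum>i\<in>UNIV. (w $ i)^2)" .
  have "(CLINT v|centered_normal \<Sigma>. iexp (t \<bullet> v)) =
      (CLINT z|(\<Pi>\<^sub>M i\<in>UNIV. std_normal_distribution). iexp (t \<bullet> (psd_sqrt \<Sigma> *v (\<chi> i. z i))))"
    unfolding centered_normal_def by (rule integral_distr[OF measurable_matrix_vector_mult]) measurable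
  also have "\<dots> = (CLINT z|(\<Pi>\<^sub>M i\<in>UNIV. std_normal_distribution). (\<Prod>i\<in>UNIV. iexp (w $ i * z i)))"
  proof (rule Bochner_Integration.integral_cong[OF refl])
    fix z :: "'a \<Rightarrow> real"
    have "t \<bullet> (psd_sqrt \<Sigma> *v (\<chi> i. z i)) = w \<bullet> (\<chi> i. z i)"
      using psd_coneD(3)[OF psd_sqrt_in_psd_cone[OF assms], of t] by (simp add: w_def)
    then show "iexp (t \<bullet> (psd_sqrt \<Sigma> *v (\<chi> i. z i))) = (\<Prod>i\<in>UNIV. iexp (w $ i * z i))"
      by (simp add: inner_vec_def sum_distrib_left exp_sum)
  qed
  also have "\<dots> = (\<Prod>i\<in>UNIV. (CLINT x|std_normal_distribution. iexp (w $ i * x)))"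
    by (rule product_integral_prod) (auto intro!: std.integrable_iexp)
  also have "\<dots> = (\<Prod>i\<in>UNIV. of_real (exp (- ((w $ i)^2) / 2)))"
    using char_std_normal_distribution by (simp add: char_def fun_eq_iff)
  also have "\<dots> = of_real (exp (\<Sum>i\<in>UNIV. - ((w $ i)^2) / 2))"
    by (simp add: exp_sum)
  also have "(\<Sum>i\<in>UNIV. - ((w $ i)^2) / 2) = - (t \<bullet> (\<Sigma> *v t)) / 2"
    by (simp add: ww sum_negf sum_divide_distrib)
  finally show ?thesis .
qed

lemma measurable_unflat: "(\<lambda>v::real^('q::finite \<times> 'q). \<chi> i j. v $ (i, j)) \<in> borel_measurable borel"
  by (intro borel_measurable_continuous_onI continuous_intros)

lemma prob_space_centered_matrix_normal: "prob_space (centered_matrix_normal \<Sigma>)"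
  and sets_centered_matrix_normal: "sets (centered_matrix_normal \<Sigma>) = sets borel"
proof -
  interpret prob_space "centered_normal \<Sigma>" by (rule prob_space_centered_normal)
  show "prob_space (centered_matrix_normal \<Sigma>)"
    unfolding centered_matrix_normal_def
    by (rule prob_space_distr) (simp add: centered_normal_def measurable_unflat)
qed (simp add: centered_matrix_normal_def)

lemma char_centered_matrix_normal:
  assumes "\<Sigma> \<in> psd_cone"
  shows "(CLINT y|centered_matrix_normal \<Sigma>. iexp (t \<bullet> y)) =
           of_real (exp (- (flat t \<bullet> (\<Sigma> *v flat t)) / 2))"
proof -
  have "(CLINT y|centered_matrix_normal \<Sigma>. iexp (t \<bullet> y)) =
      (CLINT v|centered_normal \<Sigma>. iexp (t \<bullet> (\<chi> i j. v $ (i, j))))"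
    unfolding centered_matrix_normal_def
    by (rule integral_distr) (simp_all add: centered_normal_def measurable_unflat)
  then show ?thesis by (simp only: inner_unflat char_centered_normal[OF assms])
qed

section \<open>The limiting covariances as quadratic forms\<close>

text \<open>
  This is \<open>h R h\<close> for \<open>h = t + t'\<close>. Its inner product with \<open>S'S\<close> is \<open>p\<close> times the variance of the inner
  product of \<open>t\<close> with \<open>S'x + x'S\<close>, when the rows of \<open>x\<close> are centred and uncorrelated with second
  moments \<open>R / p\<close>.
\<close>

definition cross_form :: "real^'q^'q \<Rightarrow> real^'q^'q \<Rightarrow> real^'q^'q" where
  "cross_form t R = (\<chi> j l. \<Sum>i\<in>UNIV. \<Sum>k\<in>UNIV.
     (t $ i $ j + t $ j $ i) * (t $ k $ l + t $ l $ k) * R $ i $ k)"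

text \<open>
  Of the four products in \<open>(t + t') \<otimes> (t + t')\<close>, two give the first summand of \<open>T2\<close> and two the second
  one; whence the factor 1/2.
\<close>

lemma T2_form: "flat t \<bullet> (T2 \<nu> *v flat t) = (cross_form t (r2 \<nu>) \<bullet> r2 \<nu>) / 2"
proof -
  define r where "r = r2 \<nu>"
  define P where "P i j k l = t $ i $ j * t $ k $ l * (r $ i $ k * r $ j $ l)" for i j k l
  define Q where "Q i j k l = t $ i $ j * t $ k $ l * (r $ i $ l * r $ j $ k)" for i j k l
  have lhs: "flat t \<bullet> (T2 \<nu> *v flat t) =
      (\<Sum>i\<in>UNIV. \<Sum>j\<in>UNIV. \<Sum>k\<in>UNIV. \<Sum>l\<in>UNIV. P i j k l + Q i j k l)"
    by (simp add: inner_vec_def matrix_vector_mult_def sum_UNIV_prod flat_nth T2_def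
        sum_distrib_left P_def Q_def r_def algebra_simps)
  have "cross_form t r \<bullet> r = (\<Sum>j\<in>UNIV. \<Sum>l\<in>UNIV. \<Sum>i\<in>UNIV. \<Sum>k\<in>UNIV.
      P i j k l + Q i j l k + Q j i k l + P j i l k)"
    by (simp add: inner_vec_def cross_form_def sum_distrib_left sum_distrib_right P_def Q_def algebra_simps)
  also have "\<dots> = (\<Sum>j\<in>UNIV. \<Sum>i\<in>UNIV. \<Sum>l\<in>UNIV. \<Sum>k\<in>UNIV.
      P i j k l + Q i j l k + Q j i k l + P j i l k)"
    by (intro sum.cong refl sum.swap)
  also have "\<dots> = (\<Sum>j\<in>UNIV. \<Sum>i\<in>UNIV. \<Sum>l\<in>UNIV. \<Sum>k\<in>UNIV. P i j k l)
     + (\<Sum>j\<in>UNIV. \<Sum>i\<in>UNIV. \<Sum>l\<in>UNIV. \<Sum>k\<in>UNIV. Q i j l k)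
     + (\<Sum>j\<in>UNIV. \<Sum>i\<in>UNIV. \<Sum>l\<in>UNIV. \<Sum>k\<in>UNIV. Q j i k l)
     + (\<Sum>j\<in>UNIV. \<Sum>i\<in>UNIV. \<Sum>l\<in>UNIV. \<Sum>k\<in>UNIV. P j i l k)"
    by (simp only: sum.distrib)
  also have "(\<Sum>j\<in>UNIV. \<Sum>i\<in>UNIV. \<Sum>l\<in>UNIV. \<Sum>k\<in>UNIV. P i j k l) =
      (\<Sum>i\<in>UNIV. \<Sum>j\<in>UNIV. \<Sum>k\<in>UNIV. \<Sum>l\<in>UNIV. P i j k l)"
    by (subst sum.swap) (intro sum.cong refl sum.swap)
  also have "(\<Sum>j\<in>UNIV. \<Sum>i\<in>UNIV. \<Sum>l\<in>UNIV. \<Sum>k\<in>UNIV. Q i j l k) =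
      (\<Sum>i\<in>UNIV. \<Sum>j\<in>UNIV. \<Sum>k\<in>UNIV. \<Sum>l\<in>UNIV. Q i j k l)"
    by (rule sum.swap)
  also have "(\<Sum>j\<in>UNIV. \<Sum>i\<in>UNIV. \<Sum>l\<in>UNIV. \<Sum>k\<in>UNIV. Q j i k l) =
      (\<Sum>i\<in>UNIV. \<Sum>j\<in>UNIV. \<Sum>k\<in>UNIV. \<Sum>l\<in>UNIV. Q i j k l)"
    by (intro sum.cong refl sum.swap)
  finally show ?thesis unfolding lhs by (simp add: sum.distrib r_def)
qed

lemma covariance_matrix_form:
  assumes int: "\<And>i j k l. integrable M (\<lambda>\<omega>.
      (Z \<omega> $ i $ j - (LINT \<omega>|M. Z \<omega> $ i $ j)) * (Z \<omega> $ k $ l - (LINT \<omega>|M. Z \<omega> $ k $ l)))"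
  shows "flat t \<bullet> (covariance_matrix M Z *v flat t) =
    (LINT \<omega>|M. (t \<bullet> (Z \<omega> - (\<chi> i j. LINT \<omega>|M. Z \<omega> $ i $ j)))^2)"
proof -
  define Y where "Y \<omega> i j = Z \<omega> $ i $ j - (LINT \<omega>|M. Z \<omega> $ i $ j)" for \<omega> i j
  have "(t \<bullet> (Z \<omega> - (\<chi> i j. LINT \<omega>|M. Z \<omega> $ i $ j)))^2 =
    (\<Sum>i\<in>UNIV. \<Sum>k\<in>UNIV. \<Sum>j\<in>UNIV. \<Sum>l\<in>UNIV. (t $ i $ j * t $ k $ l) * (Y \<omega> i j * Y \<omega> k l))" for \<omega>
    by (simp add: inner_vec_def power2_eq_square sum_product Y_def mult_ac)
  then have "(LINT \<omega>|M. (t \<bullet> (Z \<omega> - (\<chi> i j. LINT \<omega>|M. Z \<omega> $ i $ j)))^2) =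
    (\<Sum>i\<in>UNIV. \<Sum>k\<in>UNIV. \<Sum>j\<in>UNIV. \<Sum>l\<in>UNIV. (t $ i $ j * t $ k $ l) * (LINT \<omega>|M. Y \<omega> i j * Y \<omega> k l))"
    using int by (simp add: Y_def)
  also have "\<dots> = (\<Sum>i\<in>UNIV. \<Sum>j\<in>UNIV. \<Sum>k\<in>UNIV. \<Sum>l\<in>UNIV. (t $ i $ j * t $ k $ l) * (LINT \<omega>|M. Y \<omega> i j * Y \<omega> k l))"
    by (intro sum.cong refl sum.swap)
  also have "\<dots> = flat t \<bullet> (covariance_matrix M Z *v flat t)"
    by (simp add: inner_vec_def matrix_vector_mult_def sum_UNIV_prod flat_nth covariance_matrix_def
        sum_distrib_left Y_def mult_ac)
  finally show ?thesis by simp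
qed

lemma psd_cone_flatI:
  fixes A :: "real^('q::finite \<times> 'q)^('q \<times> 'q)"
  assumes "transpose A = A" "\<And>t. 0 \<le> flat t \<bullet> (A *v flat t)"
  shows "A \<in> psd_cone"
proof -
  have "0 \<le> v \<bullet> (A *v v)" for v
    using assms(2)[of "\<chi> i j. v $ (i, j)"] by (simp add: flat_surj)
  then show ?thesis using assms(1) by (simp add: psd_cone_def)
qed

section \<open>Moments of radial matrices\<close>

text \<open>
  The squared Frobenius norm, that is, the trace of the Gram matrix.
\<close>

definition sqn :: "nat \<Rightarrow> (nat \<Rightarrow> real^'q) \<Rightarrow> real" where
  "sqn p x = (\<Sum>a<p. (norm (x a))^2)"

definition lin_form :: "nat \<Rightarrow> (nat \<Rightarrow> real^'q) \<Rightarrow> (nat \<Rightarrow> real^'q) \<Rightarrow> real" where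
  "lin_form p c x = (\<Sum>a<p. c a \<bullet> x a)"

text \<open>
  The reflection of the \<open>p\<close>-dimensional space in the hyperplane orthogonal to \<open>u\<close>. Together with
  \<open>-1\<close>, these are the only orthogonal matrices that the argument uses.
\<close>

definition reflection :: "nat \<Rightarrow> (nat \<Rightarrow> real) \<Rightarrow> nat \<Rightarrow> nat \<Rightarrow> real" where
  "reflection p u i j = (if i = j then 1 else 0) - 2 * u i * u j / (\<Sum>k<p. (u k)^2)"

lemma sqn_nonneg: "0 \<le> sqn p x"
  by (simp add: sqn_def sum_nonneg)

lemma norm_sq_le_sqn: "a < p \<Longrightarrow> (norm (x a))^2 \<le> sqn p x"
  unfolding sqn_def by (rule member_le_sum) auto

lemma entry_sq_le_sqn: "a < p \<Longrightarrow> (x a $ i)^2 \<le> sqn p x"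
  using norm_sq_le_sqn[of a p x] component_le_norm_cart[of "x a" i]
  by (metis abs_ge_zero norm_ge_zero order_trans power2_abs power_mono)

lemma reflection_orthogonal:
  assumes "(\<Sum>k<p. (u k)^2) \<noteq> 0"
  shows "reflection p u \<in> orthogonal_group p"
proof -
  define s where "s = (\<Sum>k<p. (u k)^2)"
  have s: "s \<noteq> 0" using assms by (simp add: s_def)
  have "(\<Sum>k<p. reflection p u k i * reflection p u k j) = (if i = j then 1 else 0)"
    if ij: "i < p" "j < p" for i j
  proof -
    have "reflection p u k i * reflection p u k j =
       (if k = i then (if i = j then 1 else 0) else 0)
       - (if k = i then 2 * u i * u j / s else 0) - (if k = j then 2 * u i * u j / s else 0)
       + (4 * u i * u j / s^2) * (u k)^2" for k
      using s unfolding reflection_def s_def[symmetric] by (auto simp: field_simps power2_eq_square)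
    moreover have "(\<Sum>k<p. (4 * u i * u j / s^2) * (u k)^2) = (4 * u i * u j / s^2) * s"
      unfolding s_def[symmetric] sum_distrib_left[symmetric] ..
    ultimately have "(\<Sum>k<p. reflection p u k i * reflection p u k j) =
       (if i = j then 1 else 0) - 2 * u i * u j / s - 2 * u i * u j / s + (4 * u i * u j / s^2) * s"
      using ij by (simp only: sum.distrib sum_subtractf) simp
    also have "\<dots> = (if i = j then 1 else 0)" using s by (simp add: field_simps power2_eq_square)
    finally show ?thesis .
  qed
  then show ?thesis by (simp add: orthogonal_group_def)
qed

lemma left_mult_reflection:
  assumes "i < p"
  shows "left_mult p (reflection p u) x i =
    x i - (2 * u i / (\<Sum>k<p. (u k)^2)) *\<^sub>R (\<Sum>j<p. u j *\<^sub>R x j)"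
proof -
  define s where "s = (\<Sum>k<p. (u k)^2)"
  have "left_mult p (reflection p u) x i = (\<Sum>j<p. (if i = j then x j else 0) - (2 * u i / s) *\<^sub>R (u j *\<^sub>R x j))"
    using assms unfolding left_mult_def
    by (simp, intro sum.cong refl) (auto simp: reflection_def s_def algebra_simps)
  also have "\<dots> = x i - (2 * u i / s) *\<^sub>R (\<Sum>j<p. u j *\<^sub>R x j)"
    using assms by (simp add: sum_subtractf scaleR_sum_right)
  finally show ?thesis by (simp add: s_def)
qed

lemma integral_double_sum:
  fixes f :: "'i \<Rightarrow> 'j \<Rightarrow> 'a \<Rightarrow> real"
  assumes "\<And>i j. i \<in> I \<Longrightarrow> j \<in> J i \<Longrightarrow> integrable M (f i j)"
  shows "(LINT x|M. (\<Sum>i\<in>I. \<Sum>j\<in>J i. f i j x)) = (\<Sum>i\<in>I. \<Sum>j\<in>J i. (LINT x|M. f i j x))"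
proof -
  have "integrable M (\<lambda>x. \<Sum>j\<in>J i. f i j x)" if "i \<in> I" for i
    using assms that by (intro Bochner_Integration.integrable_sum) auto
  then have "(LINT x|M. (\<Sum>i\<in>I. \<Sum>j\<in>J i. f i j x)) = (\<Sum>i\<in>I. (LINT x|M. (\<Sum>j\<in>J i. f i j x)))"
    by (intro Bochner_Integration.integral_sum) auto
  also have "\<dots> = (\<Sum>i\<in>I. \<Sum>j\<in>J i. (LINT x|M. f i j x))"
    using assms by (intro sum.cong refl Bochner_Integration.integral_sum) auto
  finally show ?thesis .
qed

locale radial_measure = prob_space \<mu> for \<mu> :: "(nat \<Rightarrow> real^'q) measure" +
  fixes p :: nat
  assumes sets_mu: "sets \<mu> = sets (rect_mat p)"
    and radial: "radial p \<mu>"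
    and p_pos: "0 < p"
    and fourth_moment: "integrable \<mu> (\<lambda>x. (sqn p x)^2)"
begin

lemma measurable_row [measurable (raw)]: "a \<in> {..<p} \<Longrightarrow> (\<lambda>x. x a) \<in> borel_measurable \<mu>"
  unfolding measurable_cong_sets[OF sets_mu refl] rect_mat_def
  by (rule measurable_component_singleton)

lemma measurable_entry: "a < p \<Longrightarrow> (\<lambda>x. x a $ i) \<in> borel_measurable \<mu>"
  using borel_measurable_inner[OF measurable_row borel_measurable_const, of a "axis i 1"]
  by (simp add: inner_axis)

lemma measurable_rect_mat_iff: "f \<in> borel_measurable \<mu> \<longleftrightarrow> f \<in> borel_measurable (rect_mat p)"
  by (rule arg_cong[of _ _ "\<lambda>A. f \<in> A"]) (rule measurable_cong_sets[OF sets_mu refl])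

lemma measurable_left_mult: "left_mult p A \<in> \<mu> \<rightarrow>\<^sub>M rect_mat p"
  unfolding left_mult_def rect_mat_def by measurable

lemma radial_integral:
  fixes f :: "_ \<Rightarrow> real"
  assumes "A \<in> orthogonal_group p" "f \<in> borel_measurable \<mu>"
  shows "(LINT x|\<mu>. f (left_mult p A x)) = (LINT x|\<mu>. f x)"
proof -
  have "(LINT x|\<mu>. f x) = (LINT x|distr \<mu> (rect_mat p) (left_mult p A). f x)"
    using radial assms(1) by (simp add: radial_def)
  also have "\<dots> = (LINT x|\<mu>. f (left_mult p A x))"
    using assms(2) measurable_left_mult by (intro integral_distr) (simp_all add: measurable_rect_mat_iff)
  finally show ?thesis by simp
qed

lemma integrable_sqn: "integrable \<mu> (sqn p)"
proof (rule Bochner_Integration.integrable_bound)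
  show "integrable \<mu> (\<lambda>x. 1 + (sqn p x)^2)" using fourth_moment by simp
  show "sqn p \<in> borel_measurable \<mu>" unfolding sqn_def by measurable
  have "\<bar>sqn p x\<bar> \<le> \<bar>1 + (sqn p x)^2\<bar>" for x :: "nat \<Rightarrow> real^'q"
    using sqn_nonneg[of p x] sum_power2_ge_zero[of "sqn p x - 1/2" 0] by (simp add: power2_eq_square algebra_simps)
  then show "AE x in \<mu>. norm (sqn p x) \<le> norm (1 + (sqn p x)^2)" by simp
qed

lemma integrable_of_bound:
  fixes f :: "_ \<Rightarrow> real"
  assumes "f \<in> borel_measurable \<mu>" "\<And>x. \<bar>f x\<bar> \<le> C * (1 + (sqn p x)^2)"
  shows "integrable \<mu> f"
proof (rule Bochner_Integration.integrable_bound)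
  show "integrable \<mu> (\<lambda>x. C * (1 + (sqn p x)^2))" using fourth_moment by simp
  show "AE x in \<mu>. norm (f x) \<le> norm (C * (1 + (sqn p x)^2))"
    using assms(2) by (intro AE_I2) (simp, metis abs_ge_self order_trans)
qed (rule assms)

lemma integrable_entry2:
  assumes "a < p" "b < p"
  shows "integrable \<mu> (\<lambda>x. x a $ i * x b $ k)"
proof (rule Bochner_Integration.integrable_bound[OF integrable_sqn])
  show "(\<lambda>x. x a $ i * x b $ k) \<in> borel_measurable \<mu>"
    using assms by (intro borel_measurable_times measurable_entry)
  have "\<bar>x a $ i * x b $ k\<bar> \<le> sqn p x" for x :: "nat \<Rightarrow> real^'q"
  proof -
    have "\<bar>x a $ i * x b $ k\<bar> = sqrt ((x a $ i)^2 * (x b $ k)^2)"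
      by (simp add: real_sqrt_mult abs_mult)
    also have "\<dots> \<le> sqrt (sqn p x * sqn p x)"
      using assms by (intro real_sqrt_le_mono mult_mono entry_sq_le_sqn) (auto simp: sqn_nonneg)
    finally show ?thesis by (simp add: sqn_nonneg)
  qed
  then show "AE x in \<mu>. norm (x a $ i * x b $ k) \<le> norm (sqn p x)"
    by (simp add: abs_of_nonneg[OF sqn_nonneg])
qed

lemma integrable_entry22:
  assumes "a < p" "b < p"
  shows "integrable \<mu> (\<lambda>x. (x a $ i)^2 * (x b $ k)^2)"
proof (rule Bochner_Integration.integrable_bound[OF fourth_moment])
  show "(\<lambda>x. (x a $ i)^2 * (x b $ k)^2) \<in> borel_measurable \<mu>"
    using assms by (intro borel_measurable_times borel_measurable_power measurable_entry)
  have "(x a $ i)^2 * (x b $ k)^2 \<le> (sqn p x)^2" for x :: "nat \<Rightarrow> real^'q"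
    unfolding power2_eq_square[of "sqn p x"]
    using assms by (intro mult_mono entry_sq_le_sqn) (auto simp: sqn_nonneg)
  then show "AE x in \<mu>. norm ((x a $ i)^2 * (x b $ k)^2) \<le> norm ((sqn p x)^2)" by simp
qed

lemma integral_flip_row:
  fixes f :: "_ \<Rightarrow> real"
  assumes "a < p" and f: "f \<in> borel_measurable \<mu>"
    and cong: "\<And>x y. (\<And>i. i < p \<Longrightarrow> x i = y i) \<Longrightarrow> f x = f y"
  shows "(LINT x|\<mu>. f (x(a := - x a))) = (LINT x|\<mu>. f x)"
proof -
  define u :: "nat \<Rightarrow> real" where "u k = (if k = a then 1 else 0)" for k
  have s: "(\<Sum>k<p. (u k)^2) = 1"
    using assms(1) by (simp add: u_def if_distrib[of "\<lambda>z. z^2"] cong: if_cong)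
  have "(\<Sum>j<p. u j *\<^sub>R x j) = x a" for x :: "nat \<Rightarrow> real^'q"
    using assms(1) by (simp add: u_def if_distrib if_distribR cong: if_cong)
  then have "f (left_mult p (reflection p u) x) = f (x(a := - x a))" for x
    using s by (intro cong) (auto simp: left_mult_reflection u_def scaleR_2)
  then show ?thesis
    using radial_integral[OF reflection_orthogonal[of u p] f] s by simp
qed

text \<open>
  The reflection that exchanges the unit vectors \<open>w\<close> and \<open>e\<^sub>0\<close> maps the first row of \<open>x\<close> to \<open>w' x\<close>.
\<close>

lemma integral_row_direction:
  fixes f :: "real^'q \<Rightarrow> real"
  assumes f: "f \<in> borel_measurable borel" and w: "(\<Sum>a<p. (w a)^2) = 1"
  shows "(LINT x|\<mu>. f (\<Sum>a<p. w a *\<^sub>R x a)) = (LINT x|\<mu>. f (x 0))"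
proof -
  define u where "u k = (if k = 0 then 1 else 0) - w k" for k
  have mf: "(\<lambda>x. f (x 0)) \<in> borel_measurable \<mu>"
    using measurable_compose[OF measurable_row f, of 0] p_pos by simp
  have "(u k)^2 = (if k = 0 then 1 - 2 * w 0 else 0) + (w k)^2" for k
    by (simp add: u_def power2_eq_square algebra_simps)
  then have s: "(\<Sum>k<p. (u k)^2) = 2 * u 0"
    using w p_pos by (simp add: sum.distrib) (simp add: u_def)
  have us: "(\<Sum>k<p. u k *\<^sub>R x k) = x 0 - (\<Sum>k<p. w k *\<^sub>R x k)" for x :: "nat \<Rightarrow> real^'q"
  proof -
    have "u k *\<^sub>R x k = (if k = 0 then x 0 else 0) - w k *\<^sub>R x k" for k
      by (simp add: u_def scaleR_left_diff_distrib)
    then show ?thesis using p_pos by (simp add: sum_subtractf)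
  qed
  show ?thesis
  proof (cases "u 0 = 0")
    case True
    then have "\<forall>k<p. u k = 0" using s by (simp add: sum_nonneg_eq_0_iff)
    then have "x 0 = (\<Sum>k<p. w k *\<^sub>R x k)" for x :: "nat \<Rightarrow> real^'q"
      using us[of x] by simp
    then show ?thesis by metis
  next
    case False
    then have "left_mult p (reflection p u) x 0 = (\<Sum>a<p. w a *\<^sub>R x a)" for x :: "nat \<Rightarrow> real^'q"
      using p_pos by (simp add: left_mult_reflection s us)
    then show ?thesis
      using radial_integral[OF reflection_orthogonal[of u p] mf] False s by simp
  qed
qed

lemma integral_row_eq:
  fixes f :: "real^'q \<Rightarrow> real"
  assumes f: "f \<in> borel_measurable borel" and a: "a < p"
  shows "(LINT x|\<mu>. f (x a)) = (LINT x|\<mu>. f (x 0))"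
proof -
  define w :: "nat \<Rightarrow> real" where "w k = (if k = a then 1 else 0)" for k
  have "(\<Sum>k<p. (w k)^2) = 1"
    using a by (simp add: w_def if_distrib[of "\<lambda>z. z^2"] cong: if_cong)
  moreover have "(\<Sum>j<p. w j *\<^sub>R x j) = x a" for x :: "nat \<Rightarrow> real^'q"
    using a by (simp add: w_def if_distrib if_distribR cong: if_cong)
  ultimately show ?thesis using integral_row_direction[OF f, of w] by simp
qed

definition second_moment :: "real^'q^'q" where
  "second_moment = (\<chi> i k. LINT x|\<mu>. gram p x $ i $ k)"

text \<open>
  Changing the sign of a row annihilates the mixed moments of two rows; for equal rows the moments
  do not depend on the row, and they add up to the second moment matrix.
\<close>

lemma integral_entry2:
  assumes "a < p" "b < p"
  shows "(LINT x|\<mu>. x a $ i * x b $ k) = (if a = b then second_moment $ i $ k / p else 0)"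
proof (cases "a = b")
  case False
  have "(LINT x|\<mu>. x a $ i * x b $ k) = (LINT x|\<mu>. (x(a := - x a)) a $ i * (x(a := - x a)) b $ k)"
    using assms
    by (intro integral_flip_row[symmetric] borel_measurable_times measurable_entry) auto
  then show ?thesis using False by simp
next
  case True
  have "(\<lambda>v::real^'q. v $ i * v $ k) \<in> borel_measurable borel"
    by (intro borel_measurable_continuous_onI continuous_intros)
  note row = integral_row_eq[OF this]
  have "second_moment $ i $ k = (\<Sum>c<p. LINT x|\<mu>. x c $ i * x c $ k)"
    by (simp add: second_moment_def gram_def integrable_entry2)
  also have "\<dots> = (\<Sum>c<p. LINT x|\<mu>. x a $ i * x a $ k)"
  proof (intro sum.cong refl)
    show "(LINT x|\<mu>. x c $ i * x c $ k) = (LINT x|\<mu>. x a $ i * x a $ k)" if "c \<in> {..<p}" for c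
      using trans[OF row row[symmetric]] that assms(1) by blast
  qed
  finally show ?thesis using True p_pos by simp
qed

definition mean_sqn_sq :: real where
  "mean_sqn_sq = (LINT x|\<mu>. (sqn p x)^2)"

lemma mean_sqn_sq_nonneg: "0 \<le> mean_sqn_sq"
  by (simp add: mean_sqn_sq_def)

text \<open>
  For \<open>a \<noteq> b\<close> the unit vectors \<open>(e\<^sub>a \<plusminus> e\<^sub>b) / sqrt 2\<close> give entries with the law of a single entry.
  Comparing fourth moments, \<open>m = E x\<^sub>a\<^sup>4\<close> equals \<open>3 E (x\<^sub>a\<^sup>2 x\<^sub>b\<^sup>2)\<close>. The \<open>p (p - 1)\<close> mixed moments are
  summands of the fourth moment of a whole column, so \<open>m\<close> is at most of order \<open>p\<^sup>-\<^sup>2\<close>.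
\<close>

lemma fourth_moment_entry:
  assumes p2: "2 \<le> p"
  shows "(LINT x|\<mu>. (x 0 $ i)^4) \<le> 6 * mean_sqn_sq / p^2"
proof -
  define m where "m = (LINT x|\<mu>. (x 0 $ i)^4)"
  have mf: "(\<lambda>v::real^'q. (v $ i)^4) \<in> borel_measurable borel"
    by (intro borel_measurable_continuous_onI continuous_intros)
  have int4: "integrable \<mu> (\<lambda>x. (x a $ i)^4)" if "a < p" for a
    using integrable_entry22[OF that that, of i i] by (simp flip: power_add)
  have m22: "(LINT x|\<mu>. (x a $ i)^2 * (x b $ i)^2) = m / 3" if ab: "a < p" "b < p" "a \<noteq> b" for a b
  proof -
    have dir: "(LINT x|\<mu>. (x a $ i + e * x b $ i)^4) = 4 * m" if e: "e^2 = 1" for e :: real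
    proof -
      define w where "w k = (if k = a then 1 / sqrt 2 else 0) + (if k = b then e / sqrt 2 else 0)" for k
      have "(w k)^2 = (if k = a then 1/2 else 0) + (if k = b then 1/2 else 0)" for k
        using ab(3) e by (auto simp: w_def power_divide)
      then have "(\<Sum>k<p. (w k)^2) = 1" using ab by (simp add: sum.distrib)
      from integral_row_direction[OF mf this]
      have "m = (LINT x|\<mu>. ((\<Sum>k<p. w k *\<^sub>R x k) $ i)^4)" by (simp add: m_def)
      also have "\<dots> = (LINT x|\<mu>. (x a $ i + e * x b $ i)^4 / 4)"
      proof (rule Bochner_Integration.integral_cong[OF refl])
        fix x :: "nat \<Rightarrow> real^'q"
        have "w k *\<^sub>R x k = (if k = a then (1 / sqrt 2) *\<^sub>R x a else 0) + (if k = b then (e / sqrt 2) *\<^sub>R x b else 0)" for k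
          using ab(3) by (simp add: w_def)
        then have "(\<Sum>k<p. w k *\<^sub>R x k) = (1 / sqrt 2) *\<^sub>R x a + (e / sqrt 2) *\<^sub>R x b"
          using ab(1,2) by (simp add: sum.distrib)
        then have "(\<Sum>k<p. w k *\<^sub>R x k) $ i = (1 / sqrt 2) * x a $ i + (e / sqrt 2) * x b $ i"
          by (simp only: vector_add_component vector_scaleR_component) simp
        then have "(\<Sum>k<p. w k *\<^sub>R x k) $ i = (x a $ i + e * x b $ i) / sqrt 2"
          by (simp add: add_divide_distrib)
        moreover have "(sqrt 2)^4 = (4::real)"
          using power_mult[of "sqrt 2" 2 2] by simp
        ultimately show "((\<Sum>k<p. w k *\<^sub>R x k) $ i)^4 = (x a $ i + e * x b $ i)^4 / 4"
          by (simp add: power_divide)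
      qed
      finally show ?thesis by simp
    qed
    have id: "(y + 1 * z)^4 + (y + (-1) * z)^4 = 2 * y^4 + 12 * (y^2 * z^2) + 2 * z^4" for y z :: real
      by (simp add: power2_eq_square power4_eq_xxxx algebra_simps)
    have int: "integrable \<mu> (\<lambda>x. (x a $ i + e * x b $ i)^4)" for e
    proof (rule Bochner_Integration.integrable_bound)
      show "integrable \<mu> (\<lambda>x. 8 * (x a $ i)^4 + 8 * e^4 * (x b $ i)^4)" using int4 ab by simp
      show "(\<lambda>x. (x a $ i + e * x b $ i)^4) \<in> borel_measurable \<mu>"
        using ab by (intro borel_measurable_power borel_measurable_add borel_measurable_times
           borel_measurable_const measurable_entry)
      have "(y + z)^4 \<le> 8 * y^4 + 8 * z^4" for y z :: real
      proof -
        have sq: "(s + t)^2 \<le> 2 * s^2 + 2 * t^2" for s t :: real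
          using zero_le_power2[of "s - t"] by (simp add: power2_eq_square algebra_simps)
        have "(y + z)^4 = ((y + z)^2)^2" by simp
        also have "\<dots> \<le> (2 * y^2 + 2 * z^2)^2" using sq[of y z] by (intro power_mono) auto
        also have "\<dots> \<le> 8 * y^4 + 8 * z^4" using sq[of "2 * y^2" "2 * z^2"] by (simp add: power_mult_distrib)
        finally show ?thesis .
      qed
      from this[of "_" "e * _"] show "AE x in \<mu>. norm ((x a $ i + e * x b $ i)^4) \<le> norm (8 * (x a $ i)^4 + 8 * e^4 * (x b $ i)^4)"
        by (intro AE_I2) (simp add: power_mult_distrib mult.assoc abs_of_nonneg)
    qed
    have "8 * m = (LINT x|\<mu>. (x a $ i + 1 * x b $ i)^4) + (LINT x|\<mu>. (x a $ i + (-1) * x b $ i)^4)"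
      using dir[of 1] dir[of "-1"] by simp
    also have "\<dots> = (LINT x|\<mu>. (x a $ i + 1 * x b $ i)^4 + (x a $ i + (-1) * x b $ i)^4)"
      by (rule Bochner_Integration.integral_add[symmetric]) (rule int)+
    also have "\<dots> = (LINT x|\<mu>. 2 * (x a $ i)^4 + 12 * ((x a $ i)^2 * (x b $ i)^2) + 2 * (x b $ i)^4)"
      by (simp only: id)
    also have "\<dots> = 2 * (LINT x|\<mu>. (x a $ i)^4) + 12 * (LINT x|\<mu>. (x a $ i)^2 * (x b $ i)^2) + 2 * (LINT x|\<mu>. (x b $ i)^4)"
      using int4 integrable_entry22 ab by simp
    also have "\<dots> = 4 * m + 12 * (LINT x|\<mu>. (x a $ i)^2 * (x b $ i)^2)"
      using integral_row_eq[OF mf ab(1)] integral_row_eq[OF mf ab(2)] by (simp add: m_def)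
    finally show ?thesis by simp
  qed
  have "real p * (real p - 1) * (m / 3) = (\<Sum>a<p. \<Sum>b\<in>{..<p} - {a}. m / 3)"
    using p2 by (simp add: of_nat_diff)
  also have "\<dots> = (\<Sum>a<p. (\<Sum>b\<in>{..<p} - {a}. (LINT x|\<mu>. (x a $ i)^2 * (x b $ i)^2)))"
    using m22 by (intro sum.cong) auto
  also have "\<dots> = (LINT x|\<mu>. (\<Sum>a<p. (\<Sum>b\<in>{..<p} - {a}. (x a $ i)^2 * (x b $ i)^2)))"
    by (rule integral_double_sum[symmetric]) (auto intro: integrable_entry22)
  also have "\<dots> \<le> mean_sqn_sq"
    unfolding mean_sqn_sq_def
  proof (rule integral_mono)
    show "integrable \<mu> (\<lambda>x. \<Sum>a<p. \<Sum>b\<in>{..<p} - {a}. (x a $ i)^2 * (x b $ i)^2)"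
      by (auto intro!: Bochner_Integration.integrable_sum integrable_entry22)
    fix x :: "nat \<Rightarrow> real^'q"
    have "(\<Sum>a<p. \<Sum>b\<in>{..<p} - {a}. (x a $ i)^2 * (x b $ i)^2) \<le> (\<Sum>a<p. \<Sum>b<p. (x a $ i)^2 * (x b $ i)^2)"
      by (intro sum_mono sum_mono2) auto
    also have "\<dots> = (\<Sum>a<p. (x a $ i)^2)^2" by (simp add: power2_eq_square sum_product)
    also have "\<dots> \<le> (sqn p x)^2"
    proof -
      have "(x a $ i)^2 \<le> (norm (x a))^2" for a
        using component_le_norm_cart[of "x a" i] abs_le_square_iff[of "x a $ i" "norm (x a)"] by simp
      then show ?thesis
        unfolding sqn_def by (intro power_mono[OF sum_mono]) (auto simp: sum_nonneg)
    qed
    finally show "(\<Sum>a<p. \<Sum>b\<in>{..<p} - {a}. (x a $ i)^2 * (x b $ i)^2) \<le> (sqn p x)^2" .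
  qed (rule fourth_moment)
  finally have main: "real p * (real p - 1) * (m / 3) \<le> mean_sqn_sq" .
  have m0: "0 \<le> m" by (simp add: m_def)
  \<comment> \<open>\<open>p (p - 1) \<ge> p\<^sup>2 / 2\<close> for \<open>p \<ge> 2\<close>\<close>
  have "real p ^ 2 / 2 * (m / 3) \<le> real p * (real p - 1) * (m / 3)"
    using p2 m0 by (intro mult_right_mono) (auto simp: power2_eq_square field_simps)
  with main have "real p ^ 2 / 2 * (m / 3) \<le> mean_sqn_sq" by linarith
  then have "real p ^ 2 * m \<le> 6 * mean_sqn_sq" by simp
  then have "m \<le> 6 * mean_sqn_sq / real p ^ 2"
    using p_pos by (simp add: pos_le_divide_eq mult.commute)
  then show ?thesis unfolding m_def by simp
qed

lemma lin_form_entries: "lin_form p c x = (\<Sum>i\<in>UNIV. (\<Sum>a<p. c a $ i *\<^sub>R x a) $ i)"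
  unfolding lin_form_def inner_vec_def by (subst sum.swap) simp

lemma measurable_lin_form [measurable]: "lin_form p c \<in> borel_measurable \<mu>"
  unfolding lin_form_def by measurable

lemma lin_form_sq_le: "(lin_form p c x)^2 \<le> sqn p c * sqn p x"
proof -
  have "\<bar>lin_form p c x\<bar> \<le> (\<Sum>a<p. norm (c a) * norm (x a))"
    unfolding lin_form_def by (rule order_trans[OF sum_abs]) (intro sum_mono Cauchy_Schwarz_ineq2)
  also have "\<dots> \<le> L2_set (\<lambda>a. norm (c a)) {..<p} * L2_set (\<lambda>a. norm (x a)) {..<p}"
    using L2_set_mult_ineq[of "\<lambda>a. norm (c a)" "\<lambda>a. norm (x a)" "{..<p}"] by simp
  also have "\<dots> = sqrt (sqn p c * sqn p x)" by (simp add: L2_set_def sqn_def real_sqrt_mult)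
  finally have "\<bar>lin_form p c x\<bar>^2 \<le> (sqrt (sqn p c * sqn p x))^2"
    by (intro power_mono) auto
  then show ?thesis by (simp add: sqn_nonneg)
qed

lemma integrable_lin_form_sq: "integrable \<mu> (\<lambda>x. (lin_form p c x)^2)"
proof (rule Bochner_Integration.integrable_bound)
  show "integrable \<mu> (\<lambda>x. sqn p c * sqn p x)" using integrable_sqn by simp
  show "AE x in \<mu>. norm ((lin_form p c x)^2) \<le> norm (sqn p c * sqn p x)"
    using lin_form_sq_le[of c] by (intro AE_I2) (simp add: abs_mult sqn_nonneg)
qed measurable

lemma integrable_lin_form_pow4: "integrable \<mu> (\<lambda>x. (lin_form p c x)^4)"
proof (rule Bochner_Integration.integrable_bound)
  show "integrable \<mu> (\<lambda>x. (sqn p c)^2 * (sqn p x)^2)" using fourth_moment by simp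
  have "((lin_form p c x)^2)^2 \<le> (sqn p c * sqn p x)^2" for x
    using lin_form_sq_le by (intro power_mono) auto
  then show "AE x in \<mu>. norm ((lin_form p c x)^4) \<le> norm ((sqn p c)^2 * (sqn p x)^2)"
    by (simp add: power_mult_distrib)
qed measurable

lemma integral_lin_form_sq:
  "(LINT x|\<mu>. (lin_form p c x)^2) =
     (\<Sum>a<p. \<Sum>i\<in>UNIV. \<Sum>k\<in>UNIV. c a $ i * c a $ k * second_moment $ i $ k) / p"
proof -
  have "(lin_form p c x)^2 = (\<Sum>a<p. \<Sum>b<p. \<Sum>i\<in>UNIV. \<Sum>k\<in>UNIV. (c a $ i * c b $ k) * (x a $ i * x b $ k))" for x
    by (simp add: lin_form_def power2_eq_square sum_product inner_vec_def mult_ac)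
  then have "(LINT x|\<mu>. (lin_form p c x)^2) =
      (LINT x|\<mu>. (\<Sum>a<p. \<Sum>b<p. \<Sum>i\<in>UNIV. \<Sum>k\<in>UNIV. (c a $ i * c b $ k) * (x a $ i * x b $ k)))"
    by simp
  also have "\<dots> = (\<Sum>a<p. \<Sum>b<p. (LINT x|\<mu>. (\<Sum>i\<in>UNIV. \<Sum>k\<in>UNIV. (c a $ i * c b $ k) * (x a $ i * x b $ k))))"
    by (intro integral_double_sum Bochner_Integration.integrable_sum integrable_mult_right integrable_entry2) auto
  also have "\<dots> = (\<Sum>a<p. \<Sum>b<p. \<Sum>i\<in>UNIV. \<Sum>k\<in>UNIV. (LINT x|\<mu>. (c a $ i * c b $ k) * (x a $ i * x b $ k)))"
    by (intro sum.cong refl integral_double_sum integrable_mult_right integrable_entry2) auto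
  also have "\<dots> = (\<Sum>a<p. \<Sum>b<p. \<Sum>i\<in>UNIV. \<Sum>k\<in>UNIV. (c a $ i * c b $ k) * (LINT x|\<mu>. x a $ i * x b $ k))"
    by simp
  also have "\<dots> = (\<Sum>a<p. \<Sum>b<p. if a = b then \<Sum>i\<in>UNIV. \<Sum>k\<in>UNIV. (c a $ i * c b $ k) * (second_moment $ i $ k / p) else 0)"
    by (intro sum.cong refl) (auto simp: integral_entry2)
  also have "\<dots> = (\<Sum>a<p. \<Sum>i\<in>UNIV. \<Sum>k\<in>UNIV. (c a $ i * c a $ k) * (second_moment $ i $ k / p))"
    by (intro sum.cong refl) simp
  finally show ?thesis by (simp add: sum_divide_distrib)
qed

text \<open>
  The contribution of column \<open>i\<close> of \<open>x\<close> is the length of column \<open>i\<close> of \<open>c\<close> times a variable with the law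
  of a single entry. The cube of the number of columns comes from the power mean inequality.
\<close>

lemma integral_lin_form_pow4_le:
  assumes p2: "2 \<le> p"
  shows "(LINT x|\<mu>. (lin_form p c x)^4) \<le> 6 * real CARD('q)^3 * mean_sqn_sq / p^2 * (sqn p c)^2"
proof -
  define q where "q = real CARD('q)"
  define W where "W i = (\<Sum>a<p. (c a $ i)^2)" for i
  define y where "y i x = (\<Sum>a<p. c a $ i *\<^sub>R x a) $ i" for i and x :: "nat \<Rightarrow> real^'q"
  have W0: "0 \<le> W i" for i by (simp add: W_def sum_nonneg)
  have pm: "(\<Sum>i\<in>UNIV. z i)^4 \<le> q^3 * (\<Sum>i\<in>UNIV. (z i)^4)" for z :: "'q \<Rightarrow> real"
  proof -
    have cs: "(\<Sum>i\<in>UNIV. z i)^2 \<le> q * (\<Sum>i\<in>UNIV. (z i)^2)" for z :: "'q \<Rightarrow> real"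
      using sum_squared_le_sum_of_squares[of z "UNIV::'q set"] by (simp add: q_def mult.commute)
    have "(\<Sum>i\<in>UNIV. z i)^4 = ((\<Sum>i\<in>UNIV. z i)^2)^2" by simp
    also have "\<dots> \<le> (q * (\<Sum>i\<in>UNIV. (z i)^2))^2" by (intro power_mono cs) auto
    also have "\<dots> = q^2 * (\<Sum>i\<in>UNIV. (z i)^2)^2" by (rule power_mult_distrib)
    also have "\<dots> \<le> q^2 * (q * (\<Sum>i\<in>UNIV. ((z i)^2)^2))" by (intro mult_left_mono cs) auto
    finally show ?thesis by (simp add: power3_eq_cube power2_eq_square power4_eq_xxxx mult_ac)
  qed
  have my: "y i \<in> borel_measurable \<mu>" for i
  proof -
    have "y i = (\<lambda>x. \<Sum>a<p. c a $ i * x a $ i)" by (simp add: y_def fun_eq_iff)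
    then show ?thesis by (auto intro!: borel_measurable_sum borel_measurable_times measurable_entry)
  qed
  have ysq: "(y i x)^4 = (lin_form p (\<lambda>a. axis i (c a $ i)) x)^4" for i x
    by (simp add: y_def lin_form_def inner_axis')
  then have inty: "integrable \<mu> (\<lambda>x. (y i x)^4)" for i
    using integrable_lin_form_pow4[of "\<lambda>a. axis i (c a $ i)"] by simp
  have yi: "(LINT x|\<mu>. (y i x)^4) \<le> (W i)^2 * (6 * mean_sqn_sq / p^2)" for i
  proof (cases "W i = 0")
    case True
    then have "\<forall>a<p. c a $ i = 0" by (simp add: W_def sum_nonneg_eq_0_iff)
    then have "y i x = 0" for x by (simp add: y_def)
    then show ?thesis using True by simp
  next
    case False
    define w where "w a = c a $ i / sqrt (W i)" for a
    have "(\<Sum>a<p. (w a)^2) = 1"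
      using False W0[of i] by (simp add: w_def power_divide flip: sum_divide_distrib) (simp add: W_def)
    moreover have mf: "(\<lambda>v::real^'q. (v $ i)^4) \<in> borel_measurable borel"
      by (intro borel_measurable_continuous_onI continuous_intros)
    ultimately have "(LINT x|\<mu>. ((\<Sum>a<p. w a *\<^sub>R x a) $ i)^4) = (LINT x|\<mu>. (x 0 $ i)^4)"
      using integral_row_direction by blast
    moreover have "(y i x)^4 = (W i)^2 * ((\<Sum>a<p. w a *\<^sub>R x a) $ i)^4" for x
    proof -
      have "y i x = sqrt (W i) * (\<Sum>a<p. w a *\<^sub>R x a) $ i"
        using False by (simp add: y_def w_def sum_distrib_left)
      moreover have "(sqrt (W i))^4 = (W i)^2"
        using power_mult[of "sqrt (W i)" 2 2] W0[of i] by simp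
      ultimately show ?thesis by (simp add: power_mult_distrib)
    qed
    ultimately have "(LINT x|\<mu>. (y i x)^4) = (W i)^2 * (LINT x|\<mu>. (x 0 $ i)^4)" by simp
    also have "\<dots> \<le> (W i)^2 * (6 * mean_sqn_sq / p^2)"
      by (intro mult_left_mono fourth_moment_entry p2) auto
    finally show ?thesis .
  qed
  have sumW: "(\<Sum>i\<in>UNIV. (W i)^2) \<le> (sqn p c)^2"
  proof -
    have "(\<Sum>i\<in>UNIV. (W i)^2) \<le> (\<Sum>i\<in>UNIV. W i)^2"
    proof -
      have "(\<Sum>i\<in>UNIV. (W i)^2) = (\<Sum>i\<in>UNIV. W i * W i)" by (simp add: power2_eq_square)
      also have "\<dots> \<le> (\<Sum>i\<in>UNIV. W i * (\<Sum>j\<in>UNIV. W j))"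
        using W0 by (intro sum_mono mult_left_mono member_le_sum) auto
      finally show ?thesis by (simp add: power2_eq_square sum_distrib_right)
    qed
    also have "(\<Sum>i\<in>UNIV. W i) = sqn p c"
      unfolding W_def sqn_def power2_norm_eq_inner inner_vec_def
      by (subst sum.swap) (simp add: power2_eq_square)
    finally show ?thesis .
  qed
  have "(LINT x|\<mu>. (lin_form p c x)^4) \<le> (LINT x|\<mu>. q^3 * (\<Sum>i\<in>UNIV. (y i x)^4))"
    using integrable_lin_form_pow4 inty pm
    by (intro integral_mono) (auto simp: lin_form_entries y_def)
  also have "\<dots> = q^3 * (\<Sum>i\<in>UNIV. (LINT x|\<mu>. (y i x)^4))" using inty by simp
  also have "\<dots> \<le> q^3 * (\<Sum>i\<in>UNIV. (W i)^2 * (6 * mean_sqn_sq / p^2))"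
    by (intro mult_left_mono sum_mono yi) (simp add: q_def)
  also have "\<dots> = q^3 * (6 * mean_sqn_sq / p^2) * (\<Sum>i\<in>UNIV. (W i)^2)"
    by (subst sum_distrib_right[symmetric]) (simp add: mult_ac)
  also have "\<dots> \<le> q^3 * (6 * mean_sqn_sq / p^2) * (sqn p c)^2"
    using mean_sqn_sq_nonneg by (intro mult_left_mono sumW) (auto simp: q_def)
  finally show ?thesis by (simp add: q_def mult_ac)
qed

end

section \<open>Gram matrices of sums and elementary estimates\<close>

definition mat_add :: "nat \<Rightarrow> (nat \<Rightarrow> real^'q) \<Rightarrow> (nat \<Rightarrow> real^'q) \<Rightarrow> nat \<Rightarrow> real^'q" where
  "mat_add p S x = (\<lambda>i\<in>{..<p}. S i + x i)"

lemma inner_gram: "t \<bullet> gram p x = (\<Sum>a<p. x a \<bullet> (t *v x a))"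
proof -
  have "t \<bullet> gram p x = (\<Sum>i\<in>UNIV. \<Sum>j\<in>UNIV. \<Sum>a<p. x a $ i * (t $ i $ j * x a $ j))"
    by (simp add: inner_vec_def gram_def sum_distrib_left mult_ac)
  also have "\<dots> = (\<Sum>i\<in>UNIV. \<Sum>a<p. \<Sum>j\<in>UNIV. x a $ i * (t $ i $ j * x a $ j))"
    by (intro sum.cong refl sum.swap)
  also have "\<dots> = (\<Sum>a<p. \<Sum>i\<in>UNIV. \<Sum>j\<in>UNIV. x a $ i * (t $ i $ j * x a $ j))"
    by (rule sum.swap)
  also have "\<dots> = (\<Sum>a<p. x a \<bullet> (t *v x a))"
    by (simp add: inner_vec_def matrix_vector_mult_def sum_distrib_left)
  finally show ?thesis .
qed

lemma inner_gram_mat_add: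
  "t \<bullet> gram p (mat_add p S x) =
     t \<bullet> gram p S + t \<bullet> gram p x + lin_form p (\<lambda>a. (t + transpose t) *v S a) x"
proof -
  have "(S a + x a) \<bullet> (t *v (S a + x a)) =
      S a \<bullet> (t *v S a) + x a \<bullet> (t *v x a) + ((t + transpose t) *v S a) \<bullet> x a" for a
  proof -
    have "(transpose t *v S a) \<bullet> x a = S a \<bullet> (t *v x a)"
      by (simp add: transpose_matrix_vector dot_lmul_matrix)
    then show ?thesis
      by (simp add: matrix_vector_right_distrib matrix_vector_mult_add_rdistrib inner_add_left
          inner_add_right inner_commute[of "t *v S a"])
  qed
  then show ?thesis
    unfolding inner_gram lin_form_def
    by (simp add: mat_add_def sum.distrib)
qed

lemma sqn_mat_add: "sqn p (mat_add p S x) \<le> 2 * sqn p S + 2 * sqn p x"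
proof -
  have "(norm (u + v))^2 \<le> 2 * (norm u)^2 + 2 * (norm v)^2" for u v :: "real^'a"
    using zero_le_power2[of "norm (u - v)"]
    by (simp add: power2_norm_eq_inner inner_add_left inner_add_right inner_diff_left inner_diff_right inner_commute)
  then have "sqn p (mat_add p S x) \<le> (\<Sum>a<p. 2 * (norm (S a))^2 + 2 * (norm (x a))^2)"
    unfolding sqn_def by (intro sum_mono) (simp add: mat_add_def)
  then show ?thesis by (simp add: sqn_def sum.distrib sum_distrib_left)
qed

lemma abs_inner_gram_le: "\<bar>t \<bullet> gram p x\<bar> \<le> onorm ((*v) t) * sqn p x"
proof -
  have "\<bar>t \<bullet> gram p x\<bar> \<le> (\<Sum>a<p. \<bar>x a \<bullet> (t *v x a)\<bar>)"
    unfolding inner_gram by (rule sum_abs)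
  also have "\<dots> \<le> (\<Sum>a<p. onorm ((*v) t) * (norm (x a))^2)"
  proof (intro sum_mono)
    fix a
    have "\<bar>x a \<bullet> (t *v x a)\<bar> \<le> norm (x a) * norm (t *v x a)" by (rule Cauchy_Schwarz_ineq2)
    also have "\<dots> \<le> norm (x a) * (onorm ((*v) t) * norm (x a))"
      by (intro mult_left_mono onorm) auto
    finally show "\<bar>x a \<bullet> (t *v x a)\<bar> \<le> onorm ((*v) t) * (norm (x a))^2"
      by (simp add: power2_eq_square mult_ac)
  qed
  finally show ?thesis by (simp add: sqn_def sum_distrib_left)
qed

lemma sqn_eq_inner_gram: "sqn p x = mat 1 \<bullet> gram p x"
  by (simp add: inner_gram sqn_def power2_norm_eq_inner)

lemma sqn_matrix_image_le: "sqn p (\<lambda>a. h *v S a) \<le> (onorm ((*v) h))^2 * sqn p S"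
proof -
  have "(norm (h *v S a))^2 \<le> (onorm ((*v) h))^2 * (norm (S a))^2" for a
    unfolding power_mult_distrib[symmetric] by (intro power_mono onorm) auto
  then show ?thesis unfolding sqn_def sum_distrib_left by (intro sum_mono)
qed

lemma cross_form_gram:
  "cross_form t R \<bullet> gram p S =
     (\<Sum>a<p. \<Sum>i\<in>UNIV. \<Sum>k\<in>UNIV. ((t + transpose t) *v S a) $ i * ((t + transpose t) *v S a) $ k * R $ i $ k)"
proof -
  have "v \<bullet> (cross_form t R *v v) =
     (\<Sum>i\<in>UNIV. \<Sum>k\<in>UNIV. ((t + transpose t) *v v) $ i * ((t + transpose t) *v v) $ k * R $ i $ k)" for v
  proof -
    define f where "f i j k l = (t $ i $ j + t $ j $ i) * v $ j * ((t $ k $ l + t $ l $ k) * v $ l) * R $ i $ k" for i j k l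
    have "v \<bullet> (cross_form t R *v v) = (\<Sum>j\<in>UNIV. \<Sum>l\<in>UNIV. \<Sum>i\<in>UNIV. \<Sum>k\<in>UNIV. f i j k l)"
      by (simp add: inner_vec_def matrix_vector_mult_def cross_form_def sum_distrib_left
          sum_distrib_right f_def mult_ac)
    also have "\<dots> = (\<Sum>j\<in>UNIV. \<Sum>i\<in>UNIV. \<Sum>k\<in>UNIV. \<Sum>l\<in>UNIV. f i j k l)"
    proof (rule sum.cong[OF refl])
      fix j
      have "(\<Sum>l\<in>UNIV. \<Sum>i\<in>UNIV. \<Sum>k\<in>UNIV. f i j k l) = (\<Sum>i\<in>UNIV. \<Sum>l\<in>UNIV. \<Sum>k\<in>UNIV. f i j k l)"
        by (rule sum.swap)
      also have "\<dots> = (\<Sum>i\<in>UNIV. \<Sum>k\<in>UNIV. \<Sum>l\<in>UNIV. f i j k l)"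
        by (intro sum.cong refl sum.swap)
      finally show "(\<Sum>l\<in>UNIV. \<Sum>i\<in>UNIV. \<Sum>k\<in>UNIV. f i j k l) =
          (\<Sum>i\<in>UNIV. \<Sum>k\<in>UNIV. \<Sum>l\<in>UNIV. f i j k l)" .
    qed
    also have "\<dots> = (\<Sum>i\<in>UNIV. \<Sum>j\<in>UNIV. \<Sum>k\<in>UNIV. \<Sum>l\<in>UNIV. f i j k l)"
      by (rule sum.swap)
    also have "\<dots> = (\<Sum>i\<in>UNIV. \<Sum>k\<in>UNIV. \<Sum>j\<in>UNIV. \<Sum>l\<in>UNIV. f i j k l)"
      by (intro sum.cong refl sum.swap)
    also have "\<dots> = (\<Sum>i\<in>UNIV. \<Sum>k\<in>UNIV. (\<Sum>j\<in>UNIV. (t $ i $ j + t $ j $ i) * v $ j) *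
        (\<Sum>l\<in>UNIV. (t $ k $ l + t $ l $ k) * v $ l) * R $ i $ k)"
      unfolding f_def sum_product by (simp only: sum_distrib_right)
    finally show ?thesis by (simp add: matrix_vector_mult_def transpose_def)
  qed
  then show ?thesis unfolding inner_gram by simp
qed

lemma measurable_rect_mat_row [measurable (raw)]:
  "a \<in> {..<p} \<Longrightarrow> (\<lambda>x. x a) \<in> borel_measurable (rect_mat p)"
  unfolding rect_mat_def by (rule measurable_component_singleton)

lemma measurable_mat_add:
  "(\<lambda>(S, x). mat_add p S x) \<in> rect_mat p \<Otimes>\<^sub>M rect_mat p \<rightarrow>\<^sub>M (rect_mat p :: (nat \<Rightarrow> real^'q) measure)"
  unfolding mat_add_def rect_mat_def by measurable

lemma measurable_inner_gram [measurable]: "(\<lambda>x. t \<bullet> gram p x) \<in> borel_measurable (rect_mat p)"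
proof -
  have "(\<lambda>v. v \<bullet> (t *v v)) \<in> borel_measurable borel"
    by (intro borel_measurable_continuous_onI continuous_intros linear_continuous_on) simp
  then show ?thesis
    unfolding inner_gram by (intro borel_measurable_sum) (rule measurable_compose[OF measurable_rect_mat_row])
qed

lemma measurable_sqn [measurable]: "sqn p \<in> borel_measurable (rect_mat p)"
  unfolding sqn_eq_inner_gram[abs_def] by measurable

text \<open>
  The remainder of the second order Taylor expansion is at most the minimum of the square and the cube
  of the increment. The larger of the two parts dominates: if it is \<open>a\<close>, both bounds are kept, since
  only second moments of \<open>a\<close> will be available; if it is \<open>b\<close>, the cube is split by the inequality of
  arithmetic and geometric means between the second and the fourth power.
\<close>

lemma iexp_split_bound:
  fixes a b d :: real
  assumes d: "0 < d"
  shows "cmod (iexp (a + b) - (1 + \<i> * of_real (a + b) - of_real ((a + b)^2 / 2)))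
      \<le> 4 * min (a^2) (\<bar>a\<bar>^3) + (d * b^2 + b^4 / d)"
proof -
  define z where "z = a + b"
  have taylor: "(\<Sum>k\<le>2. (\<i> * complex_of_real z)^k / fact k) = 1 + \<i> * of_real z - of_real (z^2 / 2)"
    by (simp add: numeral_2_eq_2 power_mult_distrib)
  have b1: "cmod (iexp z - (1 + \<i> * of_real z - of_real (z^2 / 2))) \<le> \<bar>z\<bar>^3 / 6"
    using iexp_approx1[of z 2] unfolding taylor by (simp add: eval_nat_numeral)
  have b2: "cmod (iexp z - (1 + \<i> * of_real z - of_real (z^2 / 2))) \<le> z^2"
    using iexp_approx2[of z 2] unfolding taylor by (simp add: eval_nat_numeral)
  have amgm: "2 * \<bar>b\<bar>^3 \<le> d * b^2 + b^4 / d"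
  proof -
    have "2 * c^3 \<le> d * c^2 + c^4 / d" for c :: real
    proof -
      have "0 \<le> (d * c - c^2)^2 / d" using d by simp
      also have "\<dots> = d * c^2 + c^4 / d - 2 * c^3"
        using d by (simp add: field_simps power2_eq_square power3_eq_cube power4_eq_xxxx)
      finally show ?thesis by simp
    qed
    from this[of "\<bar>b\<bar>"] show ?thesis by simp
  qed
  have nn: "0 \<le> d * b^2 + b^4 / d" using d by simp
  show ?thesis
  proof (cases "\<bar>b\<bar> \<le> \<bar>a\<bar>")
    case True
    then have z: "\<bar>z\<bar> \<le> 2 * \<bar>a\<bar>" by (simp add: z_def)
    have "z^2 \<le> 4 * a^2" using power_mono[OF z, of 2] by (simp add: power_mult_distrib)
    moreover have "\<bar>z\<bar>^3 \<le> 8 * \<bar>a\<bar>^3" using power_mono[OF z, of 3] by (simp add: power_mult_distrib)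
    moreover have "0 \<le> \<bar>a\<bar>^3" by simp
    ultimately have "cmod (iexp z - (1 + \<i> * of_real z - of_real (z^2 / 2))) \<le> 4 * a^2"
        "cmod (iexp z - (1 + \<i> * of_real z - of_real (z^2 / 2))) \<le> 4 * \<bar>a\<bar>^3"
      using b1 b2 by linarith+
    then have "cmod (iexp z - (1 + \<i> * of_real z - of_real (z^2 / 2))) \<le> 4 * min (a^2) (\<bar>a\<bar>^3)"
      by (simp add: min_def)
    with nn show ?thesis unfolding z_def by linarith
  next
    case False
    then have z: "\<bar>z\<bar> \<le> 2 * \<bar>b\<bar>" by (simp add: z_def)
    have "\<bar>z\<bar>^3 \<le> 8 * \<bar>b\<bar>^3" using power_mono[OF z, of 3] by (simp add: power_mult_distrib)
    moreover have "0 \<le> \<bar>b\<bar>^3" by simp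
    ultimately have "cmod (iexp z - (1 + \<i> * of_real z - of_real (z^2 / 2))) \<le> 2 * \<bar>b\<bar>^3"
      using b1 by linarith
    moreover have "0 \<le> 4 * min (a^2) (\<bar>a\<bar>^3)" by simp
    ultimately show ?thesis using amgm unfolding z_def by linarith
  qed
qed

lemma exp_minus_bound:
  fixes u :: real
  assumes "0 \<le> u"
  shows "\<bar>exp (- u) - (1 - u)\<bar> \<le> u^2"
proof -
  have "exp (- u) \<ge> 1 - u" using exp_ge_add_one_self[of "- u"] by simp
  moreover have "exp (- u) \<le> 1 / (1 + u)"
    using exp_ge_add_one_self[of u] assms by (simp add: exp_minus field_simps)
  moreover have "1 / (1 + u) - (1 - u) \<le> u^2"
  proof -
    have "1 / (1 + u) - (1 - u) = u^2 / (1 + u)"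
      using assms by (simp add: field_simps power2_eq_square)
    also have "\<dots> \<le> u^2" using assms by (simp add: divide_le_eq mult_left_mono algebra_simps)
    finally show ?thesis .
  qed
  ultimately show ?thesis by linarith
qed

text \<open>
  All factors \<open>exp (-v / 2)\<close> are at most 1, so the error of a step is not amplified by later steps.
\<close>

lemma telescoping_product_bound:
  fixes \<phi> :: "nat \<Rightarrow> complex" and v \<epsilon> :: "nat \<Rightarrow> real"
  assumes "\<phi> 0 = 1" and v: "\<And>m. m < n \<Longrightarrow> 0 \<le> v m"
    and step: "\<And>m. m < n \<Longrightarrow> cmod (\<phi> (Suc m) - of_real (exp (- v m / 2)) * \<phi> m) \<le> \<epsilon> m"
  shows "cmod (\<phi> n - of_real (exp (- (\<Sum>m<n. v m) / 2))) \<le> (\<Sum>m<n. \<epsilon> m)"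
  using v step
proof (induction n)
  case 0
  then show ?case using assms(1) by simp
next
  case (Suc n)
  define V where "V = (\<Sum>m<n. v m)"
  have IH: "cmod (\<phi> n - of_real (exp (- V / 2))) \<le> (\<Sum>m<n. \<epsilon> m)"
    unfolding V_def by (rule Suc.IH) (use Suc.prems in auto)
  have "exp (- (\<Sum>m<Suc n. v m) / 2) = exp (- v n / 2) * exp (- V / 2)"
    by (simp add: V_def add_divide_distrib flip: exp_add)
  then have "\<phi> (Suc n) - of_real (exp (- (\<Sum>m<Suc n. v m) / 2)) =
      (\<phi> (Suc n) - of_real (exp (- v n / 2)) * \<phi> n) + of_real (exp (- v n / 2)) * (\<phi> n - of_real (exp (- V / 2)))"
    by (simp add: algebra_simps)
  also have "cmod \<dots> \<le> \<epsilon> n + cmod (of_real (exp (- v n / 2)) * (\<phi> n - of_real (exp (- V / 2))))"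
    by (rule norm_triangle_mono) (use Suc.prems in auto)
  also have "cmod (of_real (exp (- v n / 2)) * (\<phi> n - of_real (exp (- V / 2)))) \<le> 1 * (\<Sum>m<n. \<epsilon> m)"
    unfolding norm_mult using IH Suc.prems(1)[of n] by (intro mult_mono) auto
  finally show ?case by simp
qed

section \<open>One step of the walk\<close>

context radial_measure
begin

lemma integrable_inner_gram: "integrable \<mu> (\<lambda>x. t \<bullet> gram p x)"
proof (rule Bochner_Integration.integrable_bound)
  show "integrable \<mu> (\<lambda>x. onorm ((*v) t) * sqn p x)" using integrable_sqn by simp
  show "(\<lambda>x. t \<bullet> gram p x) \<in> borel_measurable \<mu>" by (simp add: measurable_rect_mat_iff)
  show "AE x in \<mu>. norm (t \<bullet> gram p x) \<le> norm (onorm ((*v) t) * sqn p x)"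
    using abs_inner_gram_le[of t p] by (intro AE_I2) (metis abs_ge_self order_trans real_norm_def)
qed

lemma integral_inner_gram: "(LINT x|\<mu>. t \<bullet> gram p x) = t \<bullet> second_moment"
proof -
  have "integrable \<mu> (\<lambda>x. gram p x $ i $ j)" for i j
    by (auto simp: gram_def intro!: Bochner_Integration.integrable_sum integrable_entry2)
  then have "(LINT x|\<mu>. (\<Sum>i\<in>UNIV. \<Sum>j\<in>UNIV. t $ i $ j * gram p x $ i $ j)) =
      (\<Sum>i\<in>UNIV. \<Sum>j\<in>UNIV. (LINT x|\<mu>. t $ i $ j * gram p x $ i $ j))"
    by (intro integral_double_sum) simp
  then show ?thesis by (simp add: inner_vec_def second_moment_def)
qed

definition gram_dev :: "real^'q^'q \<Rightarrow> (nat \<Rightarrow> real^'q) \<Rightarrow> real" where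
  "gram_dev t x = t \<bullet> (gram p x - second_moment)"

definition var_gram_dev :: "real^'q^'q \<Rightarrow> real" where
  "var_gram_dev t = (LINT x|\<mu>. (gram_dev t x)^2)"

text \<open>
  This tends to 0 with \<open>\<tau>\<close> by dominated convergence, although third moments of \<open>gram_dev\<close> may be
  infinite.
\<close>

definition lindeberg :: "real^'q^'q \<Rightarrow> real \<Rightarrow> real" where
  "lindeberg t \<tau> = (LINT x|\<mu>. min ((gram_dev t x)^2) (\<tau> * \<bar>gram_dev t x\<bar>^3))"

lemma gram_dev_eq: "gram_dev t x = t \<bullet> gram p x - t \<bullet> second_moment"
  by (simp add: gram_dev_def inner_diff_right)

lemma measurable_gram_dev [measurable]: "gram_dev t \<in> borel_measurable \<mu>"
  unfolding gram_dev_eq[abs_def] using measurable_inner_gram[of t p]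
  by (simp add: measurable_rect_mat_iff borel_measurable_diff)

lemma integrable_gram_dev: "integrable \<mu> (gram_dev t)"
  unfolding gram_dev_eq[abs_def] using integrable_inner_gram by simp

lemma integral_gram_dev: "(LINT x|\<mu>. gram_dev t x) = 0"
  unfolding gram_dev_eq[abs_def] using integrable_inner_gram integral_inner_gram by (simp add: prob_space)

lemma integrable_gram_dev_sq: "integrable \<mu> (\<lambda>x. (gram_dev t x)^2)"
proof (rule integrable_of_bound)
  define C where "C = 2 * (onorm ((*v) t))^2 + 2 * (t \<bullet> second_moment)^2"
  show "\<bar>(gram_dev t x)^2\<bar> \<le> C * (1 + (sqn p x)^2)" for x
  proof -
    have "(gram_dev t x)^2 \<le> 2 * (t \<bullet> gram p x)^2 + 2 * (t \<bullet> second_moment)^2"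
      using zero_le_power2[of "t \<bullet> gram p x + t \<bullet> second_moment"]
      unfolding gram_dev_eq by (simp add: power2_sum power2_diff)
    also have "(t \<bullet> gram p x)^2 \<le> (onorm ((*v) t))^2 * (sqn p x)^2"
      using power_mono[OF abs_inner_gram_le[of t p x], of 2] by (simp add: power_mult_distrib)
    finally have "(gram_dev t x)^2 \<le> 2 * ((onorm ((*v) t))^2 * (sqn p x)^2) + 2 * (t \<bullet> second_moment)^2"
      by simp
    also have "\<dots> \<le> C * (1 + (sqn p x)^2)"
      by (simp add: C_def algebra_simps)
    finally show ?thesis by simp
  qed
qed measurable

lemma var_gram_dev_nonneg: "0 \<le> var_gram_dev t"
  by (simp add: var_gram_dev_def)

text \<open>
  The orthogonal matrix \<open>-1\<close> maps \<open>x\<close> to \<open>-x\<close>.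
\<close>

lemma integral_odd:
  fixes f :: "_ \<Rightarrow> real"
  assumes f: "f \<in> borel_measurable \<mu>"
    and cong: "\<And>x y. (\<And>i. i < p \<Longrightarrow> x i = y i) \<Longrightarrow> f x = f y"
    and odd: "\<And>x. f (\<lambda>a. - x a) = - f x"
  shows "(LINT x|\<mu>. f x) = 0"
proof -
  define A :: "nat \<Rightarrow> nat \<Rightarrow> real" where "A i j = (if i = j then -1 else 0)" for i j
  have "A \<in> orthogonal_group p"
    by (auto simp: orthogonal_group_def A_def if_distrib if_distribR cong: if_cong)
  from radial_integral[OF this f]
  have "(LINT x|\<mu>. f x) = (LINT x|\<mu>. f (left_mult p A x))" by simp
  also have "\<dots> = (LINT x|\<mu>. - f x)"
  proof (rule Bochner_Integration.integral_cong[OF refl])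
    fix x :: "nat \<Rightarrow> real^'q"
    have "left_mult p A x i = - x i" if "i < p" for i
    proof -
      have "A i j *\<^sub>R x j = (if j = i then - x j else 0)" for j by (simp add: A_def)
      then show ?thesis using that by (simp add: left_mult_def)
    qed
    then have "f (left_mult p A x) = f (\<lambda>a. - x a)" by (intro cong) auto
    then show "f (left_mult p A x) = - f x" by (simp add: odd)
  qed
  finally show ?thesis by simp
qed

lemma lin_form_cong: "(\<And>i. i < p \<Longrightarrow> x i = y i) \<Longrightarrow> lin_form p c x = lin_form p c y"
  by (simp add: lin_form_def)

lemma lin_form_uminus: "lin_form p c (\<lambda>a. - x a) = - lin_form p c x"
  by (simp add: lin_form_def sum_negf)

lemma gram_dev_cong: "(\<And>i. i < p \<Longrightarrow> x i = y i) \<Longrightarrow> gram_dev t x = gram_dev t y"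
  by (simp add: gram_dev_eq inner_gram)

lemma gram_dev_uminus: "gram_dev t (\<lambda>a. - x a) = gram_dev t x"
proof -
  have "t *v (- v) = - (t *v v)" for v using matrix_vector_mult_diff_distrib[of t 0 v] by simp
  then show ?thesis by (simp add: gram_dev_eq inner_gram)
qed

lemma integrable_lin_form: "integrable \<mu> (lin_form p c)"
  using integrable_lin_form_sq[of c] by (rule square_integrable_imp_integrable[rotated]) measurable

lemma integral_lin_form: "(LINT x|\<mu>. lin_form p c x) = 0"
  by (rule integral_odd) (measurable, auto intro: lin_form_cong simp: lin_form_uminus)

lemma integrable_gram_dev_lin_form: "integrable \<mu> (\<lambda>x. gram_dev t x * lin_form p c x)"
proof (rule Bochner_Integration.integrable_bound)
  show "integrable \<mu> (\<lambda>x. (gram_dev t x)^2 + (lin_form p c x)^2)"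
    using integrable_gram_dev_sq integrable_lin_form_sq by simp
  have "\<bar>a * b\<bar> \<le> \<bar>a^2 + b^2\<bar>" for a b :: real
  proof -
    have "0 \<le> (\<bar>a\<bar> - \<bar>b\<bar>)^2" by simp
    then have "2 * (\<bar>a\<bar> * \<bar>b\<bar>) \<le> a^2 + b^2" by (simp add: power2_diff)
    moreover have "0 \<le> \<bar>a\<bar> * \<bar>b\<bar>" by simp
    ultimately show ?thesis unfolding abs_mult by linarith
  qed
  then show "AE x in \<mu>. norm (gram_dev t x * lin_form p c x) \<le> norm ((gram_dev t x)^2 + (lin_form p c x)^2)"
    by simp
qed measurable

lemma integral_gram_dev_lin_form: "(LINT x|\<mu>. gram_dev t x * lin_form p c x) = 0"
proof (rule integral_odd)
  fix x y :: "nat \<Rightarrow> real^'q" assume eq: "\<And>i. i < p \<Longrightarrow> x i = y i"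
  show "gram_dev t x * lin_form p c x = gram_dev t y * lin_form p c y"
    using gram_dev_cong[OF eq] lin_form_cong[OF eq] by simp
next
  fix x :: "nat \<Rightarrow> real^'q"
  show "gram_dev t (\<lambda>a. - x a) * lin_form p c (\<lambda>a. - x a) = - (gram_dev t x * lin_form p c x)"
    by (simp add: gram_dev_uminus lin_form_uminus)
qed measurable

abbreviation coef :: "real^'q^'q \<Rightarrow> (nat \<Rightarrow> real^'q) \<Rightarrow> nat \<Rightarrow> real^'q" where
  "coef t S \<equiv> (\<lambda>a. (t + transpose t) *v S a)"

text \<open>
  The inner product of \<open>t\<close> with the change \<open>(x'x - r) + (S'x + x'S)\<close> of the centred Gram matrix.
\<close>

definition increment :: "real^'q^'q \<Rightarrow> (nat \<Rightarrow> real^'q) \<Rightarrow> (nat \<Rightarrow> real^'q) \<Rightarrow> real" where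
  "increment t S x = gram_dev t x + lin_form p (coef t S) x"

definition cond_var :: "real^'q^'q \<Rightarrow> (nat \<Rightarrow> real^'q) \<Rightarrow> real" where
  "cond_var t S = var_gram_dev t + (cross_form t second_moment \<bullet> gram p S) / p"

lemma integral_lin_form_coef_sq:
  "(LINT x|\<mu>. (lin_form p (coef t S) x)^2) = (cross_form t second_moment \<bullet> gram p S) / p"
  unfolding integral_lin_form_sq cross_form_gram ..

lemma integrable_increment: "integrable \<mu> (increment t S)"
  unfolding increment_def using integrable_gram_dev integrable_lin_form by simp

lemma integral_increment: "(LINT x|\<mu>. increment t S x) = 0"
  unfolding increment_def using integrable_gram_dev integrable_lin_form integral_gram_dev integral_lin_form by simp

lemma increment_sq:
  "(increment t S x)^2 = (gram_dev t x)^2 + (lin_form p (coef t S) x)^2 + 2 * (gram_dev t x * lin_form p (coef t S) x)"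
  by (simp add: increment_def power2_sum)

lemma integrable_increment_sq: "integrable \<mu> (\<lambda>x. (increment t S x)^2)"
  unfolding increment_sq
  by (intro Bochner_Integration.integrable_add integrable_mult_right integrable_gram_dev_sq
      integrable_lin_form_sq integrable_gram_dev_lin_form)

lemma integral_increment_sq: "(LINT x|\<mu>. (increment t S x)^2) = cond_var t S"
proof -
  have "(LINT x|\<mu>. (increment t S x)^2) = (LINT x|\<mu>. (gram_dev t x)^2) + (LINT x|\<mu>. (lin_form p (coef t S) x)^2)
      + 2 * (LINT x|\<mu>. gram_dev t x * lin_form p (coef t S) x)"
    unfolding increment_sq
    using integrable_gram_dev_sq integrable_lin_form_sq integrable_gram_dev_lin_form by simp
  then show ?thesis
    by (simp only: integral_gram_dev_lin_form integral_lin_form_coef_sq cond_var_def var_gram_dev_def)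
qed

definition pow4_const :: "real^'q^'q \<Rightarrow> real" where
  "pow4_const t = 6 * real CARD('q)^3 * mean_sqn_sq * (onorm ((*v) (t + transpose t)))^4"

lemma pow4_const_nonneg: "0 \<le> pow4_const t"
  by (simp add: pow4_const_def mean_sqn_sq_nonneg)

lemma integral_lin_form_coef_pow4_le:
  assumes "2 \<le> p"
  shows "(LINT x|\<mu>. (lin_form p (coef t S) x)^4) \<le> pow4_const t / p^2 * (sqn p S)^2"
proof -
  define h where "h = onorm ((*v) (t + transpose t))"
  have "(LINT x|\<mu>. (lin_form p (coef t S) x)^4) \<le> 6 * real CARD('q)^3 * mean_sqn_sq / p^2 * (sqn p (coef t S))^2"
    by (rule integral_lin_form_pow4_le[OF assms])
  also have "\<dots> \<le> 6 * real CARD('q)^3 * mean_sqn_sq / p^2 * (h^2 * sqn p S)^2"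
    unfolding h_def using mean_sqn_sq_nonneg
    by (intro mult_left_mono power_mono sqn_matrix_image_le) (auto simp: sqn_nonneg)
  also have "\<dots> = pow4_const t / p^2 * (sqn p S)^2"
    by (simp add: pow4_const_def h_def power_mult_distrib)
  finally show ?thesis .
qed

lemma integrable_min_gram_dev:
  assumes "0 \<le> \<tau>"
  shows "integrable \<mu> (\<lambda>x. min ((gram_dev t x)^2) (\<tau> * \<bar>gram_dev t x\<bar>^3))"
  by (rule Bochner_Integration.integrable_bound[OF integrable_gram_dev_sq[of t]]) (use assms in auto)

text \<open>
  The increment has mean zero and variance \<open>cond_var t S\<close>, so the second order Taylor polynomial of the
  exponential integrates to \<open>1 - \<tau>\<^sup>2 cond_var t S / 2\<close>. The parameter \<open>d\<close> balances the second against
  the fourth moment of the linear part.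
\<close>

lemma char_increment_bound:
  assumes p2: "2 \<le> p" and tau: "0 \<le> \<tau>" and d: "0 < d"
  shows "cmod ((CLINT x|\<mu>. iexp (\<tau> * increment t S x)) - of_real (1 - \<tau>^2 * cond_var t S / 2))
     \<le> 4 * \<tau>^2 * lindeberg t \<tau> + d * \<tau>^2 * (cross_form t second_moment \<bullet> gram p S) / p
        + \<tau>^4 * pow4_const t * (sqn p S)^2 / (d * p^2)"
proof -
  define L where "L = lin_form p (coef t S)"
  define r where "r x = iexp (\<tau> * increment t S x) -
      (1 + \<i> * of_real (\<tau> * increment t S x) - of_real ((\<tau> * increment t S x)^2 / 2))" for x
  define g where "g x = 4 * \<tau>^2 * min ((gram_dev t x)^2) (\<tau> * \<bar>gram_dev t x\<bar>^3)
      + (d * \<tau>^2 * (L x)^2 + \<tau>^4 / d * (L x)^4)" for x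
  have [measurable]: "increment t S \<in> borel_measurable \<mu>" using integrable_increment by auto
  have int_iexp: "integrable \<mu> (\<lambda>x. iexp (\<tau> * increment t S x))"
    by (rule integrable_iexp) (auto simp: borel_measurable_times)
  have int2: "integrable \<mu> (\<lambda>x. (\<tau> * increment t S x)^2 / 2)"
    using integrable_increment_sq by (simp add: power_mult_distrib)
  have int1: "integrable \<mu> (\<lambda>x. \<tau> * increment t S x)" using integrable_increment by simp
  have int_poly: "integrable \<mu> (\<lambda>x. 1 + \<i> * of_real (\<tau> * increment t S x) - complex_of_real ((\<tau> * increment t S x)^2 / 2))"
    by (intro Bochner_Integration.integrable_add Bochner_Integration.integrable_diff integrable_mult_right
        integrable_of_real int1 int2) simp
  have int_g: "integrable \<mu> g"
    unfolding g_def L_def using integrable_min_gram_dev[OF tau] integrable_lin_form_sq integrable_lin_form_pow4 by simp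
  have "(CLINT x|\<mu>. r x) = (CLINT x|\<mu>. iexp (\<tau> * increment t S x)) -
      (CLINT x|\<mu>. 1 + \<i> * of_real (\<tau> * increment t S x) - complex_of_real ((\<tau> * increment t S x)^2 / 2))"
    unfolding r_def by (rule Bochner_Integration.integral_diff[OF int_iexp int_poly])
  also have "(CLINT x|\<mu>. 1 + \<i> * of_real (\<tau> * increment t S x) - complex_of_real ((\<tau> * increment t S x)^2 / 2))
      = 1 + \<i> * of_real (LINT x|\<mu>. \<tau> * increment t S x) - of_real (LINT x|\<mu>. (\<tau> * increment t S x)^2 / 2)"
  proof -
    have c1: "integrable \<mu> (\<lambda>x. \<i> * complex_of_real (\<tau> * increment t S x))"
      and c2: "integrable \<mu> (\<lambda>x. complex_of_real ((\<tau> * increment t S x)^2 / 2))"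
      by (intro integrable_mult_right integrable_of_real int1 int2)+
    have "(CLINT x|\<mu>. 1 + \<i> * of_real (\<tau> * increment t S x) - complex_of_real ((\<tau> * increment t S x)^2 / 2))
       = (CLINT x|\<mu>. 1) + (CLINT x|\<mu>. \<i> * of_real (\<tau> * increment t S x)) - (CLINT x|\<mu>. complex_of_real ((\<tau> * increment t S x)^2 / 2))"
      by (simp only: Bochner_Integration.integral_add[OF _ c1] Bochner_Integration.integral_diff[OF Bochner_Integration.integrable_add[OF _ c1] c2]
         integrable_const)
    then show ?thesis
      by (simp only: integral_mult_right_zero integral_complex_of_real lebesgue_integral_const prob_space scaleR_one)
  qed
  also have "\<dots> = of_real (1 - \<tau>^2 * cond_var t S / 2)"
    by (simp add: integral_increment power_mult_distrib integral_increment_sq)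
  finally have eq: "(CLINT x|\<mu>. iexp (\<tau> * increment t S x)) - of_real (1 - \<tau>^2 * cond_var t S / 2) = (CLINT x|\<mu>. r x)"
    by simp
  have "cmod (r x) \<le> g x" for x
  proof -
    have "cmod (r x) \<le> 4 * min ((\<tau> * gram_dev t x)^2) (\<bar>\<tau> * gram_dev t x\<bar>^3) + (d * (\<tau> * L x)^2 + (\<tau> * L x)^4 / d)"
      using iexp_split_bound[OF d, of "\<tau> * gram_dev t x" "\<tau> * L x"]
      by (simp add: r_def increment_def L_def distrib_left)
    also have "min ((\<tau> * gram_dev t x)^2) (\<bar>\<tau> * gram_dev t x\<bar>^3) = \<tau>^2 * min ((gram_dev t x)^2) (\<tau> * \<bar>gram_dev t x\<bar>^3)"
      using tau by (simp add: mult_min_right abs_mult power_mult_distrib power2_eq_square power3_eq_cube mult_ac)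
    finally show ?thesis by (simp add: g_def power_mult_distrib mult_ac)
  qed
  moreover have "complex_integrable \<mu> r"
    unfolding r_def by (rule Bochner_Integration.integrable_diff[OF int_iexp int_poly])
  ultimately have "cmod (CLINT x|\<mu>. r x) \<le> (LINT x|\<mu>. g x)"
    using int_g by (intro order_trans[OF integral_norm_bound] integral_mono integrable_norm) auto
  also have "(LINT x|\<mu>. g x) = 4 * \<tau>^2 * lindeberg t \<tau> + (d * \<tau>^2 * (LINT x|\<mu>. (L x)^2) + \<tau>^4 / d * (LINT x|\<mu>. (L x)^4))"
    unfolding g_def L_def lindeberg_def
    using integrable_min_gram_dev[OF tau] integrable_lin_form_sq integrable_lin_form_pow4 by simp
  also have "\<dots> \<le> 4 * \<tau>^2 * lindeberg t \<tau> + (d * \<tau>^2 * ((cross_form t second_moment \<bullet> gram p S) / p)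
      + \<tau>^4 / d * (pow4_const t / p^2 * (sqn p S)^2))"
    unfolding L_def integral_lin_form_coef_sq
    using integral_lin_form_coef_pow4_le[OF p2, of t S] d by (intro add_left_mono mult_left_mono) auto
  also have "\<dots> = 4 * \<tau>^2 * lindeberg t \<tau> + d * \<tau>^2 * (cross_form t second_moment \<bullet> gram p S) / p
        + \<tau>^4 * pow4_const t * (sqn p S)^2 / (d * p^2)"
    by simp
  finally show ?thesis unfolding eq .
qed

end

section \<open>The walk\<close>

context radial_measure
begin

text \<open>
  The law of the sum of \<open>m\<close> independent matrices with law \<open>\<mu>\<close>. The recursion conditions on all but the
  last summand, which is how every estimate below proceeds.
\<close>

primrec walk :: "nat \<Rightarrow> (nat \<Rightarrow> real^'q) measure" where
  "walk 0 = return (rect_mat p) (\<lambda>i\<in>{..<p}. 0)"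
| "walk (Suc m) = distr (walk m \<Otimes>\<^sub>M \<mu>) (rect_mat p) (\<lambda>(S, x). mat_add p S x)"

lemma sets_walk [simp]: "sets (walk m) = sets (rect_mat p)"
  by (cases m) auto

lemma borel_measurable_walk_iff: "f \<in> borel_measurable (walk m) \<longleftrightarrow> f \<in> borel_measurable (rect_mat p)"
  by (rule arg_cong[of _ _ "\<lambda>A. f \<in> A"]) (rule measurable_cong_sets[OF sets_walk refl])

lemma measurable_mat_add_walk:
  "(\<lambda>(S, x). mat_add p S x) \<in> walk m \<Otimes>\<^sub>M \<mu> \<rightarrow>\<^sub>M rect_mat p"
  using measurable_mat_add measurable_cong_sets[OF sets_pair_measure_cong[OF sets_walk sets_mu] refl]
  by blast

lemma prob_space_walk: "prob_space (walk m)"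
proof (induction m)
  case 0
  show ?case by (auto intro!: prob_space_return simp: rect_mat_def space_PiM)
next
  case (Suc m)
  interpret W: prob_space "walk m" by (rule Suc.IH)
  interpret pair_prob_space "walk m" \<mu> ..
  show ?case
    using P.prob_space_distr[OF measurable_mat_add_walk] by simp
qed

sublocale walk: prob_space "walk m" for m
  by (rule prob_space_walk)

lemma
  fixes f :: "(nat \<Rightarrow> real^'q) \<Rightarrow> 'b::{banach, second_countable_topology}"
  assumes f: "integrable (walk (Suc m)) f"
  shows integral_walk_Suc: "integral\<^sup>L (walk (Suc m)) f = (LINT S|walk m. (LINT x|\<mu>. f (mat_add p S x)))"
    and integrable_walk_Suc: "integrable (walk m) (\<lambda>S. (LINT x|\<mu>. f (mat_add p S x)))"
proof -
  interpret pair_prob_space "walk m" \<mu> ..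
  have mf: "f \<in> borel_measurable (rect_mat p)"
    using f borel_measurable_integrable borel_measurable_walk_iff by blast
  have int: "integrable (walk m \<Otimes>\<^sub>M \<mu>) (\<lambda>(S, x). f (mat_add p S x))"
    using f integrable_distr_eq[OF measurable_mat_add_walk mf] by (simp add: case_prod_beta')
  show "integrable (walk m) (\<lambda>S. (LINT x|\<mu>. f (mat_add p S x)))"
    using integrable_fst[OF int] by simp
  have "integral\<^sup>L (walk (Suc m)) f = (LINT z|(walk m \<Otimes>\<^sub>M \<mu>). (\<lambda>(S, x). f (mat_add p S x)) z)"
    using integral_distr[OF measurable_mat_add_walk mf] by (simp add: case_prod_beta')
  also have "\<dots> = (LINT S|walk m. (LINT x|\<mu>. f (mat_add p S x)))"
    using integral_fst[OF int] by simp
  finally show "integral\<^sup>L (walk (Suc m)) f = (LINT S|walk m. (LINT x|\<mu>. f (mat_add p S x)))" .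
qed

lemma zero_in_space_rect_mat: "(\<lambda>i\<in>{..<p}. 0 :: real^'q) \<in> space (rect_mat p)"
  by (auto simp: rect_mat_def space_PiM)

lemma integral_walk_0:
  fixes f :: "(nat \<Rightarrow> real^'q) \<Rightarrow> 'b::{banach, second_countable_topology}"
  assumes "f \<in> borel_measurable (walk 0)"
  shows "integral\<^sup>L (walk 0) f = f (\<lambda>i\<in>{..<p}. 0)"
  using assms zero_in_space_rect_mat borel_measurable_walk_iff[of f 0]
  by (simp add: integral_return del: sets_walk)

lemma integrable_walk_sqn_sq: "integrable (walk m) (\<lambda>S. (sqn p S)^2)"
proof (induction m)
  case 0
  have "(\<lambda>S. (sqn p S)^2) \<in> borel_measurable (rect_mat p)" by measurable
  then show ?case
    using zero_in_space_rect_mat by (simp add: integrable_iff_bounded nn_integral_return)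
next
  case (Suc m)
  interpret pair_prob_space "walk m" \<mu> ..
  have msq: "(\<lambda>S. (sqn p S)^2) \<in> borel_measurable (rect_mat p)" by measurable
  have mw: "(\<lambda>S. (sqn p S)^2) \<in> borel_measurable (walk m)" "(\<lambda>S. (sqn p S)^2) \<in> borel_measurable \<mu>"
    using msq borel_measurable_walk_iff measurable_rect_mat_iff by blast+
  define g where "g z = 8 * (sqn p (fst z))^2 + 8 * (sqn p (snd z))^2" for z :: "(nat \<Rightarrow> real^'q) \<times> (nat \<Rightarrow> real^'q)"
  have mg: "g \<in> borel_measurable (walk m \<Otimes>\<^sub>M \<mu>)"
    unfolding g_def
    by (intro borel_measurable_add borel_measurable_times borel_measurable_const
        measurable_compose[OF measurable_fst mw(1)] measurable_compose[OF measurable_snd mw(2)])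
  have "integrable (walk m \<Otimes>\<^sub>M \<mu>) g"
  proof (rule Fubini_integrable[OF mg])
    show "integrable (walk m) (\<lambda>x. LINT y|\<mu>. norm (g (x, y)))"
      using Suc.IH fourth_moment by (simp add: g_def prob_space abs_of_nonneg)
    show "AE x in walk m. integrable \<mu> (\<lambda>y. g (x, y))"
      using fourth_moment by (simp add: g_def)
  qed
  then have "integrable (walk m \<Otimes>\<^sub>M \<mu>) (\<lambda>z. (sqn p (case z of (S, x) \<Rightarrow> mat_add p S x))^2)"
  proof (rule Bochner_Integration.integrable_bound)
    show "(\<lambda>z. (sqn p (case z of (S, x) \<Rightarrow> mat_add p S x))^2) \<in> borel_measurable (walk m \<Otimes>\<^sub>M \<mu>)"
      by (rule measurable_compose[OF measurable_mat_add_walk msq])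
    have "(sqn p (mat_add p S x))^2 \<le> 8 * (sqn p S)^2 + 8 * (sqn p x)^2" for S x :: "nat \<Rightarrow> real^'q"
    proof -
      have "(sqn p (mat_add p S x))^2 \<le> (2 * sqn p S + 2 * sqn p x)^2"
        by (intro power_mono sqn_mat_add sqn_nonneg)
      also have "\<dots> \<le> 8 * (sqn p S)^2 + 8 * (sqn p x)^2"
        using zero_le_power2[of "sqn p S - sqn p x"] by (simp add: power2_sum power2_diff power_mult_distrib)
      finally show ?thesis .
    qed
    then show "AE z in walk m \<Otimes>\<^sub>M \<mu>. norm ((sqn p (case z of (S, x) \<Rightarrow> mat_add p S x))^2) \<le> norm (g z)"
      by (intro AE_I2) (auto simp: g_def)
  qed
  then show ?case
    by (simp add: integrable_distr_eq[OF measurable_mat_add_walk msq])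
qed

definition centred :: "real^'q^'q \<Rightarrow> nat \<Rightarrow> (nat \<Rightarrow> real^'q) \<Rightarrow> real" where
  "centred t m S = t \<bullet> gram p S - real m * (t \<bullet> second_moment)"

lemma centred_mat_add: "centred t (Suc m) (mat_add p S x) = centred t m S + increment t S x"
  by (simp add: centred_def increment_def gram_dev_eq inner_gram_mat_add algebra_simps)

lemma measurable_centred: "centred t m \<in> borel_measurable (walk k)"
  unfolding centred_def[abs_def] borel_measurable_walk_iff by measurable

lemma integrable_centred_sq: "integrable (walk k) (\<lambda>S. (centred t m S)^2)"
proof (rule Bochner_Integration.integrable_bound)
  define C D where "C = 2 * (onorm ((*v) t))^2" and "D = 2 * (real m * (t \<bullet> second_moment))^2"
  show "integrable (walk k) (\<lambda>S. C * (sqn p S)^2 + D)" using integrable_walk_sqn_sq by simp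
  show "(\<lambda>S. (centred t m S)^2) \<in> borel_measurable (walk k)"
    using measurable_centred by (rule borel_measurable_power)
  have "(centred t m S)^2 \<le> C * (sqn p S)^2 + D" for S
  proof -
    have "(centred t m S)^2 \<le> 2 * (t \<bullet> gram p S)^2 + D"
      using zero_le_power2[of "t \<bullet> gram p S + real m * (t \<bullet> second_moment)"]
      unfolding centred_def D_def by (simp add: power2_sum power2_diff)
    also have "(t \<bullet> gram p S)^2 \<le> (onorm ((*v) t))^2 * (sqn p S)^2"
      using power_mono[OF abs_inner_gram_le[of t p S], of 2] by (simp add: power_mult_distrib)
    finally show ?thesis by (simp add: C_def)
  qed
  then show "AE S in walk k. norm ((centred t m S)^2) \<le> norm (C * (sqn p S)^2 + D)"
    by (intro AE_I2) (simp, metis abs_ge_self order_trans)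
qed

lemma integrable_centred: "integrable (walk k) (centred t m)"
  by (rule walk.square_integrable_imp_integrable[OF measurable_centred integrable_centred_sq])

lemma integral_centred: "(LINT S|walk m. centred t m S) = 0"
proof (induction m)
  case 0
  show ?case
    unfolding integral_walk_0[OF measurable_centred] by (simp add: centred_def inner_gram)
next
  case (Suc m)
  have "(LINT S|walk (Suc m). centred t (Suc m) S) = (LINT S|walk m. (LINT x|\<mu>. centred t m S + increment t S x))"
    using integral_walk_Suc[OF integrable_centred] by (simp add: centred_mat_add)
  also have "\<dots> = (LINT S|walk m. centred t m S)"
    using integrable_increment integral_increment by (simp add: prob_space)
  finally show ?case using Suc.IH by simp
qed

lemma inner_gram_eq_centred: "t \<bullet> gram p S = centred t m S + real m * (t \<bullet> second_moment)"
  by (simp add: centred_def)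

lemma integral_walk_inner_gram: "(LINT S|walk m. t \<bullet> gram p S) = real m * (t \<bullet> second_moment)"
  and integrable_walk_inner_gram: "integrable (walk m) (\<lambda>S. t \<bullet> gram p S)"
  unfolding inner_gram_eq_centred[of t _ m] using integrable_centred[of m t m] integral_centred[of m t]
  by (simp_all add: walk.prob_space)

definition cross_var :: "real^'q^'q \<Rightarrow> real" where
  "cross_var t = cross_form t second_moment \<bullet> second_moment"

lemma integral_cond_var: "(LINT S|walk m. cond_var t S) = var_gram_dev t + real m * cross_var t / p"
  and integrable_cond_var: "integrable (walk m) (cond_var t)"
  unfolding cond_var_def[abs_def] cross_var_def
  using integrable_walk_inner_gram integral_walk_inner_gram by (simp_all add: walk.prob_space)

text \<open>
  The increments are orthogonal, and the mean of \<open>cond_var t\<close> under \<open>walk m\<close> is known exactly because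
  the mean of \<open>S'S\<close> is \<open>m r\<close>.
\<close>

lemma integral_centred_sq:
  "(LINT S|walk m. (centred t m S)^2) = real m * var_gram_dev t + real m * (real m - 1) / (2 * real p) * cross_var t"
proof (induction m)
  case 0
  show ?case
    unfolding integral_walk_0[OF borel_measurable_power[OF measurable_centred]]
    by (simp add: centred_def inner_gram)
next
  case (Suc m)
  have "(LINT S|walk (Suc m). (centred t (Suc m) S)^2) =
      (LINT S|walk m. (LINT x|\<mu>. (centred t m S + increment t S x)^2))"
    using integral_walk_Suc[OF integrable_centred_sq] by (simp add: centred_mat_add)
  also have "\<dots> = (LINT S|walk m. (centred t m S)^2 + cond_var t S)"
  proof (rule Bochner_Integration.integral_cong[OF refl])
    fix S
    have "(LINT x|\<mu>. (centred t m S + increment t S x)^2) =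
      (LINT x|\<mu>. (centred t m S)^2 + (increment t S x)^2 + 2 * centred t m S * increment t S x)"
      by (simp add: power2_sum)
    also have "\<dots> = (centred t m S)^2 + cond_var t S"
      using integrable_increment[of t S] integrable_increment_sq[of t S] integral_increment[of t S]
        integral_increment_sq[of t S] by (simp add: prob_space)
    finally show "(LINT x|\<mu>. (centred t m S + increment t S x)^2) = (centred t m S)^2 + cond_var t S" .
  qed
  also have "\<dots> = (LINT S|walk m. (centred t m S)^2) + (LINT S|walk m. cond_var t S)"
    by (rule Bochner_Integration.integral_add[OF integrable_centred_sq integrable_cond_var])
  also have "\<dots> = real (Suc m) * var_gram_dev t + real (Suc m) * (real (Suc m) - 1) / (2 * real p) * cross_var t"
    unfolding Suc.IH integral_cond_var using p_pos by (simp add: field_simps)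
  finally show ?case .
qed

text \<open>
  For \<open>S\<close> a single summand, this is \<open>p\<close> times the mean conditional variance of the inner product of
  \<open>t\<close> with \<open>S'x + x'S\<close>.
\<close>

lemma cross_var_nonneg: "0 \<le> cross_var t"
proof -
  have "cross_form t second_moment \<bullet> gram p S \<ge> 0" for S
  proof -
    have "0 \<le> (LINT x|\<mu>. (lin_form p (coef t S) x)^2)" by simp
    then show ?thesis unfolding integral_lin_form_coef_sq using p_pos by (simp add: zero_le_divide_iff)
  qed
  then have "0 \<le> (LINT S|walk 1. cross_form t second_moment \<bullet> gram p S)" by (intro Bochner_Integration.integral_nonneg) auto
  then show ?thesis by (simp only: integral_walk_inner_gram cross_var_def)
qed

lemma integral_abs_centred_le:
  "(LINT S|walk m. \<bar>centred t m S\<bar>) \<le> sqrt (real m * var_gram_dev t + real m ^ 2 / (2 * real p) * cross_var t)"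
proof -
  have "(LINT S|walk m. \<bar>centred t m S\<bar>)^2 \<le> (LINT S|walk m. \<bar>centred t m S\<bar>^2)"
  proof -
    have i1: "integrable (walk m) (\<lambda>S. \<bar>centred t m S\<bar>)" using integrable_centred by simp
    have i2: "integrable (walk m) (\<lambda>S. \<bar>centred t m S\<bar>^2)" using integrable_centred_sq by simp
    have "0 \<le> walk.variance m (\<lambda>S. \<bar>centred t m S\<bar>)" by (rule walk.variance_positive)
    then show ?thesis using walk.variance_eq[OF i1 i2] by simp
  qed
  also have "\<dots> = real m * var_gram_dev t + real m * (real m - 1) / (2 * real p) * cross_var t"
    using integral_centred_sq by simp
  also have "\<dots> \<le> real m * var_gram_dev t + real m ^ 2 / (2 * real p) * cross_var t"
    using cross_var_nonneg[of t] by (intro add_left_mono mult_right_mono divide_right_mono)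
      (auto simp: power2_eq_square mult_left_mono)
  finally show ?thesis by (rule real_le_rsqrt)
qed

definition sqn_sq_const :: real where
  "sqn_sq_const = 2 * var_gram_dev (mat 1) + cross_var (mat 1) + 2 * (mat 1 \<bullet> second_moment)^2"

lemma sqn_sq_const_nonneg: "0 \<le> sqn_sq_const"
  using var_gram_dev_nonneg[of "mat 1"] cross_var_nonneg[of "mat 1"] by (simp add: sqn_sq_const_def)

text \<open>
  The trace of \<open>S'S\<close> is its mean, which is proportional to \<open>m\<close>, plus a fluctuation whose second
  moment is at most of order \<open>m\<^sup>2\<close>.
\<close>

lemma integral_walk_sqn_sq_le: "(LINT S|walk m. (sqn p S)^2) \<le> real m ^ 2 * sqn_sq_const"
proof -
  define s where "s = mat 1 \<bullet> second_moment"
  have "(sqn p S)^2 \<le> 2 * (centred (mat 1) m S)^2 + 2 * (real m * s)^2" for S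
  proof -
    have "sqn p S = centred (mat 1) m S + real m * s"
      by (simp add: sqn_eq_inner_gram centred_def s_def)
    then show ?thesis
      using zero_le_power2[of "centred (mat 1) m S - real m * s"] by (simp add: power2_sum power2_diff)
  qed
  then have "(LINT S|walk m. (sqn p S)^2) \<le> (LINT S|walk m. 2 * (centred (mat 1) m S)^2 + 2 * (real m * s)^2)"
    using integrable_centred_sq integrable_walk_sqn_sq by (intro integral_mono) auto
  also have "\<dots> = 2 * (real m * var_gram_dev (mat 1) + real m * (real m - 1) / (2 * real p) * cross_var (mat 1)) + 2 * (real m * s)^2"
    using integrable_centred_sq integral_centred_sq by (simp add: walk.prob_space)
  also have "\<dots> \<le> real m ^ 2 * sqn_sq_const"
  proof -
    have m1: "real m \<le> real m ^ 2" by (cases m) (auto simp: power2_eq_square)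
    have "real m * var_gram_dev (mat 1) \<le> real m ^ 2 * var_gram_dev (mat 1)"
      using m1 var_gram_dev_nonneg by (intro mult_right_mono) auto
    moreover have "real m * (real m - 1) / (2 * real p) * cross_var (mat 1) \<le> real m ^ 2 / 2 * cross_var (mat 1)"
    proof (intro mult_right_mono cross_var_nonneg frac_le)
      show "real m * (real m - 1) \<le> real m ^ 2" by (simp add: power2_eq_square mult_left_mono)
    qed (use p_pos in auto)
    ultimately show ?thesis by (simp add: sqn_sq_const_def s_def power_mult_distrib algebra_simps)
  qed
  finally show ?thesis .
qed

definition char_walk :: "real^'q^'q \<Rightarrow> real \<Rightarrow> nat \<Rightarrow> complex" where
  "char_walk t \<tau> m = (CLINT S|walk m. iexp (\<tau> * centred t m S))"

text \<open>
  Given \<open>S\<close>, the next increment multiplies the exponential by \<open>1 - \<tau>\<^sup>2 cond_var t S / 2\<close> up to the error of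
  \<open>char_increment_bound\<close>. Replacing the conditional variance by its mean costs the mean absolute
  fluctuation of \<open>S'S\<close>, tested against \<open>K = cross_form t second_moment\<close>; replacing \<open>1 - v / 2\<close> by
  \<open>exp (-v / 2)\<close> costs \<open>(v / 2)\<^sup>2\<close>.
\<close>

lemma char_walk_step:
  assumes p2: "2 \<le> p" and tau: "0 \<le> \<tau>" and d: "0 < d"
    and v: "v = \<tau>^2 * (var_gram_dev t + real m * cross_var t / p)"
  shows "cmod (char_walk t \<tau> (Suc m) - of_real (exp (- v / 2)) * char_walk t \<tau> m) \<le>
    4 * \<tau>^2 * lindeberg t \<tau> + d * \<tau>^2 * (real m * cross_var t) / p + \<tau>^4 * pow4_const t * (real m ^ 2 * sqn_sq_const) / (d * p^2)
    + \<tau>^2 / (2 * p) * sqrt (real m * var_gram_dev (cross_form t second_moment)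
         + real m ^ 2 / (2 * real p) * cross_var (cross_form t second_moment))
    + (v / 2)^2"
proof -
  define K where "K = cross_form t second_moment"
  define Y where "Y S = iexp (\<tau> * centred t m S)" for S
  define \<psi> where "\<psi> S = (CLINT x|\<mu>. iexp (\<tau> * increment t S x))" for S
  define c where "c = exp (- v / 2)"
  define g where "g S = 4 * \<tau>^2 * lindeberg t \<tau> + d * \<tau>^2 * (K \<bullet> gram p S) / p
        + \<tau>^4 * pow4_const t * (sqn p S)^2 / (d * p^2) + \<tau>^2 / (2 * p) * \<bar>centred K m S\<bar> + (v / 2)^2" for S
  have v0: "0 \<le> v" using v var_gram_dev_nonneg cross_var_nonneg by simp
  have int: "complex_integrable (walk k) (\<lambda>S. iexp (\<tau> * centred t k S))" for k
    by (rule walk.integrable_iexp) (use measurable_centred in auto)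
  have step_eq: "(CLINT x|\<mu>. iexp (\<tau> * centred t (Suc m) (mat_add p S x))) = Y S * \<psi> S" for S
  proof -
    have "iexp (\<tau> * centred t (Suc m) (mat_add p S x)) = Y S * iexp (\<tau> * increment t S x)" for x
      by (simp add: centred_mat_add Y_def distrib_left flip: exp_add)
    then show ?thesis by (simp add: \<psi>_def)
  qed
  have int1: "complex_integrable (walk m) (\<lambda>S. Y S * \<psi> S)"
    using integrable_walk_Suc[OF int[of "Suc m"]] by (simp only: step_eq)
  have int2: "complex_integrable (walk m) (\<lambda>S. of_real c * Y S)"
    using int by (simp add: Y_def)
  have "char_walk t \<tau> (Suc m) - of_real c * char_walk t \<tau> m = (CLINT S|walk m. Y S * \<psi> S) - (CLINT S|walk m. of_real c * Y S)"
    unfolding char_walk_def integral_walk_Suc[OF int[of "Suc m"]] step_eq by (simp add: Y_def)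
  also have "\<dots> = (CLINT S|walk m. Y S * \<psi> S - of_real c * Y S)"
    using int1 int2 by (rule Bochner_Integration.integral_diff[symmetric])
  finally have eq: "char_walk t \<tau> (Suc m) - of_real c * char_walk t \<tau> m = \<dots>" .
  have bound: "cmod (Y S * \<psi> S - of_real c * Y S) \<le> g S" for S
  proof -
    have "cmod (Y S * \<psi> S - of_real c * Y S) = cmod (Y S) * cmod (\<psi> S - of_real c)"
      by (simp add: algebra_simps flip: norm_mult)
    also have "cmod (Y S) = 1" by (simp add: Y_def)
    also have "1 * cmod (\<psi> S - of_real c) \<le> cmod (\<psi> S - of_real (1 - \<tau>^2 * cond_var t S / 2))
        + cmod (of_real (1 - \<tau>^2 * cond_var t S / 2) - of_real (1 - v / 2)) + cmod (of_real (1 - v / 2) - of_real c)"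
    proof -
      have "cmod (a - e) \<le> cmod (a - b) + cmod (b - d) + cmod (d - e)" for a b d e
        using norm_triangle_ineq[of "a - b" "b - d"] norm_triangle_ineq[of "a - d" "d - e"] by simp
      then show ?thesis unfolding mult_1 .
    qed
    also have "cmod (of_real (1 - v / 2) - of_real c) \<le> (v / 2)^2"
      using exp_minus_bound[of "v / 2"] v0 unfolding of_real_diff[symmetric] norm_of_real
      by (simp add: c_def abs_minus_commute)
    also have "cmod (of_real (1 - \<tau>^2 * cond_var t S / 2) - of_real (1 - v / 2)) = \<tau>^2 / (2 * p) * \<bar>centred K m S\<bar>"
    proof -
      have "(1 - \<tau>^2 * cond_var t S / 2) - (1 - v / 2) = - (\<tau>^2 / (2 * p) * centred K m S)"
        using p_pos by (simp add: v cond_var_def centred_def K_def cross_var_def field_simps)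
      then show ?thesis unfolding of_real_diff[symmetric] norm_of_real by (simp add: abs_mult)
    qed
    finally show ?thesis
      using char_increment_bound[OF p2 tau d, of t S] by (simp add: \<psi>_def g_def K_def)
  qed
  have ints: "integrable (walk m) (\<lambda>S. K \<bullet> gram p S)" "integrable (walk m) (\<lambda>S. (sqn p S)^2)"
     "integrable (walk m) (\<lambda>S. \<bar>centred K m S\<bar>)"
    using integrable_walk_inner_gram integrable_walk_sqn_sq integrable_centred by auto
  then have int_g: "integrable (walk m) g" unfolding g_def by simp
  have "cmod (CLINT S|walk m. Y S * \<psi> S - of_real c * Y S) \<le> (LINT S|walk m. g S)"
    using int_g Bochner_Integration.integrable_diff[OF int1 int2] bound
    by (intro order_trans[OF integral_norm_bound] integral_mono integrable_norm) auto
  also have "(LINT S|walk m. g S) = 4 * \<tau>^2 * lindeberg t \<tau> + d * \<tau>^2 * (real m * cross_var t) / p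
        + \<tau>^4 * pow4_const t * (LINT S|walk m. (sqn p S)^2) / (d * p^2) + \<tau>^2 / (2 * p) * (LINT S|walk m. \<bar>centred K m S\<bar>) + (v / 2)^2"
    unfolding g_def using ints integral_walk_inner_gram[of m K]
    by (simp add: walk.prob_space) (simp add: K_def cross_var_def)
  also have "\<dots> \<le> 4 * \<tau>^2 * lindeberg t \<tau> + d * \<tau>^2 * (real m * cross_var t) / p
        + \<tau>^4 * pow4_const t * (real m ^ 2 * sqn_sq_const) / (d * p^2) + \<tau>^2 / (2 * p) * sqrt (real m * var_gram_dev K
         + real m ^ 2 / (2 * real p) * cross_var K) + (v / 2)^2"
    using integral_walk_sqn_sq_le[of m] integral_abs_centred_le[of m K] d tau pow4_const_nonneg[of t]
    by (intro add_mono order_refl mult_left_mono divide_right_mono) auto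
  finally show ?thesis using eq by (simp only: c_def K_def)
qed

end

context radial_measure
begin

text \<open>
  The sum of the one-step errors with \<open>d = 1 / sqrt n\<close>. With \<open>\<rho>\<close> and \<open>\<eta>\<close> bounded, every term tends to 0 as
  \<open>n\<close> and \<open>p\<close> grow and \<open>\<tau>\<close> tends to 0.
\<close>

lemma char_walk_bound:
  assumes p2: "2 \<le> p" and tau: "0 \<le> \<tau>" and n: "1 \<le> n"
    and rho: "\<rho> = real n * \<tau>^2" and lam: "\<eta> = \<tau>^2 * real n ^ 2 / p"
  shows "cmod (char_walk t \<tau> n - of_real (exp (- (\<rho> * var_gram_dev t + (\<eta> - \<eta> / n) / 2 * cross_var t) / 2))) \<le>
    4 * \<rho> * lindeberg t \<tau> + \<eta> * cross_var t / sqrt n + \<eta>^2 * pow4_const t * sqn_sq_const / sqrt n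
    + \<eta> / 2 * sqrt (var_gram_dev (cross_form t second_moment) / n + cross_var (cross_form t second_moment) / (2 * p))
    + (\<rho> * var_gram_dev t + \<eta> * cross_var t)^2 / (4 * n)"
proof -
  define K where "K = cross_form t second_moment"
  define d where "d = 1 / sqrt (real n)"
  define v where "v m = \<tau>^2 * (var_gram_dev t + real m * cross_var t / p)" for m
  define e where "e m = 4 * \<tau>^2 * lindeberg t \<tau> + d * \<tau>^2 * (real m * cross_var t) / p + \<tau>^4 * pow4_const t * (real m ^ 2 * sqn_sq_const) / (d * p^2)
    + \<tau>^2 / (2 * p) * sqrt (real m * var_gram_dev K + real m ^ 2 / (2 * real p) * cross_var K) + (v m / 2)^2" for m
  have n0: "real n > 0" and p0: "real p > 0" using n p_pos by auto
  have d0: "0 < d" using n0 by (simp add: d_def)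
  have v0: "0 \<le> v m" for m using var_gram_dev_nonneg cross_var_nonneg by (simp add: v_def)
  note [measurable] = measurable_centred
  have m0: "(\<lambda>S. iexp (\<tau> * centred t 0 S)) \<in> borel_measurable (walk 0)" by measurable
  have "char_walk t \<tau> 0 = 1"
    unfolding char_walk_def integral_walk_0[OF m0] by (simp add: centred_def inner_gram)
  then have "cmod (char_walk t \<tau> n - of_real (exp (- (\<Sum>m<n. v m) / 2))) \<le> (\<Sum>m<n. e m)"
  proof (rule telescoping_product_bound)
    show "0 \<le> v m" for m by (rule v0)
    show "cmod (char_walk t \<tau> (Suc m) - of_real (exp (- v m / 2)) * char_walk t \<tau> m) \<le> e m" for m
      unfolding e_def K_def by (rule char_walk_step[OF p2 tau d0 v_def])
  qed
  also have "(\<Sum>m<n. v m) = \<rho> * var_gram_dev t + (\<eta> - \<eta> / n) / 2 * cross_var t"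
  proof -
    have "(\<Sum>m<n. real m) = real n * (real n - 1) / 2"
      by (induction n) (auto simp: field_simps)
    moreover have "(\<Sum>m<n. v m) = real n * (\<tau>^2 * var_gram_dev t) + \<tau>^2 * cross_var t / p * (\<Sum>m<n. real m)"
    proof -
      have "v m = \<tau>^2 * var_gram_dev t + (\<tau>^2 * cross_var t / p) * real m" for m
        by (simp add: v_def distrib_left)
      then show ?thesis by (simp only: sum.distrib sum_distrib_left[symmetric]) simp
    qed
    ultimately have "(\<Sum>m<n. v m) = real n * (\<tau>^2 * var_gram_dev t) + \<tau>^2 * cross_var t / p * (real n * (real n - 1) / 2)"
      by (simp only:)
    also have "\<dots> = \<rho> * var_gram_dev t + (\<eta> - \<eta> / n) / 2 * cross_var t"
      using n0 p0 by (simp add: rho lam field_simps power2_eq_square)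
    finally show ?thesis .
  qed
  also have "(\<Sum>m<n. e m) \<le> (\<Sum>m<n. e n)"
  proof (intro sum_mono)
    fix m assume "m \<in> {..<n}"
    then have mn: "real m \<le> real n" by simp
    then have mn2: "real m ^ 2 \<le> real n ^ 2" by (simp add: power_mono)
    have vmn: "v m \<le> v n" unfolding v_def
      using mn cross_var_nonneg[of t] p0 by (intro mult_left_mono add_left_mono divide_right_mono mult_right_mono) auto
    have s: "real m * var_gram_dev K + real m ^ 2 / (2 * real p) * cross_var K \<le> real n * var_gram_dev K + real n ^ 2 / (2 * real p) * cross_var K"
      using mn mn2 var_gram_dev_nonneg cross_var_nonneg p0 by (intro add_mono mult_right_mono divide_right_mono) auto
    show "e m \<le> e n"
      unfolding e_def
      using mn mn2 cross_var_nonneg[of t] pow4_const_nonneg[of t] sqn_sq_const_nonneg d0 v0 vmn s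
      by (intro add_mono order_refl divide_right_mono mult_left_mono mult_right_mono power_mono
          real_sqrt_le_mono[OF s]) auto
  qed
  also have "(\<Sum>m<n. e n) = 4 * \<rho> * lindeberg t \<tau> + \<eta> * cross_var t / sqrt n + \<eta>^2 * pow4_const t * sqn_sq_const / sqrt n
    + \<eta> / 2 * sqrt (var_gram_dev K / n + cross_var K / (2 * p)) + (\<rho> * var_gram_dev t + \<eta> * cross_var t)^2 / (4 * n)"
  proof -
    have t1: "real n * (4 * \<tau>^2 * lindeberg t \<tau>) = 4 * \<rho> * lindeberg t \<tau>" by (simp add: rho)
    have t2: "real n * (d * \<tau>^2 * (real n * cross_var t) / p) = \<eta> * cross_var t / sqrt n"
      by (simp add: lam d_def power2_eq_square mult_ac)
    have t3: "real n * (\<tau>^4 * pow4_const t * (real n ^ 2 * sqn_sq_const) / (d * p^2)) = \<eta>^2 * pow4_const t * sqn_sq_const / sqrt n"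
    proof -
      have "1 / d = real n / sqrt n" using n0 by (simp add: d_def real_div_sqrt)
      then have "real n * (\<tau>^4 * pow4_const t * (real n ^ 2 * sqn_sq_const) / (d * p^2)) =
          real n * (\<tau>^4 * pow4_const t * (real n ^ 2 * sqn_sq_const) / p^2) * (real n / sqrt n)"
        by (metis (no_types, opaque_lifting) divide_divide_eq_left mult.commute times_divide_eq_left mult_1)
      then show ?thesis by (simp add: lam power2_eq_square power4_eq_xxxx)
    qed
    have sq: "sqrt (real n * var_gram_dev K + real n ^ 2 / (2 * real p) * cross_var K) = real n * sqrt (var_gram_dev K / n + cross_var K / (2 * p))"
    proof -
      have "real n * var_gram_dev K + real n ^ 2 / (2 * real p) * cross_var K = real n ^ 2 * (var_gram_dev K / n + cross_var K / (2 * p))"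
        using n0 p0 by (simp add: field_simps power2_eq_square)
      then show ?thesis by (simp add: real_sqrt_mult)
    qed
    have t4: "real n * (\<tau>^2 / (2 * p) * sqrt (real n * var_gram_dev K + real n ^ 2 / (2 * real p) * cross_var K))
        = \<eta> / 2 * sqrt (var_gram_dev K / n + cross_var K / (2 * p))"
      unfolding sq lam by (simp add: power2_eq_square mult_ac)
    have t5: "real n * (v n / 2)^2 = (\<rho> * var_gram_dev t + \<eta> * cross_var t)^2 / (4 * n)"
    proof -
      have "\<rho> * var_gram_dev t + \<eta> * cross_var t = real n * v n"
        by (simp add: rho lam v_def distrib_left power2_eq_square)
      then show ?thesis using n0 by (simp add: power2_eq_square)
    qed
    have "(\<Sum>m<n. e n) = real n * e n" by simp
    then show ?thesis unfolding e_def distrib_left t1 t2 t3 t4 t5 .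
  qed
  finally show ?thesis unfolding K_def .
qed

end

section \<open>From radial laws to the measure on the cone\<close>

text \<open>
  A set whose preimage under \<open>phi p\<close> is not measurable would receive mass 0 in the definition of the
  image measure, and so would its complement; this contradicts total mass 1.
\<close>

lemma measurable_phi_of_distr:
  fixes \<nu> :: "(real^'q^'q) measure"
  assumes prob: "prob_space \<nu>" and d: "distr \<mu> (restrict_space borel psd_cone) (phi p) = \<nu>"
  shows "phi p \<in> \<mu> \<rightarrow>\<^sub>M restrict_space borel psd_cone"
proof -
  define N :: "(real^'q^'q) measure" where "N = restrict_space borel psd_cone"
  define F where "F A = emeasure \<mu> (phi p -` A \<inter> space \<mu>)" for A
  interpret prob_space \<nu> by (rule prob)
  have sN: "space N = psd_cone" by (simp add: N_def space_restrict_space)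
  have phiN: "phi p x \<in> psd_cone" for x
    by (simp add: phi_def psd_sqrt_in_psd_cone gram_in_psd_cone)
  have sets\<nu>: "sets \<nu> = sets N" "space \<nu> = space N" using d by (auto simp: N_def)
  have em: "emeasure \<nu> A = (if A \<in> sets N \<and> measure_space (space N) (sets N) F then F A else 0)" for A
  proof -
    have "emeasure \<nu> = emeasure (measure_of (space N) (sets N) F)"
      using d unfolding distr_def N_def F_def by simp
    then show ?thesis
      by (simp add: emeasure_measure_of_conv sets.sigma_sets_eq sets.space_closed)
  qed
  have "emeasure \<nu> (space N) = 1" using emeasure_space_1 sets\<nu> by simp
  then have ms: "measure_space (space N) (sets N) F" using em[of "space N"] by (auto split: if_splits)
  have emF: "emeasure \<nu> A = F A" if "A \<in> sets N" for A using em ms that by simp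
  have "phi p -` A \<inter> space \<mu> \<in> sets \<mu>" if A: "A \<in> sets N" for A
  proof (rule ccontr)
    assume ns: "phi p -` A \<inter> space \<mu> \<notin> sets \<mu>"
    then have "F A = 0" by (simp add: F_def emeasure_notin_sets)
    moreover have "phi p -` (space N - A) \<inter> space \<mu> = space \<mu> - (phi p -` A \<inter> space \<mu>)"
      using phiN by (auto simp: sN)
    then have "phi p -` (space N - A) \<inter> space \<mu> \<notin> sets \<mu>"
      using ns by (metis Diff_Diff_Int Int_commute inf.absorb_iff2 inf_le2 sets.compl_sets)
    then have "F (space N - A) = 0" by (simp add: F_def emeasure_notin_sets)
    moreover have "emeasure \<nu> A + emeasure \<nu> (space N - A) = 1"
      using emeasure_space_1 A sets\<nu> sets.sets_into_space[OF A]
      by (subst plus_emeasure) (auto simp: Un_absorb1)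
    ultimately show False using emF A by simp
  qed
  then show ?thesis
    using phiN sN unfolding N_def[symmetric] by (intro measurableI) auto
qed

lemma
  fixes f :: "real^'q^'q \<Rightarrow> real"
  assumes prob: "prob_space \<nu>" and lift: "radial_lift p \<nu> \<mu>" and f: "f \<in> borel_measurable borel"
  shows integral_gram: "(LINT x|\<mu>. f (gram p x)) = (LINT s|\<nu>. f (s ** s))"
    and integrable_gram: "integrable \<mu> (\<lambda>x. f (gram p x)) \<longleftrightarrow> integrable \<nu> (\<lambda>s. f (s ** s))"
proof -
  have d: "distr \<mu> (restrict_space borel psd_cone) (phi p) = \<nu>" using lift by (simp add: radial_lift_def)
  note phi = measurable_phi_of_distr[OF prob d]
  have "(\<lambda>s::real^'q^'q. s ** s) \<in> borel_measurable borel"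
    unfolding matrix_matrix_mult_def by (intro borel_measurable_continuous_onI continuous_intros)
  then have m: "(\<lambda>s. f (s ** s)) \<in> borel_measurable (restrict_space borel psd_cone)"
    by (intro measurable_restrict_space1 measurable_compose[OF _ f])
  show "(LINT x|\<mu>. f (gram p x)) = (LINT s|\<nu>. f (s ** s))"
    unfolding d[symmetric] integral_distr[OF phi m] phi_mult_self ..
  show "integrable \<mu> (\<lambda>x. f (gram p x)) \<longleftrightarrow> integrable \<nu> (\<lambda>s. f (s ** s))"
    unfolding d[symmetric] integrable_distr_eq[OF phi m] phi_mult_self ..
qed

lemma norm_matrix_mult_le: "norm (A ** B) \<le> norm A * norm (B :: real^'q^'q)"
proof -
  have "(norm (A ** B))^2 = (\<Sum>i\<in>UNIV. \<Sum>j\<in>UNIV. (row i A \<bullet> column j B)^2)"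
    unfolding power2_norm_eq_inner
    by (simp add: inner_vec_def matrix_matrix_mult_def row_def column_def power2_eq_square)
  also have "\<dots> \<le> (\<Sum>i\<in>UNIV. \<Sum>j\<in>UNIV. (norm (row i A))^2 * (norm (column j B))^2)"
    by (intro sum_mono) (metis Cauchy_Schwarz_ineq power2_norm_eq_inner)
  also have "\<dots> = (\<Sum>i\<in>UNIV. (norm (row i A))^2) * (\<Sum>j\<in>UNIV. (norm (column j B))^2)"
    by (simp add: sum_product)
  also have "(\<Sum>i\<in>UNIV. (norm (row i A))^2) = (norm A)^2"
    by (simp add: power2_norm_eq_inner inner_vec_def row_def)
  also have "(\<Sum>j\<in>UNIV. (norm (column j B))^2) = (norm B)^2"
    unfolding power2_norm_eq_inner inner_vec_def column_def by (simp add: sum.swap[of "\<lambda>i j. B $ j $ i * B $ j $ i"])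
  finally have "(norm (A ** B))^2 \<le> (norm A * norm B)^2" by (simp add: power_mult_distrib)
  then show ?thesis by (rule power2_le_imp_le) simp
qed

context
  fixes \<nu> :: "(real^'q^'q) measure"
  assumes prob: "prob_space \<nu>" and sets: "sets \<nu> = sets (restrict_space borel psd_cone)"
    and int4: "integrable \<nu> (\<lambda>s. norm s ^ 4)"
begin

lemma measurable_of_square:
  assumes "f \<in> borel_measurable borel"
  shows "(\<lambda>s. f (s ** s)) \<in> borel_measurable \<nu>"
proof -
  have "(\<lambda>s::real^'q^'q. s ** s) \<in> borel_measurable borel"
    unfolding matrix_matrix_mult_def by (intro borel_measurable_continuous_onI continuous_intros)
  then have "(\<lambda>s. f (s ** s)) \<in> borel_measurable (restrict_space borel psd_cone)"
    by (intro measurable_restrict_space1 measurable_compose[OF _ assms])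
  then show ?thesis using measurable_cong_sets[OF sets refl] by blast
qed

lemma integrable_of_square:
  fixes f :: "real^'q^'q \<Rightarrow> 'b::{banach, second_countable_topology}"
  assumes "f \<in> borel_measurable borel" "\<And>y. norm (f y) \<le> C * (1 + (norm y)^2)" "0 \<le> C"
  shows "integrable \<nu> (\<lambda>s. f (s ** s))"
proof (rule Bochner_Integration.integrable_bound)
  interpret prob_space \<nu> by (rule prob)
  show "integrable \<nu> (\<lambda>s. C * (1 + norm s ^ 4))" using int4 by simp
  show "(\<lambda>s. f (s ** s)) \<in> borel_measurable \<nu>"
    by (rule measurable_of_square[OF assms(1)])
  have "norm (f (s ** s)) \<le> C * (1 + norm s ^ 4)" for s
  proof -
    have "(norm (s ** s))^2 \<le> (norm s * norm s)^2" by (intro power_mono norm_matrix_mult_le) auto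
    also have "\<dots> = norm s ^ 4" by (simp add: power2_eq_square power4_eq_xxxx)
    finally show ?thesis using assms(2)[of "s ** s"] assms(3) by (meson add_left_mono mult_left_mono order_trans)
  qed
  then show "AE s in \<nu>. norm (f (s ** s)) \<le> norm (C * (1 + norm s ^ 4))"
    by (intro AE_I2) (simp, metis abs_ge_self order_trans)
qed

lemma integrable_square: "integrable \<nu> (\<lambda>s. s ** s)"
proof -
  have "z \<le> 1 + z^2" for z :: real
  proof -
    have "z / 2 + z / 2 \<le> z * z + 1 / 4"
      using zero_le_power2[of "z - 1/2"] by (simp add: power2_eq_square algebra_simps)
    then show ?thesis unfolding power2_eq_square by linarith
  qed
  then show ?thesis by (intro integrable_of_square[of "\<lambda>y. y" 1]) auto
qed

lemma inner_r2: "t \<bullet> r2 \<nu> = (LINT s|\<nu>. t \<bullet> (s ** s))"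
  unfolding r2_def using integrable_square by simp

lemma r2_nth: "r2 \<nu> $ i $ j = (LINT s|\<nu>. (s ** s) $ i $ j)"
  using inner_r2[of "axis i (axis j 1)"] by (simp add: inner_axis')

lemma r2_symmetric: "r2 \<nu> $ i $ j = r2 \<nu> $ j $ i"
  unfolding r2_nth
proof (rule Bochner_Integration.integral_cong[OF refl])
  fix s assume "s \<in> space \<nu>"
  then have "s \<in> psd_cone"
    using sets_eq_imp_space_eq[OF sets] by (simp add: space_restrict_space)
  then have "transpose s = s" by (rule psd_coneD)
  then have "s $ a $ b = s $ b $ a" for a b by (metis transpose_def vec_lambda_beta)
  then show "(s ** s) $ i $ j = (s ** s) $ j $ i"
    by (simp add: matrix_matrix_mult_def mult.commute)
qed

lemma integrable_centred_square_prod: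
  "integrable \<nu> (\<lambda>s. (t \<bullet> (s ** s) - a) * (u \<bullet> (s ** s) - b))"
proof -
  define c d where "c = norm t + \<bar>a\<bar>" and "d = norm u + \<bar>b\<bar>"
  have "\<bar>(t \<bullet> y - a) * (u \<bullet> y - b)\<bar> \<le> (2 * c * d) * (1 + (norm y)^2)" for y
  proof -
    have lin: "\<bar>t \<bullet> y - a\<bar> \<le> (norm t + \<bar>a\<bar>) * (1 + norm y)" for t a
    proof -
      have "\<bar>t \<bullet> y - a\<bar> \<le> norm t * norm y + \<bar>a\<bar>"
        using Cauchy_Schwarz_ineq2[of t y] by linarith
      also have "\<dots> \<le> (norm t + \<bar>a\<bar>) * (1 + norm y)" by (simp add: algebra_simps)
      finally show ?thesis .
    qed
    have "\<bar>t \<bullet> y - a\<bar> \<le> c * (1 + norm y)" "\<bar>u \<bullet> y - b\<bar> \<le> d * (1 + norm y)"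
      unfolding c_def d_def by (rule lin)+
    then have "\<bar>(t \<bullet> y - a) * (u \<bullet> y - b)\<bar> \<le> (c * (1 + norm y)) * (d * (1 + norm y))"
      unfolding abs_mult by (intro mult_mono) (auto simp: c_def)
    also have "\<dots> = (c * d) * (1 + norm y)^2" by (simp add: power2_eq_square)
    also have "\<dots> \<le> (c * d) * (2 * (1 + (norm y)^2))"
      using zero_le_power2[of "norm y - 1"]
      by (intro mult_left_mono) (auto simp: c_def d_def power2_sum power2_diff)
    finally show ?thesis by (simp add: algebra_simps)
  qed
  then show ?thesis
    by (intro integrable_of_square[where f="\<lambda>y. (t \<bullet> y - a) * (u \<bullet> y - b)" and C="2 * c * d"])
       (auto simp: c_def d_def)
qed

lemma Sigma2_form: "flat t \<bullet> (Sigma2 \<nu> *v flat t) = (LINT s|\<nu>. (t \<bullet> (s ** s - r2 \<nu>))^2)"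
proof -
  have m: "(\<chi> i j. LINT s|\<nu>. (s ** s) $ i $ j) = r2 \<nu>" by (simp add: vec_eq_iff r2_nth)
  have "integrable \<nu> (\<lambda>s. ((s ** s) $ i $ j - a) * ((s ** s) $ k $ l - b))" for i j k l a b
    using integrable_centred_square_prod[of "axis i (axis j 1)" a "axis k (axis l 1)" b]
    by (simp add: inner_axis')
  from covariance_matrix_form[of \<nu> "\<lambda>s. s ** s", OF this, of t]
  show ?thesis unfolding Sigma2_def m .
qed

lemma radial_measure_of_lift:
  assumes lift: "radial_lift p \<nu> \<mu>" and p: "0 < p"
  shows "radial_measure \<mu> p"
proof -
  interpret prob_space \<mu> using lift by (simp add: radial_lift_def)
  have m: "(\<lambda>y::real^'q^'q. (mat 1 \<bullet> y)^2) \<in> borel_measurable borel" by measurable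
  have "integrable \<nu> (\<lambda>s. (mat 1 \<bullet> (s ** s))^2)"
    using integrable_centred_square_prod[of "mat 1" 0 "mat 1" 0] by (simp add: power2_eq_square)
  then have "integrable \<mu> (\<lambda>x. (sqn p x)^2)"
    unfolding sqn_eq_inner_gram using integrable_gram[OF prob lift m] by simp
  then show ?thesis
    using lift p by unfold_locales (auto simp: radial_lift_def)
qed

lemma
  assumes lift: "radial_lift p \<nu> \<mu>" and p: "0 < p"
  shows second_moment_eq: "radial_measure.second_moment \<mu> p = r2 \<nu>"
    and var_gram_dev_eq: "radial_measure.var_gram_dev \<mu> p t = (LINT s|\<nu>. (t \<bullet> (s ** s - r2 \<nu>))^2)"
    and lindeberg_eq: "radial_measure.lindeberg \<mu> p t \<tau> =
      (LINT s|\<nu>. min ((t \<bullet> (s ** s - r2 \<nu>))^2) (\<tau> * \<bar>t \<bullet> (s ** s - r2 \<nu>)\<bar>^3))"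
    and mean_sqn_sq_eq: "radial_measure.mean_sqn_sq \<mu> p = (LINT s|\<nu>. (mat 1 \<bullet> (s ** s))^2)"
proof -
  interpret radial_measure \<mu> p by (rule radial_measure_of_lift[OF lift p])
  note transfer = integral_gram[OF prob lift]
  show sm: "second_moment = r2 \<nu>"
  proof -
    have "second_moment $ i $ j = r2 \<nu> $ i $ j" for i j
      unfolding r2_nth second_moment_def vec_lambda_beta
      by (rule transfer) (intro borel_measurable_continuous_onI continuous_intros)
    then show ?thesis by (simp add: vec_eq_iff)
  qed
  show "var_gram_dev t = (LINT s|\<nu>. (t \<bullet> (s ** s - r2 \<nu>))^2)"
    unfolding var_gram_dev_def gram_dev_def sm by (rule transfer) measurable
  show "lindeberg t \<tau> = (LINT s|\<nu>. min ((t \<bullet> (s ** s - r2 \<nu>))^2) (\<tau> * \<bar>t \<bullet> (s ** s - r2 \<nu>)\<bar>^3))"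
    unfolding lindeberg_def gram_dev_def sm by (rule transfer) measurable
  show "mean_sqn_sq = (LINT s|\<nu>. (mat 1 \<bullet> (s ** s))^2)"
    unfolding mean_sqn_sq_def sqn_eq_inner_gram by (rule transfer) measurable
qed

lemma lindeberg_tendsto_0:
  assumes "\<tau> \<longlonglongrightarrow> 0" "\<And>n. 0 \<le> \<tau> n"
  shows "(\<lambda>n. LINT s|\<nu>. min ((t \<bullet> (s ** s - r2 \<nu>))^2) (\<tau> n * \<bar>t \<bullet> (s ** s - r2 \<nu>)\<bar>^3)) \<longlonglongrightarrow> 0"
proof -
  have "(\<lambda>n. LINT s|\<nu>. min ((t \<bullet> (s ** s - r2 \<nu>))^2) (\<tau> n * \<bar>t \<bullet> (s ** s - r2 \<nu>)\<bar>^3)) \<longlonglongrightarrow> (LINT s|\<nu>. 0)"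
  proof (rule integral_dominated_convergence[where w="\<lambda>s. (t \<bullet> (s ** s - r2 \<nu>))^2"])
    show "integrable \<nu> (\<lambda>s. (t \<bullet> (s ** s - r2 \<nu>))^2)"
      using integrable_centred_square_prod[of t "t \<bullet> r2 \<nu>" t "t \<bullet> r2 \<nu>"]
      by (simp add: power2_eq_square inner_diff_right)
    show "(\<lambda>s. min ((t \<bullet> (s ** s - r2 \<nu>))^2) (\<tau> n * \<bar>t \<bullet> (s ** s - r2 \<nu>)\<bar>^3)) \<in> borel_measurable \<nu>" for n
      by (rule measurable_of_square) measurable
    show "AE s in \<nu>. (\<lambda>n. min ((t \<bullet> (s ** s - r2 \<nu>))^2) (\<tau> n * \<bar>t \<bullet> (s ** s - r2 \<nu>)\<bar>^3)) \<longlonglongrightarrow> 0"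
    proof (rule AE_I2)
      fix s
      have "(\<lambda>n. min ((t \<bullet> (s ** s - r2 \<nu>))^2) (\<tau> n * \<bar>t \<bullet> (s ** s - r2 \<nu>)\<bar>^3)) \<longlonglongrightarrow>
          min ((t \<bullet> (s ** s - r2 \<nu>))^2) (0 * \<bar>t \<bullet> (s ** s - r2 \<nu>)\<bar>^3)"
        by (intro tendsto_intros assms(1))
      then show "(\<lambda>n. min ((t \<bullet> (s ** s - r2 \<nu>))^2) (\<tau> n * \<bar>t \<bullet> (s ** s - r2 \<nu>)\<bar>^3)) \<longlonglongrightarrow> 0" by simp
    qed
    show "AE s in \<nu>. norm (min ((t \<bullet> (s ** s - r2 \<nu>))^2) (\<tau> n * \<bar>t \<bullet> (s ** s - r2 \<nu>)\<bar>^3)) \<le> (t \<bullet> (s ** s - r2 \<nu>))^2" for n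
      using assms(2) by (intro AE_I2) (simp add: abs_of_nonneg)
  qed simp
  then show ?thesis by simp
qed

end

section \<open>The central limit theorem\<close>

lemma measurable_gram: "gram p \<in> borel_measurable (rect_mat p)"
  by (subst borel_measurable_euclidean_space) (simp add: inner_commute[of "gram p _"])

context radial_measure
begin

lemma
  assumes M: "prob_space M" and indep: "prob_space.indep_vars M (\<lambda>_. rect_mat p) X UNIV"
    and law: "\<And>k. distr M (rect_mat p) (X k) = \<mu>"
  shows measurable_partial_sum: "partial_sum p X n \<in> M \<rightarrow>\<^sub>M rect_mat p"
    and distr_partial_sum: "distr M (rect_mat p) (partial_sum p X n) = walk n"
proof -
  interpret M: prob_space M by (rule M)
  have X: "X k \<in> M \<rightarrow>\<^sub>M rect_mat p" for k
    using indep unfolding M.indep_vars_def by auto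
  have Y: "(\<lambda>f. \<lambda>i\<in>{..<p}. \<Sum>k<n. f k i) \<in> (\<Pi>\<^sub>M k\<in>{..<n}. rect_mat p) \<rightarrow>\<^sub>M (rect_mat p :: (nat \<Rightarrow> real^'q) measure)" for n
  proof -
    have "(\<lambda>f. f k i) \<in> borel_measurable (\<Pi>\<^sub>M k\<in>{..<n}. (rect_mat p :: (nat \<Rightarrow> real^'q) measure))"
      if "k \<in> {..<n}" "i \<in> {..<p}" for k i
      by (rule measurable_compose[OF measurable_component_singleton[OF that(1)] measurable_rect_mat_row[OF that(2)]])
    then have "(\<lambda>f. \<lambda>i\<in>{..<p}. \<Sum>k<n. f k i)
        \<in> (\<Pi>\<^sub>M k\<in>{..<n}. (rect_mat p :: (nat \<Rightarrow> real^'q) measure)) \<rightarrow>\<^sub>M (\<Pi>\<^sub>M i\<in>{..<p}. borel)"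
      by (intro measurable_restrict borel_measurable_sum)
    then show ?thesis by (simp add: rect_mat_def)
  qed
  have eqY: "partial_sum p X n = (\<lambda>f. \<lambda>i\<in>{..<p}. \<Sum>k<n. f k i) \<circ> (\<lambda>\<omega>. restrict (\<lambda>k. X k \<omega>) {..<n})" for n
    by (auto simp: partial_sum_def fun_eq_iff)
  show meas: "partial_sum p X n \<in> M \<rightarrow>\<^sub>M rect_mat p" for n
    unfolding eqY by (rule measurable_comp[OF measurable_restrict Y]) (rule X)
  show "distr M (rect_mat p) (partial_sum p X n) = walk n"
  proof (induction n)
    case 0
    have "partial_sum p X 0 = (\<lambda>_. \<lambda>i\<in>{..<p}. 0)" by (simp add: partial_sum_def fun_eq_iff)
    then show ?case using M.distr_const[OF zero_in_space_rect_mat] by (simp only: walk.simps)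
  next
    case (Suc n)
    have "M.indep_var (rect_mat p) (partial_sum p X n) (rect_mat p) ((\<lambda>f. f n) \<circ> (\<lambda>\<omega>. restrict (\<lambda>k. X k \<omega>) {n}))"
      unfolding eqY
      by (rule M.indep_var_compose[OF M.indep_var_restrict[OF indep, of "{..<n}" "{n}"] Y])
        (auto intro: measurable_component_singleton)
    moreover have "(\<lambda>f. f n) \<circ> (\<lambda>\<omega>. restrict (\<lambda>k. X k \<omega>) {n}) = X n" by (auto simp: fun_eq_iff)
    ultimately have "distr M (rect_mat p) (partial_sum p X n) \<Otimes>\<^sub>M distr M (rect_mat p) (X n)
        = distr M (rect_mat p \<Otimes>\<^sub>M rect_mat p) (\<lambda>\<omega>. (partial_sum p X n \<omega>, X n \<omega>))"
      by (simp add: M.indep_var_distribution_eq)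
    then have pair: "walk n \<Otimes>\<^sub>M \<mu> = distr M (rect_mat p \<Otimes>\<^sub>M rect_mat p) (\<lambda>\<omega>. (partial_sum p X n \<omega>, X n \<omega>))"
      by (simp add: Suc.IH law)
    have "partial_sum p X (Suc n) = (\<lambda>(S, x). mat_add p S x) \<circ> (\<lambda>\<omega>. (partial_sum p X n \<omega>, X n \<omega>))"
      by (auto simp: partial_sum_def mat_add_def fun_eq_iff)
    then have "distr M (rect_mat p) (partial_sum p X (Suc n)) =
        distr (distr M (rect_mat p \<Otimes>\<^sub>M rect_mat p) (\<lambda>\<omega>. (partial_sum p X n \<omega>, X n \<omega>))) (rect_mat p) (\<lambda>(S, x). mat_add p S x)"
      using meas X by (simp add: distr_distr[OF measurable_mat_add measurable_Pair])
    then show ?case by (simp add: pair)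
  qed
qed

end



text \<open>
  In terms of \<open>\<nu>\<close>, all constants in \<open>char_walk_bound\<close> are the same for every dimension, so the error tends
  to 0 and the characteristic functions converge to those of the normal distribution.
\<close>

lemma radial_clt:
  fixes \<nu> :: "(real^'q^'q) measure"
    and X :: "nat \<Rightarrow> nat \<Rightarrow> 'w \<Rightarrow> nat \<Rightarrow> real^'q"
  assumes prob: "prob_space \<nu>"
    and sets: "sets \<nu> = sets (restrict_space borel psd_cone)"
    and int4: "integrable \<nu> (\<lambda>s. norm s ^ 4)"
    and p0: "\<And>n. 0 < p n"
    and p_inf: "filterlim p at_top sequentially"
    and lift: "\<And>n. radial_lift (p n) \<nu> (\<mu> n)"
    and M: "\<And>n. prob_space (M n)"
    and indep: "\<And>n. prob_space.indep_vars (M n) (\<lambda>_. rect_mat (p n)) (X n) UNIV"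
    and law: "\<And>n k. distr (M n) (rect_mat (p n)) (X n k) = \<mu> n"
    and tau: "\<And>n. 0 \<le> \<tau> n"
    and rho_lim: "(\<lambda>n. real n * (\<tau> n)^2) \<longlonglongrightarrow> \<gamma>"
    and eta_lim: "(\<lambda>n. (\<tau> n)^2 * real n ^ 2 / real (p n)) \<longlonglongrightarrow> \<delta>"
  shows "tends_in_distribution M
     (\<lambda>n \<omega>. \<tau> n *\<^sub>R (gram (p n) (partial_sum (p n) (X n) n \<omega>) - real n *\<^sub>R r2 \<nu>))
     (centered_matrix_normal (\<gamma> *\<^sub>R Sigma2 \<nu> + \<delta> *\<^sub>R T2 \<nu>))"
proof -
  define V where "V t = (LINT s|\<nu>. (t \<bullet> (s ** s - r2 \<nu>))^2)" for t
  define Q where "Q t = cross_form t (r2 \<nu>) \<bullet> r2 \<nu>" for t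
  define L where "L t a = (LINT s|\<nu>. min ((t \<bullet> (s ** s - r2 \<nu>))^2) (a * \<bar>t \<bullet> (s ** s - r2 \<nu>)\<bar>^3))" for t a
  define C where "C t = 6 * real CARD('q)^3 * (LINT s|\<nu>. (mat 1 \<bullet> (s ** s))^2) * (onorm ((*v) (t + transpose t)))^4" for t :: "real^'q^'q"
  define D where "D = 2 * V (mat 1) + Q (mat 1) + 2 * (mat 1 \<bullet> r2 \<nu>)^2"
  define \<rho> where "\<rho> n = real n * (\<tau> n)^2" for n
  define \<eta> where "\<eta> n = (\<tau> n)^2 * real n ^ 2 / real (p n)" for n
  define \<Sigma> where "\<Sigma> = \<gamma> *\<^sub>R Sigma2 \<nu> + \<delta> *\<^sub>R T2 \<nu>"
  define Z where "Z n \<omega> = \<tau> n *\<^sub>R (gram (p n) (partial_sum (p n) (X n) n \<omega>) - real n *\<^sub>R r2 \<nu>)" for n \<omega>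
  have rad: "radial_measure (\<mu> n) (p n)" for n
    by (rule radial_measure_of_lift[OF prob sets int4 lift p0])
  have sm: "radial_measure.second_moment (\<mu> n) (p n) = r2 \<nu>" for n
    by (rule second_moment_eq[OF prob sets int4 lift p0])
  have va: "radial_measure.var_gram_dev (\<mu> n) (p n) t = V t" for n t
    unfolding V_def by (rule var_gram_dev_eq[OF prob sets int4 lift p0])
  have qu: "radial_measure.cross_var (\<mu> n) (p n) t = Q t" for n t
    unfolding radial_measure.cross_var_def[OF rad] sm Q_def ..
  have li: "radial_measure.lindeberg (\<mu> n) (p n) t a = L t a" for n t a
    unfolding L_def by (rule lindeberg_eq[OF prob sets int4 lift p0])
  have c4: "radial_measure.pow4_const (\<mu> n) (p n) t = C t" for n t
    unfolding radial_measure.pow4_const_def[OF rad] mean_sqn_sq_eq[OF prob sets int4 lift p0] C_def ..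
  have sq: "radial_measure.sqn_sq_const (\<mu> n) (p n) = D" for n
    unfolding radial_measure.sqn_sq_const_def[OF rad] va qu sm D_def ..
  have V0: "0 \<le> V t" for t by (simp add: V_def)
  have Q0: "0 \<le> Q t" for t using radial_measure.cross_var_nonneg[OF rad, of 0 t] unfolding qu .
  have gam0: "0 \<le> \<gamma>" by (rule LIMSEQ_le_const[OF rho_lim]) simp
  have del0: "0 \<le> \<delta>" by (rule LIMSEQ_le_const[OF eta_lim]) (simp add: p0)
  have form: "flat t \<bullet> (\<Sigma> *v flat t) = \<gamma> * V t + \<delta> * (Q t / 2)" for t
    unfolding \<Sigma>_def matrix_vector_mult_add_rdistrib inner_add_right scaleR_matrix_vector_assoc[symmetric]
      inner_scaleR_right Sigma2_form[OF prob sets int4] T2_form V_def Q_def ..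
  have psd: "\<Sigma> \<in> psd_cone"
  proof (rule psd_cone_flatI)
    show "transpose \<Sigma> = \<Sigma>"
      using r2_symmetric[OF prob sets int4]
      by (simp add: \<Sigma>_def Sigma2_def T2_def covariance_matrix_def transpose_def vec_eq_iff mult.commute)
    show "0 \<le> flat t \<bullet> (\<Sigma> *v flat t)" for t
      unfolding form using V0 Q0 gam0 del0 by simp
  qed
  have p_real: "filterlim (\<lambda>n. real (p n)) at_top sequentially"
    using filterlim_compose[OF filterlim_real_sequentially p_inf] .
  have inv_p: "(\<lambda>n. 1 / real (p n)) \<longlonglongrightarrow> 0"
    using tendsto_inverse_0_at_top[OF p_real] by (simp add: inverse_eq_divide)
  have inv_n: "(\<lambda>n. 1 / real n) \<longlonglongrightarrow> 0" by (rule lim_1_over_n)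
  have inv_sqrt: "(\<lambda>n. 1 / sqrt (real n)) \<longlonglongrightarrow> 0"
    using tendsto_real_sqrt[OF inv_n] by (simp add: real_sqrt_divide)
  note rl = rho_lim[folded \<rho>_def] and el = eta_lim[folded \<eta>_def]
  have "(\<lambda>n. \<rho> n * (1 / real n)) \<longlonglongrightarrow> 0" using tendsto_mult[OF rl inv_n] by simp
  then have "(\<lambda>n. (\<tau> n)^2) \<longlonglongrightarrow> 0"
  proof (rule Lim_transform_eventually)
    show "\<forall>\<^sub>F n in sequentially. \<rho> n * (1 / real n) = (\<tau> n)^2"
      using eventually_gt_at_top[of 0] by eventually_elim (simp add: \<rho>_def)
  qed
  then have "(\<lambda>n. sqrt ((\<tau> n)^2)) \<longlonglongrightarrow> sqrt 0" by (intro tendsto_real_sqrt)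
  then have tau0: "\<tau> \<longlonglongrightarrow> 0" using tau by simp
  have char_lim: "(\<lambda>n. radial_measure.char_walk (\<mu> n) (p n) t (\<tau> n) n)
      \<longlonglongrightarrow> of_real (exp (- (\<gamma> * V t + \<delta> * (Q t / 2)) / 2))" for t
  proof -
    define K where "K = cross_form t (r2 \<nu>)"
    define err where "err n = 4 * \<rho> n * L t (\<tau> n) + \<eta> n * Q t / sqrt n + (\<eta> n)^2 * C t * D / sqrt n
      + \<eta> n / 2 * sqrt (V K / n + Q K / (2 * p n)) + (\<rho> n * V t + \<eta> n * Q t)^2 / (4 * n)" for n
    define g where "g n = exp (- (\<rho> n * V t + (\<eta> n - \<eta> n / n) / 2 * Q t) / 2)" for n
    have "(\<lambda>n. 4 * \<rho> n * L t (\<tau> n) + \<eta> n * Q t * (1 / sqrt n) + (\<eta> n)^2 * C t * D * (1 / sqrt n)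
      + \<eta> n / 2 * sqrt (V K * (1 / n) + Q K / 2 * (1 / p n)) + (\<rho> n * V t + \<eta> n * Q t)^2 / 4 * (1 / n))
      \<longlonglongrightarrow> 4 * \<gamma> * 0 + \<delta> * Q t * 0 + \<delta>^2 * C t * D * 0 + \<delta> / 2 * sqrt (V K * 0 + Q K / 2 * 0)
        + (\<gamma> * V t + \<delta> * Q t)^2 / 4 * 0"
      unfolding L_def
      by (intro tendsto_intros rl el inv_n inv_p inv_sqrt lindeberg_tendsto_0[OF prob sets int4 tau0 tau]) simp_all
    then have err0: "err \<longlonglongrightarrow> 0" by (simp add: err_def[abs_def])
    have "(\<lambda>n. exp (- (\<rho> n * V t + (\<eta> n - \<eta> n * (1 / n)) / 2 * Q t) / 2))
       \<longlonglongrightarrow> exp (- (\<gamma> * V t + (\<delta> - \<delta> * 0) / 2 * Q t) / 2)"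
      by (intro tendsto_intros rl el inv_n) simp_all
    then have g_lim: "g \<longlonglongrightarrow> exp (- (\<gamma> * V t + \<delta> * (Q t / 2)) / 2)" by (simp add: g_def[abs_def])
    have "(\<lambda>n. radial_measure.char_walk (\<mu> n) (p n) t (\<tau> n) n - of_real (g n)) \<longlonglongrightarrow> 0"
    proof (rule Lim_null_comparison[OF _ err0])
      have "\<forall>\<^sub>F n in sequentially. 2 \<le> p n"
        using p_inf by (simp add: filterlim_at_top)
      moreover have "\<forall>\<^sub>F n in sequentially. 1 \<le> n" by (rule eventually_ge_at_top)
      ultimately show "\<forall>\<^sub>F n in sequentially. norm (radial_measure.char_walk (\<mu> n) (p n) t (\<tau> n) n - of_real (g n)) \<le> err n"
      proof eventually_elim
        case (elim n)
        show ?case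
          using radial_measure.char_walk_bound[OF rad elim(1) tau elim(2) \<rho>_def \<eta>_def, of t]
          unfolding va qu li c4 sq sm by (simp add: g_def err_def K_def)
      qed
    qed
    from tendsto_add[OF this tendsto_of_real[OF g_lim]] show ?thesis by simp
  qed
  have Zm: "Z n \<in> borel_measurable (M n)" for n
  proof -
    note ps = radial_measure.measurable_partial_sum[OF rad[of n] M[of n] indep[of n] law[of n], of n]
    have [measurable]: "(\<lambda>\<omega>. gram (p n) (partial_sum (p n) (X n) n \<omega>)) \<in> borel_measurable (M n)"
      by (rule measurable_compose[OF ps measurable_gram])
    show ?thesis unfolding Z_def by measurable
  qed
  have char_eq: "(CLINT y|distr (M n) borel (Z n). iexp (t \<bullet> y)) = radial_measure.char_walk (\<mu> n) (p n) t (\<tau> n) n" for n t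
  proof -
    interpret radial_measure "\<mu> n" "p n" by (rule rad)
    note ps = measurable_partial_sum[OF M[of n] indep[of n] law[of n], of n]
    have mc: "(\<lambda>S. iexp (\<tau> n * centred t n S)) \<in> borel_measurable (rect_mat (p n))"
      using measurable_centred[of t n 0] unfolding borel_measurable_walk_iff by measurable
    have "(CLINT y|distr (M n) borel (Z n). iexp (t \<bullet> y)) = (CLINT \<omega>|M n. iexp (t \<bullet> Z n \<omega>))"
      by (rule integral_distr[OF Zm]) measurable
    also have "\<dots> = (CLINT \<omega>|M n. iexp (\<tau> n * centred t n (partial_sum (p n) (X n) n \<omega>)))"
      by (simp add: Z_def centred_def sm inner_diff_right)
    also have "\<dots> = (CLINT S|distr (M n) (rect_mat (p n)) (partial_sum (p n) (X n) n). iexp (\<tau> n * centred t n S))"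
      by (rule integral_distr[OF ps mc, symmetric])
    finally show ?thesis unfolding distr_partial_sum[OF M[of n] indep[of n] law[of n]] char_walk_def .
  qed
  have "converges_weakly (\<lambda>n. distr (M n) borel (Z n)) (centered_matrix_normal \<Sigma>)"
  proof (rule levy_continuity_euclidean)
    show "prob_space (distr (M n) borel (Z n))" for n
      by (rule prob_space.prob_space_distr[OF M Zm])
    show "(\<lambda>n. CLINT x|distr (M n) borel (Z n). iexp (t \<bullet> x)) \<longlonglongrightarrow> (CLINT x|centered_matrix_normal \<Sigma>. iexp (t \<bullet> x))" for t
      unfolding char_eq char_centered_matrix_normal[OF psd] form by (rule char_lim)
  qed (auto simp: prob_space_centered_matrix_normal sets_centered_matrix_normal)
  then show ?thesis unfolding tends_in_distribution_def Z_def[abs_def] \<Sigma>_def .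
qed

theorem theorem1p2:
  fixes \<nu> :: "(real^'q^'q) measure"
    and p :: "nat \<Rightarrow> nat"
    and \<nu>p :: "nat \<Rightarrow> (nat \<Rightarrow> real^'q) measure"
    and M :: "nat \<Rightarrow> 'w measure"
    and X :: "nat \<Rightarrow> nat \<Rightarrow> 'w \<Rightarrow> nat \<Rightarrow> real^'q"
  assumes "prob_space \<nu>"
    and "sets \<nu> = sets (restrict_space borel psd_cone)"
    and "integrable \<nu> (\<lambda>s. norm s ^ 4)"
    and "\<And>n. CARD('q) \<le> p n"
    and "filterlim p at_top sequentially"
    and "\<And>d. CARD('q) \<le> d \<Longrightarrow> radial_lift d \<nu> (\<nu>p d)"
    and "\<And>d. CARD('q) \<le> d \<Longrightarrow> prob_space (M d)"
    and "\<And>d. CARD('q) \<le> d \<Longrightarrow> prob_space.indep_vars (M d) (\<lambda>_. rect_mat d) (X d) UNIV"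
    and "\<And>d k. CARD('q) \<le> d \<Longrightarrow> distr (M d) (rect_mat d) (X d k) = \<nu>p d"
  shows "(filterlim (\<lambda>n. real n / real (p n)) at_top sequentially \<longrightarrow>
            tends_in_distribution (\<lambda>n. M (p n))
              (\<lambda>n \<omega>. (sqrt (real (p n)) / real n) *\<^sub>R
                 (phi (p n) (partial_sum (p n) (X (p n)) n \<omega>) **
                  phi (p n) (partial_sum (p n) (X (p n)) n \<omega>) - real n *\<^sub>R (LINT s|\<nu>. s ** s)))
              (centered_matrix_normal (T2 \<nu>))) \<and>
         (\<forall>c\<ge>0. (\<lambda>n. real n / real (p n)) \<longlonglongrightarrow> c \<longrightarrow>
            tends_in_distribution (\<lambda>n. M (p n))
              (\<lambda>n \<omega>. (1 / sqrt (real n)) *\<^sub>R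
                 (phi (p n) (partial_sum (p n) (X (p n)) n \<omega>) **
                  phi (p n) (partial_sum (p n) (X (p n)) n \<omega>) - real n *\<^sub>R (LINT s|\<nu>. s ** s)))
              (centered_matrix_normal (Sigma2 \<nu> + c *\<^sub>R T2 \<nu>)))"
proof (intro conjI impI allI)
  have p0: "0 < p n" for n
    using assms(4)[of n] zero_less_card_finite[where 'a='q] by linarith
  note clt = radial_clt[OF assms(1-3) p0 assms(5) assms(6)[OF assms(4)] assms(7)[OF assms(4)]
      assms(8)[OF assms(4)] assms(9)[OF assms(4)], unfolded r2_def]
  {
    assume lim: "filterlim (\<lambda>n. real n / real (p n)) at_top sequentially"
    have "(\<lambda>n. real n * (sqrt (real (p n)) / real n)^2) \<longlonglongrightarrow> 0"
    proof (rule Lim_transform_eventually)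
      show "(\<lambda>n. inverse (real n / real (p n))) \<longlonglongrightarrow> 0"
        by (rule tendsto_inverse_0_at_top[OF lim])
      show "\<forall>\<^sub>F n in sequentially. inverse (real n / real (p n)) = real n * (sqrt (real (p n)) / real n)^2"
        using eventually_gt_at_top[of 0]
        by eventually_elim (simp add: power_divide field_simps power2_eq_square)
    qed
    moreover have "(\<lambda>n. (sqrt (real (p n)) / real n)^2 * real n ^ 2 / real (p n)) \<longlonglongrightarrow> 1"
    proof (rule tendsto_eventually)
      show "\<forall>\<^sub>F n in sequentially. (sqrt (real (p n)) / real n)^2 * real n ^ 2 / real (p n) = 1"
        using eventually_gt_at_top[of 0]
        by eventually_elim (use p0 in \<open>simp add: power_divide\<close>)
    qed
    ultimately show "tends_in_distribution (\<lambda>n. M (p n))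
              (\<lambda>n \<omega>. (sqrt (real (p n)) / real n) *\<^sub>R
                 (phi (p n) (partial_sum (p n) (X (p n)) n \<omega>) **
                  phi (p n) (partial_sum (p n) (X (p n)) n \<omega>) - real n *\<^sub>R (LINT s|\<nu>. s ** s)))
              (centered_matrix_normal (T2 \<nu>))"
      using clt[of "\<lambda>n. sqrt (real (p n)) / real n" 0 1] by (simp add: phi_mult_self)
  }
  fix c :: real
  assume lim: "(\<lambda>n. real n / real (p n)) \<longlonglongrightarrow> c"
  have "(\<lambda>n. real n * (1 / sqrt (real n))^2) \<longlonglongrightarrow> 1"
  proof (rule tendsto_eventually)
    show "\<forall>\<^sub>F n in sequentially. real n * (1 / sqrt (real n))^2 = 1"
      using eventually_gt_at_top[of 0] by eventually_elim (simp add: power_divide)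
  qed
  moreover have "(\<lambda>n. (1 / sqrt (real n))^2 * real n ^ 2 / real (p n)) \<longlonglongrightarrow> c"
  proof -
    have "(1 / sqrt (real n))^2 * real n ^ 2 = real n" for n
      by (cases "n = 0") (auto simp: power_divide power2_eq_square)
    then show ?thesis using lim by simp
  qed
  ultimately show "tends_in_distribution (\<lambda>n. M (p n))
              (\<lambda>n \<omega>. (1 / sqrt (real n)) *\<^sub>R
                 (phi (p n) (partial_sum (p n) (X (p n)) n \<omega>) **
                  phi (p n) (partial_sum (p n) (X (p n)) n \<omega>) - real n *\<^sub>R (LINT s|\<nu>. s ** s)))
              (centered_matrix_normal (Sigma2 \<nu> + c *\<^sub>R T2 \<nu>))"
    using clt[of "\<lambda>n. 1 / sqrt (real n)" 1 c] by (simp add: phi_mult_self)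
qed

end
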